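(* Let $n\ge2$ and let $m\ge1$ be an integer. There exists a constant $C=C(n,m)>0$ such that the following holds. Let $1\le p<\frac nm$, $1\le r\le p$ and $w\in A_r$, and put $p^*_m=\frac{np}{n-mp}$. If $r>1$, let $\sigma=w^{1-r'}$, $\tau_n=2^{n+1}$, and define $q_r$ by $$\frac1p-\frac1{q_r}=\frac mn\,\frac{\tau_n[\sigma]_{A_\infty}}{1+r(\tau_n[\sigma]_{A_\infty}-1)};$$ if $r=1$, let $q_1=p^*_m$. Then $$\|f-P_B^{m-1}f\|_{L^{q_r,\infty}\left(B,\frac{w(x)dx}{w(B)}\right)}\le C\,p^*_m\,[w]_{A_r}^{\frac1p}\,r(B)^m\left(\frac1{w(B)}\int_B|\nabla^mf(x)|^pw(x)\,dx\right)^{\frac1p}$$ for any ball $B\subset\mathbb{R}^n$ and any $f\in W^{m,1}(B)$.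
   Context: A weight is a non-negative locally integrable function on $\mathbb{R}^n$; $w(E)=\int_E w$; $r(B)$ is the radius of the ball $B$; $p'$ is the conjugate exponent, $\frac1p+\frac1{p'}=1$. $M$ is the Hardy–Littlewood maximal operator $Mf(x)=\sup_B\left(\frac1{|B|}\int_B|f|\right)\chi_B(x)$, supremum over all balls. $w\in A_p$ for $p>1$ means $[w]_{A_p}=\sup_B\left(\frac1{|B|}\int_Bw\right)\left(\frac1{|B|}\int_Bw^{1-p'}\right)^{p-1}<\infty$; $w\in A_1$ means $[w]_{A_1}=\|Mw/w\|_{L^\infty}<\infty$. $A_\infty=\bigcup_{p>1}A_p$, and $[w]_{A_\infty}=\sup_B\frac1{w(B)}\int_BM(w\chi_B)(x)\,dx$. Suprema are over all balls $B$. If $w\in A_r$ with $r>1$, then $\sigma=w^{1-r'}\in A_{r'}\subset A_\infty$. $\mathcal P_{m-1}(B)$ is the space of polynomials of degree at most $m-1$ in $n$ variables restricted to $B$, with inner product $\langle f,g\rangle_B=\frac1{|B|}\int_Bfg$. With $\{\phi_k\}_k$ an orthonormal basis of $\mathcal P_{m-1}(B)$, $P_B^{m-1}f(x)=\sum_k\left(\frac1{|B|}\int_Bf\phi_k\right)\phi_k(x)$. Also $|\nabla^mf|=\sum_{|\gamma|=m}|D^\gamma f|$ (multi-indices $\gamma$). The weak average is $$\|g\|_{L^{q,\infty}\left(B,\frac{w(x)dx}{w(B)}\right)}=\sup_{t>0}t\left(\frac{w(\{x\in B:|g(x)|>t\})}{w(B)}\right)^{\frac1q}.$$ *)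

theory Defs
  imports "HOL-Analysis.Analysis" "HOL-Probability.Essential_Supremum"
begin

section \<open>Weights\<close>

text \<open>
  Weights and all quantities built from them take values in \<open>[0, \<infinity>]\<close>. The power below has
  \<open>0 powr a = \<infinity>\<close> for \<open>a < 0\<close>; with the library's real power (where \<open>0 powr a = 0\<close>)
  a weight vanishing on a set of positive measure could wrongly have a finite
  Muckenhoupt constant. Arithmetic on \<open>ennreal\<close> has \<open>0 * \<infinity> = 0\<close> and \<open>0 / 0 = 0\<close>.
\<close>

definition epowr :: "ennreal \<Rightarrow> real \<Rightarrow> ennreal" where
  "epowr x a =
     (if a = 0 then 1
      else if x = 0 then (if a < 0 then \<infinity> else 0)
      else if x = \<infinity> then (if a < 0 then 0 else \<infinity>)
      else ennreal (enn2real x powr a))"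

definition balls :: "'a::metric_space set set" where
  "balls = {ball c \<rho> |c \<rho>. 0 < \<rho>}"

definition weight :: "('a::euclidean_space \<Rightarrow> ennreal) \<Rightarrow> bool" where
  "weight w \<longleftrightarrow> w \<in> borel_measurable lebesgue \<and>
     (\<forall>K. compact K \<longrightarrow> (\<integral>\<^sup>+x\<in>K. w x \<partial>lebesgue) < \<infinity>)"

definition wmeas :: "('a::euclidean_space \<Rightarrow> ennreal) \<Rightarrow> 'a set \<Rightarrow> ennreal" where
  "wmeas w E = (\<integral>\<^sup>+x\<in>E. w x \<partial>lebesgue)"

definition eavg :: "'a::euclidean_space set \<Rightarrow> ('a \<Rightarrow> ennreal) \<Rightarrow> ennreal" where
  "eavg B g = (\<integral>\<^sup>+x\<in>B. g x \<partial>lebesgue) / emeasure lebesgue B"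

definition maximal :: "('a::euclidean_space \<Rightarrow> ennreal) \<Rightarrow> 'a \<Rightarrow> ennreal" where
  "maximal g x = (SUP B\<in>balls. eavg B g * indicator B x)"

definition conj_exp :: "real \<Rightarrow> real" where
  "conj_exp p = p / (p - 1)"

text \<open>The constant \<open>[w]\<close> of the class \<open>A_p\<close>, for \<open>p \<ge> 1\<close>.\<close>

definition Ap_const :: "real \<Rightarrow> ('a::euclidean_space \<Rightarrow> ennreal) \<Rightarrow> ennreal" where
  "Ap_const p w =
     (if p = 1 then esssup lebesgue (\<lambda>x. maximal w x / w x)
      else (SUP B\<in>balls. eavg B w * epowr (eavg B (\<lambda>x. epowr (w x) (1 - conj_exp p))) (p - 1)))"

definition Ap_class :: "real \<Rightarrow> ('a::euclidean_space \<Rightarrow> ennreal) set" where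
  "Ap_class p = {w. weight w \<and> Ap_const p w < \<infinity>}"

definition Ainf_const :: "('a::euclidean_space \<Rightarrow> ennreal) \<Rightarrow> ennreal" where
  "Ainf_const w =
     (SUP B\<in>balls. (\<integral>\<^sup>+x\<in>B. maximal (\<lambda>y. w y * indicator B y) x \<partial>lebesgue) / wmeas w B)"

text \<open>The norm of \<open>g\<close> in weak \<open>L^q\<close> of \<open>B\<close> with respect to \<open>w(x)dx / w(B)\<close>.\<close>

definition weak_avg ::
    "real \<Rightarrow> 'a::euclidean_space set \<Rightarrow> ('a \<Rightarrow> ennreal) \<Rightarrow> ('a \<Rightarrow> real) \<Rightarrow> ennreal" where
  "weak_avg q B w g =
     (SUP t\<in>{0<..}. ennreal t * epowr (wmeas w {x \<in> B. \<bar>g x\<bar> > t} / wmeas w B) (1 / q))"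


section \<open>Polynomials and the projection onto them\<close>

text \<open>Multi-indices are functions \<open>'n \<Rightarrow> nat\<close> on the index type of the coordinates.\<close>

definition mi_order :: "('n::finite \<Rightarrow> nat) \<Rightarrow> nat" where
  "mi_order \<gamma> = (\<Sum>i\<in>UNIV. \<gamma> i)"

definition mi_monom :: "('n::finite \<Rightarrow> nat) \<Rightarrow> real^'n \<Rightarrow> real" where
  "mi_monom \<gamma> x = (\<Prod>i\<in>UNIV. (x $ i) ^ \<gamma> i)"

definition polys :: "nat \<Rightarrow> (real^'n::finite \<Rightarrow> real) set" where
  "polys d = range (\<lambda>a x. \<Sum>\<gamma> | mi_order \<gamma> \<le> d. a \<gamma> * mi_monom \<gamma> x)"

definition avg_inner :: "'a::euclidean_space set \<Rightarrow> ('a \<Rightarrow> real) \<Rightarrow> ('a \<Rightarrow> real) \<Rightarrow> real" where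
  "avg_inner B f g = (LINT x:B|lebesgue. f x * g x) / measure lebesgue B"

text \<open>
  A polynomial is determined by its restriction to a ball, so a polynomial on \<open>B\<close> is
  represented by the polynomial function on the whole space.
\<close>

definition orthonormal_basis :: "(real^'n::finite) set \<Rightarrow> nat \<Rightarrow> (real^'n \<Rightarrow> real) set \<Rightarrow> bool" where
  "orthonormal_basis B d \<Phi> \<longleftrightarrow>
     finite \<Phi> \<and> \<Phi> \<subseteq> polys d \<and>
     (\<forall>\<phi>\<in>\<Phi>. \<forall>\<psi>\<in>\<Phi>. avg_inner B \<phi> \<psi> = (if \<phi> = \<psi> then 1 else 0)) \<and>
     (\<forall>g\<in>polys d. \<exists>a. g = (\<lambda>x. \<Sum>\<phi>\<in>\<Phi>. a \<phi> * \<phi> x))"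

text \<open>The projection does not depend on the orthonormal basis that is chosen.\<close>

definition poly_proj ::
    "(real^'n::finite) set \<Rightarrow> nat \<Rightarrow> (real^'n \<Rightarrow> real) \<Rightarrow> real^'n \<Rightarrow> real" where
  "poly_proj B d f =
     (let \<Phi> = (SOME \<Phi>. orthonormal_basis B d \<Phi>) in (\<lambda>x. \<Sum>\<phi>\<in>\<Phi>. avg_inner B f \<phi> * \<phi> x))"


section \<open>Weak derivatives and the Sobolev space \<open>W^{m,1}\<close>\<close>

definition pderiv_dir :: "'n \<Rightarrow> (real^'n::finite \<Rightarrow> real) \<Rightarrow> real^'n \<Rightarrow> real" where
  "pderiv_dir i \<phi> x = frechet_derivative \<phi> (at x) (axis i 1)"

definition iter_pderiv :: "'n list \<Rightarrow> (real^'n::finite \<Rightarrow> real) \<Rightarrow> real^'n \<Rightarrow> real" where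
  "iter_pderiv is \<phi> = foldr pderiv_dir is \<phi>"

definition smooth :: "(real^'n::finite \<Rightarrow> real) \<Rightarrow> bool" where
  "smooth \<phi> \<longleftrightarrow> (\<forall>is x. iter_pderiv is \<phi> differentiable (at x))"

definition test_functions :: "(real^'n::finite) set \<Rightarrow> (real^'n \<Rightarrow> real) set" where
  "test_functions U =
     {\<phi>. smooth \<phi> \<and> compact (closure {x. \<phi> x \<noteq> 0}) \<and> closure {x. \<phi> x \<noteq> 0} \<subseteq> U}"

definition locally_integrable_on :: "('a::euclidean_space \<Rightarrow> real) \<Rightarrow> 'a set \<Rightarrow> bool" where
  "locally_integrable_on f U \<longleftrightarrow> (\<forall>K. compact K \<and> K \<subseteq> U \<longrightarrow> set_integrable lebesgue K f)"

text \<open>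
  A list \<open>is\<close> of coordinates represents the multi-index \<open>\<gamma>\<close> if every \<open>i\<close> occurs \<open>\<gamma> i\<close> times in it.
  As partial derivatives of smooth functions commute, all such lists give the same \<open>D^\<gamma> \<phi>\<close>.
\<close>

definition has_weak_deriv ::
    "(real^'n::finite) set \<Rightarrow> ('n \<Rightarrow> nat) \<Rightarrow> (real^'n \<Rightarrow> real) \<Rightarrow> (real^'n \<Rightarrow> real) \<Rightarrow> bool" where
  "has_weak_deriv U \<gamma> f g \<longleftrightarrow>
     locally_integrable_on f U \<and> locally_integrable_on g U \<and>
     (\<forall>\<phi>\<in>test_functions U. \<forall>is. (\<forall>i. count_list is i = \<gamma> i) \<longrightarrow>
        (LINT x:U|lebesgue. f x * iter_pderiv is \<phi> x)
          = (- 1) ^ mi_order \<gamma> * (LINT x:U|lebesgue. g x * \<phi> x))"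

definition sobolev_W1 :: "nat \<Rightarrow> (real^'n::finite) set \<Rightarrow> (real^'n \<Rightarrow> real) set" where
  "sobolev_W1 m U =
     {f. set_integrable lebesgue U f \<and>
         (\<forall>\<gamma>. mi_order \<gamma> \<le> m \<longrightarrow> (\<exists>g. has_weak_deriv U \<gamma> f g \<and> set_integrable lebesgue U g))}"

text \<open>The weak derivative is unique up to a null set of \<open>U\<close>.\<close>

definition weak_deriv ::
    "(real^'n::finite) set \<Rightarrow> ('n \<Rightarrow> nat) \<Rightarrow> (real^'n \<Rightarrow> real) \<Rightarrow> real^'n \<Rightarrow> real" where
  "weak_deriv U \<gamma> f = (SOME g. has_weak_deriv U \<gamma> f g)"

definition grad_abs :: "nat \<Rightarrow> (real^'n::finite) set \<Rightarrow> (real^'n \<Rightarrow> real) \<Rightarrow> real^'n \<Rightarrow> real" where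
  "grad_abs m U f x = (\<Sum>\<gamma> | mi_order \<gamma> = m. \<bar>weak_deriv U \<gamma> f x\<bar>)"


section \<open>Exponents\<close>

definition sobolev_exp :: "nat \<Rightarrow> nat \<Rightarrow> real \<Rightarrow> real" where
  "sobolev_exp n m p = real n * p / (real n - real m * p)"

text \<open>
  The relation that determines \<open>q\<close> from \<open>p\<close> and \<open>r\<close>; here \<open>T\<close> is \<open>\<tau> * [\<sigma>]\<close> with
  \<open>\<tau> = 2^(n+1)\<close>. For \<open>1 \<le> p < n/m\<close> its right-hand side is at most \<open>m/n < 1/p\<close>, so
  there is exactly one \<open>q\<close> and it is positive.
\<close>

definition is_qr :: "nat \<Rightarrow> real \<Rightarrow> real \<Rightarrow> (real^'n::finite \<Rightarrow> ennreal) \<Rightarrow> real \<Rightarrow> bool" where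
  "is_qr m p r w q \<longleftrightarrow>
     (if r = 1 then q = sobolev_exp CARD('n) m p
      else (let \<sigma> = (\<lambda>x. epowr (w x) (1 - conj_exp r));
                T = 2 ^ (CARD('n) + 1) * enn2real (Ainf_const \<sigma>)
            in 1 / p - 1 / q = real m / real CARD('n) * (T / (1 + r * (T - 1)))))"

end

theory Submission
  imports Defs
begin

text \<open>
  Pointwise, \<open>|f - P f|\<close> on a ball \<open>B\<close> of radius \<open>R\<close> is controlled by the dyadic Riesz potential
  \<open>I = \<Sum>\<^sub>k r\<^sub>k\<^sup>m\<^sup>-\<^sup>n \<integral>\<^bsub>B(x, r\<^sub>k)\<^esub> g\<close> of \<open>g = |\<nabla>\<^sup>m f| \<chi>\<^sub>B\<close>, where \<open>r\<^sub>k = 2R / 2\<^sup>k\<close>: average the Taylor polynomials of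
  \<open>f\<close> at \<open>x\<close> against smooth bumps on boxes shrinking to \<open>x\<close>. The difference of two tensor product bumps
  of equal mass is a sum of partial derivatives of tensor product test functions, so an integration
  by parts leaves only the derivatives of order \<open>m\<close>.

  For the weighted estimate of \<open>I\<close>, the \<open>A\<^sub>r\<close> condition gives two bounds for \<open>\<integral>\<^bsub>B(x, r\<^sub>k)\<^esub> g\<close>: one by
  a weighted maximal function at \<open>x\<close>, whose averages are normalized by \<open>w(B(x, 5 r\<^sub>k))\<close>, and one by the
  norm of \<open>g\<close> on \<open>B\<close> with the loss \<open>2\<^sup>k\<^sup>n\<^sup>s\<^sup>/\<^sup>p\<close>, where \<open>s = r - (r - 1) / (\<tau>\<^sub>n [\<sigma>])\<close>. Summing the smaller of the two
  over \<open>k\<close> costs the factor \<open>p\<^sup>*\<close>, and the normalization by the enlarged ball turns Vitali's covering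
  lemma into a weak type bound that does not see the doubling constant of \<open>w\<close>. No reverse Hoelder
  inequality is needed for the value of \<open>s\<close>: it is enough that \<open>\<sigma>\<close> decays along concentric
  balls, which follows by bounding \<open>M(\<sigma> \<chi>\<^sub>D)\<close> from below on dyadic shells of a ball \<open>D\<close>.
\<close>

section \<open>Smooth cut-off functions\<close>

text \<open>The constant may depend on \<open>n\<close> and \<open>m\<close> only, and the power of
  \<open>[w]\<close> must be exactly \<open>1 / p\<close>; hence no step may cost a doubling
  constant of \<open>w\<close>. At the largest scale the box sits at the centre of the ball and no
  longer depends on \<open>x\<close>, so there the averaged Taylor polynomial is a genuine
  polynomial in \<open>x\<close> of degree at most \<open>m - 1\<close>. Exchanging it for
  \<open>P f\<close> costs the mean of the error, and this mean is dominated by the term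
  \<open>k = 0\<close> of the potential. Bumps are tensor products because exchanging one factor
  then needs a primitive in one variable only, and this primitive is explicit: a difference of two
  smooth steps. With \<open>T = \<tau> [\<sigma>]\<close> and the \<open>s\<close> above,
  \<open>T s = 1 + r (T - 1)\<close>, so the relation for \<open>q_r\<close> reads
  \<open>1/p - 1/q_r = m / (n s)\<close>: the Sobolev relation with \<open>n s\<close> in place of
  the dimension. The two bounds, multiplied by the weight of scale \<open>k\<close>, decay like
  \<open>2^(-k m)\<close> and grow like \<open>2^(k (n s / p - m))\<close>. As
  \<open>s \<ge> 1\<close>, the growth rate is at least \<open>n / p - m\<close>, which is
  \<open>n\<close> divided by the Sobolev exponent of \<open>p\<close>; summing the geometric series
  produces the factor in the theorem.\<close>

primrec ndiff :: "nat \<Rightarrow> (real \<Rightarrow> real) \<Rightarrow> bool" where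
  "ndiff 0 u = True"
| "ndiff (Suc k) u = (\<exists>u'. (\<forall>x. (u has_real_derivative u' x) (at x)) \<and> ndiff k u')"

text \<open>Smoothness in one variable is kept apart from \<open>smooth\<close>. Derivatives enter
  \<open>ndiff\<close> as existential witnesses, so closure under sums, products and reciprocals is
  an induction that never evaluates \<open>deriv\<close>.\<close>

definition smooth1 :: "(real \<Rightarrow> real) \<Rightarrow> bool" where
  "smooth1 u \<longleftrightarrow> (\<forall>k. ndiff k u)"

lemma ndiff_SucI:
  assumes "\<And>x. (u has_real_derivative u' x) (at x)" "ndiff k u'"
  shows "ndiff (Suc k) u"
  unfolding ndiff.simps by (rule exI[where x = u']) (simp add: assms)

lemma ndiff_SucD: "ndiff (Suc k) u \<Longrightarrow> ndiff k u"
proof (induction k arbitrary: u)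
  case (Suc k)
  then show ?case
    by (metis ndiff.simps(2))
qed simp

lemma ndiff_const: "ndiff k (\<lambda>x. c)"
proof (induction k arbitrary: c)
  case (Suc k)
  show ?case
    by (rule ndiff_SucI[where u' = "\<lambda>x. 0"]) (use Suc in auto)
qed simp

lemma ndiff_affine: "ndiff k (\<lambda>x. a * x + c)"
proof (cases k)
  case (Suc j)
  show ?thesis
    unfolding Suc by (rule ndiff_SucI[where u' = "\<lambda>x. a"]) (auto intro!: derivative_eq_intros ndiff_const)
qed simp

lemma ndiff_add: "ndiff k u \<Longrightarrow> ndiff k v \<Longrightarrow> ndiff k (\<lambda>x. u x + v x)"
proof (induction k arbitrary: u v)
  case (Suc k)
  from Suc.prems obtain u' v' where
    *: "\<And>x. (u has_real_derivative u' x) (at x)" "ndiff k u'"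
       "\<And>x. (v has_real_derivative v' x) (at x)" "ndiff k v'" by auto
  show ?case
    by (rule ndiff_SucI[where u' = "\<lambda>x. u' x + v' x"]) (use * Suc.IH in \<open>auto intro!: derivative_eq_intros\<close>)
qed simp

lemma ndiff_mult: "ndiff k u \<Longrightarrow> ndiff k v \<Longrightarrow> ndiff k (\<lambda>x. u x * v x)"
proof (induction k arbitrary: u v)
  case (Suc k)
  from Suc.prems obtain u' v' where
    *: "\<And>x. (u has_real_derivative u' x) (at x)" "ndiff k u'"
       "\<And>x. (v has_real_derivative v' x) (at x)" "ndiff k v'" by auto
  have "ndiff k u" "ndiff k v"
    using Suc.prems ndiff_SucD by blast+
  with * show ?case
    by (intro ndiff_SucI[where u' = "\<lambda>x. u' x * v x + v' x * u x"])
       (auto intro!: ndiff_add Suc.IH DERIV_mult)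
qed simp

lemma ndiff_inverse:
  assumes "\<And>x. v x \<noteq> 0"
  shows "ndiff k v \<Longrightarrow> ndiff k (\<lambda>x. inverse (v x))"
proof (induction k)
  case (Suc k)
  from Suc.prems obtain v' where
    *: "\<And>x. (v has_real_derivative v' x) (at x)" "ndiff k v'" by auto
  have "ndiff k v"
    using Suc.prems ndiff_SucD by blast
  then have **: "ndiff k (\<lambda>x. inverse (v x))" by (rule Suc.IH)
  have "((\<lambda>x. inverse (v x)) has_real_derivative ((- 1) * v' x) * (inverse (v x) * inverse (v x))) (at x)" for x
    using * assms[of x] by (auto intro!: derivative_eq_intros simp: field_simps)
  moreover have "ndiff k (\<lambda>x. ((- 1) * v' x) * (inverse (v x) * inverse (v x)))"
    by (intro ndiff_mult ndiff_const * **)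
  ultimately show ?case
    by (rule ndiff_SucI)
qed simp

lemma ndiff_compose_affine: "ndiff k u \<Longrightarrow> ndiff k (\<lambda>x. u (a * x + c))"
proof (induction k arbitrary: u)
  case (Suc k)
  from Suc.prems obtain u' where
    *: "\<And>x. (u has_real_derivative u' x) (at x)" "ndiff k u'" by auto
  have "((\<lambda>x. u (a * x + c)) has_real_derivative a * u' (a * x + c)) (at x)" for x
  proof -
    have "((\<lambda>x. a * x + c) has_real_derivative a) (at x)"
      by (auto intro!: derivative_eq_intros)
    from DERIV_chain2[OF *(1) this] show ?thesis
      by (simp add: mult.commute)
  qed
  moreover have "ndiff k (\<lambda>x. a * u' (a * x + c))"
    by (intro ndiff_mult ndiff_const Suc.IH *)
  ultimately show ?case
    by (rule ndiff_SucI)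
qed simp

lemma smooth1_const: "smooth1 (\<lambda>x. c)"
  by (simp add: smooth1_def ndiff_const)

lemma smooth1_mult: "smooth1 u \<Longrightarrow> smooth1 v \<Longrightarrow> smooth1 (\<lambda>x. u x * v x)"
  by (simp add: smooth1_def ndiff_mult)

lemma smooth1_diff:
  assumes "smooth1 u" "smooth1 v"
  shows "smooth1 (\<lambda>x. u x - v x)"
proof -
  have "smooth1 (\<lambda>x. u x + (- 1) * v x)"
    using assms unfolding smooth1_def by (intro allI ndiff_add ndiff_mult ndiff_const) auto
  then show ?thesis by simp
qed

lemma smooth1_compose_affine: "smooth1 u \<Longrightarrow> smooth1 (\<lambda>x. u (a * x + c))"
  by (simp add: smooth1_def ndiff_compose_affine)

lemma smooth1_diff_power: "smooth1 (\<lambda>s. (x - s) ^ k)"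
proof (induction k)
  case (Suc k)
  have "smooth1 (\<lambda>s. (- 1) * s + x)"
    by (simp only: smooth1_def ndiff_affine simp_thms)
  then have "smooth1 (\<lambda>s. x - s)"
    by (rule back_subst[where P = smooth1]) auto
  with Suc show ?case
    by (simp add: smooth1_mult)
qed (simp add: smooth1_const)

lemma smooth1_DERIV:
  assumes "smooth1 u" "\<And>x. (u has_real_derivative u' x) (at x)"
  shows "smooth1 u'"
  unfolding smooth1_def
proof
  fix k
  from assms(1) have "ndiff (Suc k) u" by (simp add: smooth1_def del: ndiff.simps)
  then obtain v where v: "\<And>x. (u has_real_derivative v x) (at x)" "ndiff k v" by auto
  have "v = u'"
    using v(1) assms(2) DERIV_unique by blast
  with v show "ndiff k u'" by simp
qed

lemma smooth1_has_deriv: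
  assumes "smooth1 u"
  obtains u' where "smooth1 u'" "\<And>x. (u has_real_derivative u' x) (at x)"
proof -
  from assms have "ndiff (Suc 0) u" by (simp add: smooth1_def del: ndiff.simps)
  then obtain u' where u': "\<And>x. (u has_real_derivative u' x) (at x)" by auto
  with smooth1_DERIV[OF assms] that show ?thesis by blast
qed

lemma smooth1_family_deriv:
  assumes "\<And>i. smooth1 (u i)"
  shows "\<exists>u'. \<forall>i. smooth1 (u' i) \<and> (\<forall>x. (u i has_real_derivative u' i x) (at x))"
proof -
  have "\<exists>v. smooth1 v \<and> (\<forall>x. (u i has_real_derivative v x) (at x))" for i
    by (rule smooth1_has_deriv[OF assms[of i]]) (rule exI, rule conjI, assumption, simp)
  then show ?thesis
    by (intro choice allI)
qed

lemma smooth1_isCont: "smooth1 u \<Longrightarrow> isCont u x"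
  by (meson DERIV_isCont smooth1_has_deriv)

lemma smooth1_continuous_on: "smooth1 u \<Longrightarrow> continuous_on A u"
  by (simp add: continuous_at_imp_continuous_on smooth1_isCont)

section \<open>A smooth step and its derivative\<close>

definition flat :: "real \<Rightarrow> real" where
  "flat x = (if x \<le> 0 then 0 else exp (- (1 / x)))"

lemma poly_times_exp_minus_tendsto_0: "((\<lambda>y. poly P y * exp (- y)) \<longlongrightarrow> (0::real)) at_top"
proof -
  have "((\<lambda>y. \<Sum>i\<le>degree P. coeff P i * (y ^ i / exp y)) \<longlongrightarrow> (\<Sum>i\<le>degree P. coeff P i * 0)) at_top"
    by (intro tendsto_intros tendsto_power_div_exp_0)
  then show ?thesis
    by (simp add: poly_altdef exp_minus sum_distrib_right field_simps sum_divide_distrib)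
qed

text \<open>The induction needs the whole class \<open>P (1 / x) * exp (- (1 / x))\<close>, extended
  by zero. It is closed under differentiation, which replaces \<open>P\<close> by
  \<open>Q = X^2 * (P - P')\<close>; \<open>flat\<close> is the member \<open>P = 1\<close>.\<close>

lemma ndiff_poly_flat: "ndiff k (\<lambda>x. if x \<le> 0 then 0 else poly P (1 / x) * exp (- (1 / x)))"
proof (induction k arbitrary: P)
  case (Suc k)
  define u where "u = (\<lambda>P x. if x \<le> 0 then 0 else poly P (1 / x) * exp (- (1 / x)) :: real)"
  define Q where "Q = [:0, 0, 1:] * (P - pderiv P)"
  have "(u P has_real_derivative u Q x) (at x)" for x
  proof -
    consider "x < 0" | "x = 0" | "x > 0" by linarith
    then show ?thesis
    proof cases
      case 1
      have "u Q x = 0"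
        using 1 by (simp add: u_def)
      then have "((\<lambda>x. 0) has_real_derivative u Q x) (at x)" by simp
      then show ?thesis
        by (rule has_field_derivative_transform_within_open[where S = "{..<0}"]) (use 1 in \<open>auto simp: u_def\<close>)
    next
      case 3
      have "((\<lambda>x. poly P (1 / x) * exp (- (1 / x))) has_real_derivative u Q x) (at x)"
      proof -
        have i: "((\<lambda>x. 1 / x) has_real_derivative - (1 / x\<^sup>2)) (at x)"
          using 3 by (auto intro!: derivative_eq_intros simp: power2_eq_square)
        have p: "((\<lambda>x. poly P (1 / x)) has_real_derivative poly (pderiv P) (1 / x) * (- (1 / x\<^sup>2))) (at x)"
          by (rule DERIV_chain2[OF poly_DERIV i])
        have e: "((\<lambda>x. exp (- (1 / x))) has_real_derivative exp (- (1 / x)) * (1 / x\<^sup>2)) (at x)"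
          using DERIV_chain2[OF DERIV_exp DERIV_minus[OF i]] by simp
        show ?thesis
          using DERIV_mult[OF p e] 3
          by (simp add: u_def Q_def field_simps power2_eq_square)
      qed
      then show ?thesis
        by (rule has_field_derivative_transform_within_open[where S = "{0<..}"]) (use 3 in \<open>auto simp: u_def\<close>)
    next
      case 2
      \<comment> \<open>The right difference quotient at \<open>0\<close> belongs to the same class:
        \<open>pCons 0 P\<close> absorbs the factor \<open>1 / h\<close>, and the exponential beats
        every polynomial.\<close>
      have lim: "((\<lambda>h. poly (pCons 0 P) (inverse h) * exp (- inverse h)) \<longlongrightarrow> (0::real)) (at_right 0)"
        by (rule filterlim_compose[OF poly_times_exp_minus_tendsto_0 filterlim_inverse_at_top_right])
      have "((\<lambda>h. (u P (0 + h) - u P 0) / h) \<longlongrightarrow> 0) (at_right 0)"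
        by (rule Lim_transform_eventually[OF lim])
           (auto simp: eventually_at_filter u_def field_simps)
      moreover have "((\<lambda>h. (u P (0 + h) - u P 0) / h) \<longlongrightarrow> 0) (at_left 0)"
        by (rule Lim_transform_eventually[where f = "\<lambda>_. 0"])
           (auto simp: eventually_at_filter u_def)
      ultimately have "((\<lambda>h. (u P (0 + h) - u P 0) / h) \<longlongrightarrow> 0) (at 0)"
        by (simp add: filterlim_at_split)
      then show ?thesis
        using 2 by (simp add: DERIV_def) (simp add: u_def)
    qed
  qed
  moreover have "ndiff k (u Q)"
    unfolding u_def by (rule Suc.IH)
  ultimately show ?case
    unfolding u_def by (rule ndiff_SucI)
qed simp

lemma smooth1_flat: "smooth1 flat"
  unfolding smooth1_def
proof
  fix k show "ndiff k flat"
    using ndiff_poly_flat[of k "[:1:]"] by (simp add: flat_def[abs_def] cong: if_cong)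
qed

text \<open>The usual transition from \<open>0\<close> to \<open>1\<close> on the unit interval. The
  denominator is positive because \<open>x\<close> and \<open>1 - x\<close> are never both
  nonpositive.\<close>

definition step :: "real \<Rightarrow> real" where
  "step x = flat x * inverse (flat x + flat (1 - x))"

lemma flat_nonneg: "flat x \<ge> 0"
  by (simp add: flat_def)

lemma flat_mono: "x \<le> y \<Longrightarrow> flat x \<le> flat y"
  by (auto simp: flat_def frac_le)

lemma flat_sum_pos: "flat x + flat (1 - x) > 0"
  by (auto simp: flat_def add_pos_pos)

lemma smooth1_step: "smooth1 step"
proof -
  have "smooth1 (\<lambda>x. flat ((- 1) * x + 1))"
    by (rule smooth1_compose_affine[OF smooth1_flat])
  then have "smooth1 (\<lambda>x. flat (1 - x))"
    by (rule back_subst[where P = smooth1]) auto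
  with smooth1_flat have "ndiff k (\<lambda>x. flat x * inverse (flat x + flat (1 - x)))" for k
    using flat_sum_pos unfolding smooth1_def
    by (intro ndiff_mult ndiff_inverse ndiff_add) (auto simp: less_imp_neq[symmetric])
  then show ?thesis
    by (simp add: smooth1_def step_def[abs_def])
qed

lemma step_eq_0: "x \<le> 0 \<Longrightarrow> step x = 0"
  by (simp add: step_def flat_def)

lemma step_eq_1: "x \<ge> 1 \<Longrightarrow> step x = 1"
  by (simp add: step_def flat_def)

lemma step_bounds: "0 \<le> step x" "step x \<le> 1"
  using flat_nonneg[of x] flat_nonneg[of "1 - x"] flat_sum_pos[of x]
  by (simp_all add: step_def divide_inverse[symmetric] pos_divide_le_eq)

lemma step_mono:
  assumes "x \<le> y"
  shows "step x \<le> step y"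
proof -
  have "flat x * flat (1 - y) \<le> flat y * flat (1 - x)"
    using assms by (intro mult_mono flat_mono flat_nonneg) auto
  then show ?thesis
    using flat_sum_pos[of x] flat_sum_pos[of y]
    by (simp add: step_def field_simps)
qed

text \<open>A bump that is by definition a derivative has an explicit primitive. The difference of
  two rescaled bumps then has as primitive a difference of two steps, which is bounded by
  \<open>1\<close> and has compact support.\<close>

definition bump :: "real \<Rightarrow> real" where
  "bump = deriv step"

lemma step_DERIV: "(step has_real_derivative bump x) (at x)"
  unfolding bump_def using smooth1_has_deriv[OF smooth1_step] DERIV_imp_deriv by metis

lemma smooth1_bump: "smooth1 bump"
  by (rule smooth1_DERIV[OF smooth1_step step_DERIV])

lemma bump_nonneg: "bump x \<ge> 0"
proof (rule ccontr)
  assume "\<not> bump x \<ge> 0"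
  then obtain d where "d > 0" "\<And>h. h > 0 \<Longrightarrow> h < d \<Longrightarrow> step (x + h) < step x"
    using DERIV_neg_dec_right[OF step_DERIV[of x]] by auto
  then have "step (x + d / 2) < step x" by simp
  with step_mono[of x "x + d / 2"] \<open>d > 0\<close> show False by simp
qed

lemma bump_eq_0:
  assumes "x \<notin> {0..1}"
  shows "bump x = 0"
proof -
  have "(step has_real_derivative 0) (at x)"
  proof (cases "x < 0")
    case True
    have "((\<lambda>_. 0) has_real_derivative 0) (at x)" by simp
    from has_field_derivative_transform_within_open[OF this, of "{..<0}" step] True show ?thesis
      by (auto simp: step_eq_0)
  next
    case False
    have "((\<lambda>_. 1) has_real_derivative 0) (at x)" by simp
    from has_field_derivative_transform_within_open[OF this, of "{1<..}" step] False assms show ?thesis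
      by (auto simp: step_eq_1)
  qed
  then show ?thesis
    using DERIV_unique[OF step_DERIV[of x]] by simp
qed

lemma bump_bounded: obtains M where "M \<ge> 1" "\<And>x. \<bar>bump x\<bar> \<le> M"
proof -
  have "compact (bump ` {0..1})"
    by (intro compact_continuous_image smooth1_continuous_on smooth1_bump) simp
  then obtain M where M: "\<And>x. x \<in> {0..1} \<Longrightarrow> \<bar>bump x\<bar> \<le> M"
    using compact_imp_bounded bounded_iff by (metis image_eqI real_norm_def)
  have "\<bar>bump x\<bar> \<le> max M 1" for x
    using M[of x] bump_eq_0[of x] by (cases "x \<in> {0..1}") auto
  with that[of "max M 1"] show ?thesis by auto
qed

lemma bump_pos: obtains x where "bump x > 0"
proof -
  obtain z where "step 1 - step 0 = (1 - 0) * bump z"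
    using MVT2[of 0 1 step bump] step_DERIV by auto
  then have "bump z = 1"
    by (simp add: step_eq_0 step_eq_1)
  with that[of z] show ?thesis by simp
qed

section \<open>Tensor products as test functions\<close>

text \<open>This class of test functions is closed under partial derivatives, each of which affects
  a single factor, and two of its members can be connected by exchanging one factor at a
  time.\<close>

definition tens :: "('n \<Rightarrow> real \<Rightarrow> real) \<Rightarrow> real^'n::finite \<Rightarrow> real" where
  "tens u z = (\<Prod>i\<in>UNIV. u i (z $ i))"

lemma tens_split: "tens u z = u i (z $ i) * (\<Prod>j\<in>UNIV - {i}. u j (z $ j))"
  unfolding tens_def by (rule prod.remove) auto

lemma tens_fun_upd: "tens (u(i := v)) z = v (z $ i) * (\<Prod>j\<in>UNIV - {i}. u j (z $ j))"
  by (subst tens_split[of _ _ i]) (auto intro!: prod.cong)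

lemma tens_has_derivative:
  fixes u :: "'n::finite \<Rightarrow> real \<Rightarrow> real"
  assumes "\<And>i x. (u i has_real_derivative v i x) (at x)"
  shows "(tens u has_derivative (\<lambda>h. \<Sum>i\<in>UNIV. h $ i * tens (u(i := v i)) z)) (at z)"
proof -
  have "((\<lambda>z. u i (z $ i)) has_derivative (\<lambda>h. h $ i * v i (z $ i))) (at z)" for i
  proof -
    have "((\<lambda>z. z $ i) has_derivative (\<lambda>h. h $ i)) (at z)"
      by (rule bounded_linear.has_derivative[OF bounded_linear_vec_nth has_derivative_ident])
    from has_derivative_compose[OF this assms[of i "z $ i", unfolded has_field_derivative_def]]
    show ?thesis by (simp add: mult.commute)
  qed
  then have "((\<lambda>z. \<Prod>i\<in>UNIV. u i (z $ i)) has_derivative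
      (\<lambda>h. \<Sum>i\<in>UNIV. (h $ i * v i (z $ i)) * (\<Prod>j\<in>UNIV - {i}. u j (z $ j)))) (at z)"
    by (rule has_derivative_prod)
  then show ?thesis
    by (simp add: tens_fun_upd mult.assoc) (simp add: tens_def[abs_def])
qed

lemma pderiv_dir_tens:
  fixes u :: "'n::finite \<Rightarrow> real \<Rightarrow> real"
  assumes "\<And>i x. (u i has_real_derivative v i x) (at x)"
  shows "pderiv_dir i (tens u) = tens (u(i := v i))"
proof
  fix z
  have "frechet_derivative (tens u) (at z) = (\<lambda>h. \<Sum>i\<in>UNIV. h $ i * tens (u(i := v i)) z)"
    using frechet_derivative_at[OF tens_has_derivative[OF assms]] by (rule sym) 
  then show "pderiv_dir i (tens u) z = tens (u(i := v i)) z"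
    by (simp add: pderiv_dir_def axis_def if_distrib[of "\<lambda>x. x * _"] cong: if_cong)
qed

lemma iter_pderiv_tens:
  fixes u :: "'n::finite \<Rightarrow> real \<Rightarrow> real"
  assumes "\<And>i. smooth1 (u i)"
  shows "\<exists>v. (\<forall>i. smooth1 (v i)) \<and> iter_pderiv is (tens u) = tens v"
proof (induction "is")
  case Nil
  then show ?case
    using assms by (auto simp: iter_pderiv_def)
next
  case (Cons i "is")
  then obtain v where v: "\<And>i. smooth1 (v i)" "iter_pderiv is (tens u) = tens v" by auto
  from smooth1_family_deriv[of v, OF v(1)] obtain v'
    where v': "\<forall>i. smooth1 (v' i) \<and> (\<forall>x. (v i has_real_derivative v' i x) (at x))"
    by (rule exE)
  have "iter_pderiv (i # is) (tens u) = tens (v(i := v' i))"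
    using pderiv_dir_tens[of v v' i] v' v(2) by (simp add: iter_pderiv_def)
  moreover have "\<forall>j. smooth1 ((v(i := v' i)) j)"
    using v v' by simp
  ultimately show ?case by blast
qed

lemma smooth_tens:
  fixes u :: "'n::finite \<Rightarrow> real \<Rightarrow> real"
  assumes "\<And>i. smooth1 (u i)"
  shows "smooth (tens u)"
  unfolding smooth_def
proof (intro allI)
  fix "is" z
  obtain v where v: "\<And>i. smooth1 (v i)" "iter_pderiv is (tens u) = tens v"
    using iter_pderiv_tens[of u] assms by blast
  from smooth1_family_deriv[of v, OF v(1)] obtain v'
    where v': "\<forall>i. smooth1 (v' i) \<and> (\<forall>x. (v i has_real_derivative v' i x) (at x))"
    by (rule exE)
  from tens_has_derivative[of v v'] v' v(2) show "iter_pderiv is (tens u) differentiable (at z)"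
    by (auto simp: differentiable_def)
qed

lemma tens_test_function:
  fixes u :: "'n::finite \<Rightarrow> real \<Rightarrow> real"
  assumes "\<And>i. smooth1 (u i)" "compact K" "K \<subseteq> U" "\<And>z. z \<notin> K \<Longrightarrow> tens u z = 0"
  shows "tens u \<in> test_functions U"
proof -
  have "closure {z. tens u z \<noteq> 0} \<subseteq> K"
    using assms by (intro closure_minimal compact_imp_closed) auto
  moreover from this have "compact (closure {z. tens u z \<noteq> 0})"
    using assms(2) by (metis closed_closure compact_Int_closed inf.absorb_iff2)
  ultimately show ?thesis
    using assms(1,3) smooth_tens[of u] by (auto simp: test_functions_def)
qed

lemma continuous_on_tens:
  fixes u :: "'n::finite \<Rightarrow> real \<Rightarrow> real"
  assumes "\<And>i. smooth1 (u i)"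
  shows "continuous_on A (tens u)"
  unfolding tens_def
proof (rule continuous_on_prod)
  fix i :: 'n
  show "continuous_on A (\<lambda>z. u i (z $ i))"
    using continuous_on_compose2[OF smooth1_continuous_on[OF assms[of i], of UNIV], of A "\<lambda>z. z $ i"]
    by (simp add: continuous_on_component)
qed

section \<open>Averaged Taylor polynomials of weakly differentiable functions\<close>

lemma finite_mi_order_le: "finite {\<gamma> :: 'n::finite \<Rightarrow> nat. mi_order \<gamma> \<le> d}"
proof (rule finite_subset)
  show "{\<gamma> :: 'n \<Rightarrow> nat. mi_order \<gamma> \<le> d} \<subseteq> PiE UNIV (\<lambda>_. {..d})"
  proof
    fix \<gamma> :: "'n \<Rightarrow> nat"
    assume "\<gamma> \<in> {\<gamma>. mi_order \<gamma> \<le> d}"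
    moreover have "\<gamma> i \<le> mi_order \<gamma>" for i
      unfolding mi_order_def by (rule member_le_sum) auto
    ultimately show "\<gamma> \<in> PiE UNIV (\<lambda>_. {..d})"
      by (auto intro: order.trans)
  qed
qed (auto intro: finite_PiE)

lemma finite_mi_order_eq: "finite {\<gamma> :: 'n::finite \<Rightarrow> nat. mi_order \<gamma> = d}"
  by (rule finite_subset[OF _ finite_mi_order_le[of d]]) auto

lemma finite_mi_order_less: "finite {\<gamma> :: 'n::finite \<Rightarrow> nat. mi_order \<gamma> < d}"
  by (rule finite_subset[OF _ finite_mi_order_le[of d]]) auto

lemma mi_order_inc: "mi_order (\<gamma>(i := Suc (\<gamma> i))) = Suc (mi_order \<gamma>)"
  for \<gamma> :: "'n::finite \<Rightarrow> nat"
  unfolding mi_order_def by (simp add: sum.remove[where x = i])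

definition mi_fact :: "('n::finite \<Rightarrow> nat) \<Rightarrow> real" where
  "mi_fact \<gamma> = (\<Prod>i\<in>UNIV. fact (\<gamma> i))"

lemma mi_fact_ge_1: "mi_fact \<gamma> \<ge> 1"
  unfolding mi_fact_def by (intro prod_ge_1) (simp add: fact_ge_1)

lemma mi_fact_inc: "mi_fact (\<gamma>(i := Suc (\<gamma> i))) = real (Suc (\<gamma> i)) * mi_fact \<gamma>"
proof -
  have *: "mi_fact \<beta> = fact (\<beta> i) * (\<Prod>j\<in>UNIV - {i}. fact (\<beta> j))" for \<beta> :: "'a \<Rightarrow> nat"
    unfolding mi_fact_def by (rule prod.remove) auto
  have "(\<Prod>j\<in>UNIV - {i}. fact ((\<gamma>(i := Suc (\<gamma> i))) j)) = (\<Prod>j\<in>UNIV - {i}. fact (\<gamma> j) :: real)"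
    by (rule prod.cong) auto
  then show ?thesis
    by (simp only: *) simp
qed

section \<open>Averaged Taylor polynomials and their dependence on the averaging kernel\<close>

lemma set_integrable_tens:
  fixes u :: "'n::finite \<Rightarrow> real \<Rightarrow> real"
  assumes h: "locally_integrable_on h U" and K: "compact K" "K \<subseteq> U"
    and u: "\<And>i. smooth1 (u i)" "\<And>z. z \<notin> K \<Longrightarrow> tens u z = 0"
  shows "set_integrable lebesgue U (\<lambda>z. h z * tens u z)"
proof -
  have int: "integrable lebesgue (\<lambda>z. indicat_real K z * h z)"
    using h K by (simp add: locally_integrable_on_def set_integrable_def)
  have "compact (tens u ` K)"
    using K by (intro compact_continuous_image continuous_on_tens u)
  then obtain c where c: "\<And>z. z \<in> K \<Longrightarrow> \<bar>tens u z\<bar> \<le> c"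
    using compact_imp_bounded bounded_iff by (metis image_eqI real_norm_def)
  have [measurable]: "tens u \<in> borel_measurable lebesgue"
    by (intro measurable_completion) (simp add: borel_measurable_continuous_onI continuous_on_tens u)
  have "integrable lebesgue (\<lambda>z. (indicat_real K z * h z) * tens u z)"
  proof (rule Bochner_Integration.integrable_bound)
    show "integrable lebesgue (\<lambda>z. c * (indicat_real K z * h z))"
      using int by (rule integrable_mult_right)
    show "(\<lambda>z. (indicat_real K z * h z) * tens u z) \<in> borel_measurable lebesgue"
      using borel_measurable_integrable[OF int] by measurable
    show "AE z in lebesgue. norm ((indicat_real K z * h z) * tens u z) \<le> norm (c * (indicat_real K z * h z))"
    proof (rule AE_I2)
      fix z
      show "norm ((indicat_real K z * h z) * tens u z) \<le> norm (c * (indicat_real K z * h z))"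
      proof (cases "z \<in> K")
        case True
        then have "\<bar>tens u z\<bar> \<le> \<bar>c\<bar>"
          using c[of z] by simp
        then show ?thesis
          using True mult_right_mono[of "\<bar>tens u z\<bar>" "\<bar>c\<bar>" "\<bar>h z\<bar>"] by (simp add: abs_mult mult.commute)
      qed simp
    qed
  qed
  moreover have "(\<lambda>z. (indicat_real K z * h z) * tens u z) = (\<lambda>z. indicat_real U z *\<^sub>R (h z * tens u z))"
    using K u(2) by (fastforce simp: indicator_def)
  ultimately show ?thesis
    by (simp add: set_integrable_def)
qed

text \<open>The Taylor monomial \<open>(x - z)^\<alpha>\<close> is merged with the kernel factor by
  factor; as a function of \<open>z\<close> the product is again a tensor product and can serve as a
  test function.\<close>

definition taylor_factor :: "real^'n \<Rightarrow> ('n \<Rightarrow> nat) \<Rightarrow> ('n \<Rightarrow> real \<Rightarrow> real) \<Rightarrow> 'n \<Rightarrow> real \<Rightarrow> real" where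
  "taylor_factor x \<alpha> \<kappa> = (\<lambda>j s. (x $ j - s) ^ \<alpha> j * \<kappa> j s)"

lemma smooth1_taylor_factor: "(\<And>i. smooth1 (\<kappa> i)) \<Longrightarrow> smooth1 (taylor_factor x \<alpha> \<kappa> i)"
  unfolding taylor_factor_def by (intro smooth1_mult smooth1_diff_power)

lemma tens_taylor_factor: "tens (taylor_factor x \<alpha> \<kappa>) z = (\<Prod>j\<in>UNIV. (x $ j - z $ j) ^ \<alpha> j) * tens \<kappa> z"
  by (simp add: tens_def taylor_factor_def prod.distrib)

lemma pderiv_dir_tens_coord:
  fixes u :: "'n::finite \<Rightarrow> real \<Rightarrow> real"
  assumes u: "\<And>j. smooth1 (u j)" and v: "\<And>s. (u i has_real_derivative v s) (at s)"
  shows "pderiv_dir i (tens u) = tens (u(i := v))"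
proof -
  from smooth1_family_deriv[of u, OF u] obtain u'
    where u': "\<forall>i. smooth1 (u' i) \<and> (\<forall>x. (u i has_real_derivative u' i x) (at x))"
    by (rule exE)
  have "v = u' i"
    using DERIV_unique[OF v] u' by auto
  then show ?thesis
    using pderiv_dir_tens[of u u' i] u' by simp
qed

text \<open>Keeps of a Sobolev function only a family \<open>D\<close> of locally integrable
  functions tied together by integration by parts, one order at a time. A representative of each
  derivative can thus be chosen separately.\<close>

locale weak_derivs =
  fixes U :: "(real^'n::finite) set" and m :: nat and D :: "('n \<Rightarrow> nat) \<Rightarrow> real^'n \<Rightarrow> real"
  assumes m_pos: "m \<ge> 1"
    and loc_int: "\<And>\<alpha>. mi_order \<alpha> \<le> m \<Longrightarrow> locally_integrable_on (D \<alpha>) U"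
    and by_parts: "\<And>\<alpha> i \<psi>. mi_order \<alpha> < m \<Longrightarrow> \<psi> \<in> test_functions U \<Longrightarrow>
      (LINT z:U|lebesgue. D \<alpha> z * pderiv_dir i \<psi> z) = - (LINT z:U|lebesgue. D (\<alpha>(i := Suc (\<alpha> i))) z * \<psi> z)"
begin

text \<open>The Taylor polynomial of degree \<open>m - 1\<close> with base point \<open>z\<close>,
  evaluated at \<open>x\<close> and integrated over \<open>z\<close> against the density
  \<open>tens \<kappa>\<close>. The result has not been divided by the mass of the density.\<close>

definition taylor :: "('n \<Rightarrow> real \<Rightarrow> real) \<Rightarrow> real^'n \<Rightarrow> real" where
  "taylor \<kappa> x = (\<Sum>\<alpha> | mi_order \<alpha> < m.
     (1 / mi_fact \<alpha>) * (LINT z:U|lebesgue. D \<alpha> z * tens (taylor_factor x \<alpha> \<kappa>) z))"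

definition grad :: "real^'n \<Rightarrow> ennreal" where
  "grad z = (\<Sum>\<gamma> | mi_order \<gamma> = m. ennreal \<bar>D \<gamma> z\<bar>)"

text \<open>
  Integrating the \<open>i\<close>-th partial derivative by parts, all contributions of order less than \<open>m\<close>
  cancel in pairs, as in the derivative of a Taylor polynomial with respect to its base point.
\<close>

lemma taylor_change_coordinate:
  assumes K: "compact K" "K \<subseteq> U"
    and smooth: "\<And>j. smooth1 (\<kappa> j)" "smooth1 v" "smooth1 V"
    and V: "\<And>s. (V has_real_derivative \<kappa> i s - v s) (at s)"
    and supp: "\<And>z. z \<notin> K \<Longrightarrow> tens \<kappa> z = 0" "\<And>z. z \<notin> K \<Longrightarrow> tens (\<kappa>(i := v)) z = 0"
      "\<And>z. z \<notin> K \<Longrightarrow> tens (\<kappa>(i := V)) z = 0"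
  shows "taylor \<kappa> x - taylor (\<kappa>(i := v)) x =
    - (\<Sum>\<alpha> | mi_order \<alpha> = m - 1. (1 / mi_fact \<alpha>) *
        (LINT z:U|lebesgue. D (\<alpha>(i := Suc (\<alpha> i))) z * tens (taylor_factor x \<alpha> (\<kappa>(i := V))) z))"
proof -
  let ?L = "\<lambda>g. (LINT z:U|lebesgue. g z)"
  define \<psi> where "\<psi> \<alpha> = tens (taylor_factor x \<alpha> (\<kappa>(i := V)))" for \<alpha>
  define c where "c \<alpha> = (1 / mi_fact \<alpha>) * ?L (\<lambda>z. D (\<alpha>(i := Suc (\<alpha> i))) z * \<psi> \<alpha> z)" for \<alpha>
  have sm: "smooth1 (taylor_factor x \<alpha> (\<kappa>(i := V)) j)" "smooth1 (taylor_factor x \<alpha> \<kappa> j)"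
    "smooth1 (taylor_factor x \<alpha> (\<kappa>(i := v)) j)" for \<alpha> j
    by (rule smooth1_taylor_factor; use smooth in auto)+
  have sp: "tens (taylor_factor x \<alpha> \<kappa>) z = 0" "tens (taylor_factor x \<alpha> (\<kappa>(i := v))) z = 0" "\<psi> \<alpha> z = 0"
    if "z \<notin> K" for \<alpha> z
    using supp that by (simp_all add: \<psi>_def tens_taylor_factor)
  have \<psi>_test: "\<psi> \<alpha> \<in> test_functions U" for \<alpha>
    unfolding \<psi>_def using sm(1) K sp(3) by (intro tens_test_function[of _ K]) (auto simp: \<psi>_def)
  have si: "set_integrable lebesgue U (\<lambda>z. D \<beta> z * tens (taylor_factor x \<alpha> \<kappa>) z)"
    "set_integrable lebesgue U (\<lambda>z. D \<beta> z * tens (taylor_factor x \<alpha> (\<kappa>(i := v))) z)"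
    "set_integrable lebesgue U (\<lambda>z. D \<beta> z * \<psi> \<alpha> z)"
    if "mi_order \<beta> \<le> m" for \<alpha> \<beta>
    using sp unfolding \<psi>_def by (intro set_integrable_tens[OF loc_int[OF that] K] sm; simp)+
  have main: "(1 / mi_fact \<alpha>) * ?L (\<lambda>z. D \<alpha> z * tens (taylor_factor x \<alpha> \<kappa>) z)
      - (1 / mi_fact \<alpha>) * ?L (\<lambda>z. D \<alpha> z * tens (taylor_factor x \<alpha> (\<kappa>(i := v))) z)
    = - c \<alpha> + (if \<alpha> i = 0 then 0 else c (\<alpha>(i := \<alpha> i - 1)))"
    if \<alpha>: "mi_order \<alpha> < m" for \<alpha>
  proof -
    \<comment> \<open>For \<open>\<alpha> i = 0\<close> the truncated subtraction gives
      \<open>\<alpha>' = \<alpha>\<close>. This does no harm, since the term with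
      \<open>\<alpha>'\<close> always carries the factor \<open>real (\<alpha> i)\<close>.\<close>
    define \<alpha>' where "\<alpha>' = \<alpha>(i := \<alpha> i - 1)"
    have pd: "pderiv_dir i (\<psi> \<alpha>) z = (tens (taylor_factor x \<alpha> \<kappa>) z - tens (taylor_factor x \<alpha> (\<kappa>(i := v))) z)
        - real (\<alpha> i) * \<psi> \<alpha>' z" for z
    proof -
      have rest: "(\<Prod>j\<in>UNIV - {i}. taylor_factor x \<alpha> (\<kappa>(i := w)) j (z $ j))
          = (\<Prod>j\<in>UNIV - {i}. taylor_factor x \<alpha> \<kappa> j (z $ j))" for \<alpha> w
        by (rule prod.cong) (auto simp: taylor_factor_def)
      have rest': "(\<Prod>j\<in>UNIV - {i}. taylor_factor x \<alpha>' \<kappa> j (z $ j))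
          = (\<Prod>j\<in>UNIV - {i}. taylor_factor x \<alpha> \<kappa> j (z $ j))"
        by (rule prod.cong) (auto simp: taylor_factor_def \<alpha>'_def)
      have "(taylor_factor x \<alpha> (\<kappa>(i := V)) i has_real_derivative
          ((x $ i - s) ^ \<alpha> i * (\<kappa> i s - v s) - real (\<alpha> i) * (x $ i - s) ^ (\<alpha> i - 1) * V s)) (at s)" for s
        unfolding taylor_factor_def
        by (auto intro!: derivative_eq_intros V)
      from pderiv_dir_tens_coord[of "taylor_factor x \<alpha> (\<kappa>(i := V))" i, OF sm(1) this]
      have "pderiv_dir i (\<psi> \<alpha>) = tens ((taylor_factor x \<alpha> (\<kappa>(i := V)))(i := \<lambda>s.
          (x $ i - s) ^ \<alpha> i * (\<kappa> i s - v s) - real (\<alpha> i) * (x $ i - s) ^ (\<alpha> i - 1) * V s))"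
        unfolding \<psi>_def .
      then have "pderiv_dir i (\<psi> \<alpha>) z = ((x $ i - z $ i) ^ \<alpha> i * (\<kappa> i (z $ i) - v (z $ i))
           - real (\<alpha> i) * (x $ i - z $ i) ^ (\<alpha> i - 1) * V (z $ i)) *
          (\<Prod>j\<in>UNIV - {i}. taylor_factor x \<alpha> \<kappa> j (z $ j))"
        by (simp only: tens_fun_upd rest)
      moreover have "tens (taylor_factor x \<alpha> \<kappa>) z = (x $ i - z $ i) ^ \<alpha> i * \<kappa> i (z $ i) *
          (\<Prod>j\<in>UNIV - {i}. taylor_factor x \<alpha> \<kappa> j (z $ j))"
        by (subst tens_split[of _ _ i]) (simp add: taylor_factor_def)
      moreover have "tens (taylor_factor x \<alpha> (\<kappa>(i := v))) z = (x $ i - z $ i) ^ \<alpha> i * v (z $ i) *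
          (\<Prod>j\<in>UNIV - {i}. taylor_factor x \<alpha> \<kappa> j (z $ j))"
        unfolding tens_split[of _ _ i] rest by (simp add: taylor_factor_def)
      moreover have "\<psi> \<alpha>' z = (x $ i - z $ i) ^ (\<alpha> i - 1) * V (z $ i) *
          (\<Prod>j\<in>UNIV - {i}. taylor_factor x \<alpha> \<kappa> j (z $ j))"
        unfolding \<psi>_def tens_split[of _ _ i] rest rest' by (simp add: taylor_factor_def \<alpha>'_def)
      ultimately show ?thesis
        by (simp add: algebra_simps)
    qed
    have "?L (\<lambda>z. D \<alpha> z * tens (taylor_factor x \<alpha> \<kappa>) z) - ?L (\<lambda>z. D \<alpha> z * tens (taylor_factor x \<alpha> (\<kappa>(i := v))) z)
        - real (\<alpha> i) * ?L (\<lambda>z. D \<alpha> z * \<psi> \<alpha>' z)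
      = ?L (\<lambda>z. (D \<alpha> z * tens (taylor_factor x \<alpha> \<kappa>) z - D \<alpha> z * tens (taylor_factor x \<alpha> (\<kappa>(i := v))) z)
          - real (\<alpha> i) * (D \<alpha> z * \<psi> \<alpha>' z))"
      using si[of \<alpha>] \<alpha> by simp
    also have "\<dots> = ?L (\<lambda>z. D \<alpha> z * pderiv_dir i (\<psi> \<alpha>) z)"
      by (simp add: pd algebra_simps)
    also have "\<dots> = - ?L (\<lambda>z. D (\<alpha>(i := Suc (\<alpha> i))) z * \<psi> \<alpha> z)"
      by (rule by_parts[OF \<alpha> \<psi>_test])
    finally have 1: "?L (\<lambda>z. D \<alpha> z * tens (taylor_factor x \<alpha> \<kappa>) z)
        - ?L (\<lambda>z. D \<alpha> z * tens (taylor_factor x \<alpha> (\<kappa>(i := v))) z)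
      = - ?L (\<lambda>z. D (\<alpha>(i := Suc (\<alpha> i))) z * \<psi> \<alpha> z) + real (\<alpha> i) * ?L (\<lambda>z. D \<alpha> z * \<psi> \<alpha>' z)"
      by simp
    \<comment> \<open>The factor \<open>\<alpha> i\<close> turns \<open>1 / \<alpha>!\<close> into
      \<open>1 / \<alpha>'!\<close>. What results is exactly the term \<open>c \<alpha>'\<close>
      that appears with the opposite sign in the identity for \<open>\<alpha>'\<close>.\<close>
    have 2: "(1 / mi_fact \<alpha>) * (real (\<alpha> i) * ?L (\<lambda>z. D \<alpha> z * \<psi> \<alpha>' z)) = (if \<alpha> i = 0 then 0 else c \<alpha>')"
    proof (cases "\<alpha> i = 0")
      case False
      have up: "\<alpha>'(i := Suc (\<alpha>' i)) = \<alpha>"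
        using False by (auto simp: \<alpha>'_def)
      have "mi_fact \<alpha> = real (\<alpha> i) * mi_fact \<alpha>'"
        using mi_fact_inc[of \<alpha>' i] False unfolding up by (simp add: \<alpha>'_def)
      then show ?thesis
        using False by (simp add: c_def up)
    qed simp
    show ?thesis
      unfolding right_diff_distrib[symmetric] 1 distrib_left 2 by (simp add: c_def \<alpha>'_def)
  qed
  have "taylor \<kappa> x - taylor (\<kappa>(i := v)) x
      = (\<Sum>\<alpha> | mi_order \<alpha> < m. - c \<alpha> + (if \<alpha> i = 0 then 0 else c (\<alpha>(i := \<alpha> i - 1))))"
    unfolding taylor_def sum_subtractf[symmetric] by (rule sum.cong[OF refl]) (simp only: main mem_Collect_eq)
  also have "\<dots> = - (\<Sum>\<alpha> | mi_order \<alpha> < m. c \<alpha>)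
      + (\<Sum>\<alpha> | mi_order \<alpha> < m. if \<alpha> i = 0 then 0 else c (\<alpha>(i := \<alpha> i - 1)))"
    by (simp add: sum_subtractf)
  also have "(\<Sum>\<alpha> | mi_order \<alpha> < m. if \<alpha> i = 0 then 0 else c (\<alpha>(i := \<alpha> i - 1)))
      = (\<Sum>\<alpha> | mi_order \<alpha> < m \<and> \<alpha> i \<noteq> 0. c (\<alpha>(i := \<alpha> i - 1)))"
    by (rule sum.mono_neutral_cong_right) (auto simp: finite_mi_order_less)
  \<comment> \<open>Lowering the entry at \<open>i\<close> maps the remaining indices bijectively
    onto the orders below \<open>m - 1\<close>. The two sums therefore differ only in the order
    \<open>m - 1\<close>, where \<open>c\<close> contains derivatives of order
    \<open>m\<close>.\<close>
  also have "\<dots> = (\<Sum>\<beta> | mi_order \<beta> < m - 1. c \<beta>)"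
  proof (rule sum.reindex_bij_witness[where i = "\<lambda>\<beta>. \<beta>(i := Suc (\<beta> i))" and j = "\<lambda>\<alpha>. \<alpha>(i := \<alpha> i - 1)"])
    fix \<alpha> assume "\<alpha> \<in> {\<alpha>. mi_order \<alpha> < m \<and> \<alpha> i \<noteq> 0}"
    then have "\<alpha> = (\<alpha>(i := \<alpha> i - 1))(i := Suc ((\<alpha>(i := \<alpha> i - 1)) i))" "mi_order \<alpha> < m" by auto
    then show "\<alpha>(i := \<alpha> i - 1) \<in> {\<beta>. mi_order \<beta> < m - 1}"
      using mi_order_inc[of "\<alpha>(i := \<alpha> i - 1)" i] by simp
  qed (auto simp: mi_order_inc)
  also have "(\<Sum>\<alpha> | mi_order \<alpha> < m. c \<alpha>) = (\<Sum>\<beta> | mi_order \<beta> < m - 1. c \<beta>) + (\<Sum>\<beta> | mi_order \<beta> = m - 1. c \<beta>)"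
    using m_pos
    by (subst sum.union_disjoint[symmetric])
       (auto simp: finite_mi_order_less finite_mi_order_eq intro!: sum.cong)
  finally have "taylor \<kappa> x - taylor (\<kappa>(i := v)) x = - (\<Sum>\<beta> | mi_order \<beta> = m - 1. c \<beta>)"
    by linarith
  then show ?thesis
    unfolding c_def \<psi>_def .
qed

text \<open>On \<open>K\<close> every monomial of order \<open>m - 1\<close> is at most
  \<open>\<rho> ^ (m - 1)\<close>. The factors \<open>1 / \<alpha>!\<close> are estimated by
  \<open>1\<close>, and counting the indices gives the cardinality.\<close>

lemma taylor_change_coordinate_bound:
  assumes K: "compact K" "K \<subseteq> U"
    and smooth: "\<And>j. smooth1 (\<kappa> j)" "smooth1 v" "smooth1 V"
    and V: "\<And>s. (V has_real_derivative \<kappa> i s - v s) (at s)"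
    and supp: "\<And>z. z \<notin> K \<Longrightarrow> tens \<kappa> z = 0" "\<And>z. z \<notin> K \<Longrightarrow> tens (\<kappa>(i := v)) z = 0"
      "\<And>z. z \<notin> K \<Longrightarrow> tens (\<kappa>(i := V)) z = 0"
    and near: "\<And>z j. z \<in> K \<Longrightarrow> \<bar>x $ j - z $ j\<bar> \<le> \<rho>" and \<rho>: "0 \<le> \<rho>"
    and \<Lambda>: "\<And>z. \<bar>tens (\<kappa>(i := V)) z\<bar> \<le> \<Lambda>"
  shows "ennreal \<bar>taylor \<kappa> x - taylor (\<kappa>(i := v)) x\<bar> \<le>
    ennreal (real (card {\<alpha> :: 'n \<Rightarrow> nat. mi_order \<alpha> = m - 1}) * \<rho> ^ (m - 1) * \<Lambda>) * (\<integral>\<^sup>+z\<in>K. grad z \<partial>lebesgue)"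
proof -
  let ?A = "{\<alpha> :: 'n \<Rightarrow> nat. mi_order \<alpha> = m - 1}"
  let ?G = "\<integral>\<^sup>+z\<in>K. grad z \<partial>lebesgue"
  define I where "I \<alpha> = (LINT z:U|lebesgue. D (\<alpha>(i := Suc (\<alpha> i))) z * tens (taylor_factor x \<alpha> (\<kappa>(i := V))) z)" for \<alpha>
  have \<Lambda>0: "0 \<le> \<Lambda>"
    using \<Lambda>[of 0] by linarith
  have summand: "ennreal \<bar>I \<alpha>\<bar> \<le> ennreal (\<rho> ^ (m - 1) * \<Lambda>) * ?G" if \<alpha>: "mi_order \<alpha> = m - 1" for \<alpha>
  proof -
    define \<gamma> where "\<gamma> = \<alpha>(i := Suc (\<alpha> i))"
    have \<gamma>: "mi_order \<gamma> = m"
      using \<alpha> m_pos by (simp add: \<gamma>_def mi_order_inc)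
    have bnd: "\<bar>tens (taylor_factor x \<alpha> (\<kappa>(i := V))) z\<bar> \<le> \<rho> ^ (m - 1) * \<Lambda> * indicator K z" for z
    proof (cases "z \<in> K")
      case True
      have "\<bar>\<Prod>j\<in>UNIV. (x $ j - z $ j) ^ \<alpha> j\<bar> = (\<Prod>j\<in>UNIV. \<bar>x $ j - z $ j\<bar> ^ \<alpha> j)"
        by (simp add: abs_prod power_abs)
      also have "\<dots> \<le> (\<Prod>j\<in>UNIV. \<rho> ^ \<alpha> j)"
        using near[OF True] by (intro prod_mono) (auto intro: power_mono)
      also have "\<dots> = \<rho> ^ (m - 1)"
        using \<alpha> by (simp add: power_sum[symmetric] mi_order_def)
      finally show ?thesis
        using True \<Lambda>[of z] \<rho> by (auto simp: tens_taylor_factor abs_mult intro!: mult_mono)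
    next
      case False
      then show ?thesis
        using supp(3)[of z] by (simp add: tens_taylor_factor)
    qed
    have "locally_integrable_on (D \<gamma>) U"
      using loc_int \<gamma> by simp
    then have "integrable lebesgue (\<lambda>z. indicat_real U z *\<^sub>R (D \<gamma> z * tens (taylor_factor x \<alpha> (\<kappa>(i := V))) z))"
      unfolding set_integrable_def[symmetric]
      by (rule set_integrable_tens[OF _ K smooth1_taylor_factor]) (use smooth supp(3) in \<open>auto simp: tens_taylor_factor\<close>)
    from integral_norm_bound_ennreal[OF this]
    have "ennreal \<bar>I \<alpha>\<bar> \<le> (\<integral>\<^sup>+z. ennreal (norm (indicat_real U z *\<^sub>R (D \<gamma> z * tens (taylor_factor x \<alpha> (\<kappa>(i := V))) z))) \<partial>lebesgue)"
      by (simp add: I_def set_lebesgue_integral_def \<gamma>_def)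
    also have "\<dots> \<le> (\<integral>\<^sup>+z. ennreal (\<rho> ^ (m - 1) * \<Lambda>) * (grad z * indicator K z) \<partial>lebesgue)"
    proof (rule nn_integral_mono)
      fix z
      have "ennreal (norm (indicat_real U z *\<^sub>R (D \<gamma> z * tens (taylor_factor x \<alpha> (\<kappa>(i := V))) z)))
          \<le> ennreal (\<bar>D \<gamma> z\<bar> * (\<rho> ^ (m - 1) * \<Lambda> * indicator K z))"
        using bnd[of z] abs_ge_zero order.trans by (intro ennreal_leI) (auto simp: abs_mult indicator_def intro!: mult_left_mono)
      also have "\<dots> = ennreal (\<rho> ^ (m - 1) * \<Lambda>) * (ennreal \<bar>D \<gamma> z\<bar> * indicator K z)"
        using \<rho> \<Lambda>0 by (auto simp: ennreal_mult'[symmetric] ennreal_indicator[symmetric] ennreal_mult[symmetric] mult_ac indicator_def)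
      also have "\<dots> \<le> ennreal (\<rho> ^ (m - 1) * \<Lambda>) * (grad z * indicator K z)"
      proof -
        have "ennreal \<bar>D \<gamma> z\<bar> \<le> grad z"
          unfolding grad_def using \<gamma> by (intro member_le_sum finite_mi_order_eq) auto
        then show ?thesis
          by (intro mult_left_mono mult_right_mono) auto
      qed
      finally show "ennreal (norm (indicat_real U z *\<^sub>R (D \<gamma> z * tens (taylor_factor x \<alpha> (\<kappa>(i := V))) z)))
        \<le> ennreal (\<rho> ^ (m - 1) * \<Lambda>) * (grad z * indicator K z)" .
    qed
    also have "\<dots> = ennreal (\<rho> ^ (m - 1) * \<Lambda>) * ?G"
    proof (rule nn_integral_cmult)
      have "(\<lambda>z. indicat_real K z * D \<beta> z) \<in> borel_measurable lebesgue" if "mi_order \<beta> = m" for \<beta>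
        using loc_int[of \<beta>] that K
        by (auto simp: locally_integrable_on_def set_integrable_def dest!: borel_measurable_integrable)
      then have "(\<lambda>z. \<Sum>\<gamma> | mi_order \<gamma> = m. ennreal \<bar>indicat_real K z * D \<gamma> z\<bar>) \<in> borel_measurable lebesgue"
        by (intro borel_measurable_sum measurable_compose[OF _ measurable_ennreal] borel_measurable_abs) auto
      moreover have "(\<lambda>z. \<Sum>\<gamma> | mi_order \<gamma> = m. ennreal \<bar>indicat_real K z * D \<gamma> z\<bar>) = (\<lambda>z. grad z * indicator K z)"
        by (auto simp: grad_def indicator_def)
      ultimately show "(\<lambda>z. grad z * indicator K z) \<in> borel_measurable lebesgue"
        by (simp only:)
    qed
    finally show ?thesis .
  qed
  have "\<bar>taylor \<kappa> x - taylor (\<kappa>(i := v)) x\<bar> = \<bar>\<Sum>\<alpha>\<in>?A. (1 / mi_fact \<alpha>) * I \<alpha>\<bar>"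
    by (subst taylor_change_coordinate[OF K smooth V supp]) (simp_all add: I_def)
  also have "\<dots> \<le> (\<Sum>\<alpha>\<in>?A. \<bar>I \<alpha>\<bar>)"
  proof (rule order.trans[OF sum_abs sum_mono])
    fix \<alpha> :: "'n \<Rightarrow> nat"
    show "\<bar>1 / mi_fact \<alpha> * I \<alpha>\<bar> \<le> \<bar>I \<alpha>\<bar>"
      using mi_fact_ge_1[of \<alpha>] by (simp add: abs_mult divide_le_eq mult_le_cancel_left1)
  qed
  finally have "ennreal \<bar>taylor \<kappa> x - taylor (\<kappa>(i := v)) x\<bar> \<le> ennreal (\<Sum>\<alpha>\<in>?A. \<bar>I \<alpha>\<bar>)"
    by (rule ennreal_leI)
  also have "\<dots> = (\<Sum>\<alpha>\<in>?A. ennreal \<bar>I \<alpha>\<bar>)"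
    by (simp add: sum_ennreal)
  also have "\<dots> \<le> (\<Sum>\<alpha>\<in>?A. ennreal (\<rho> ^ (m - 1) * \<Lambda>) * ?G)"
    by (rule sum_mono) (use summand in auto)
  also have "\<dots> = ennreal (real (card ?A) * \<rho> ^ (m - 1) * \<Lambda>) * ?G"
    using \<rho> \<Lambda>0 by (simp add: ennreal_mult ennreal_of_nat_eq_real_of_nat mult.assoc)
  finally show ?thesis .
qed

end

text \<open>The division by \<open>\<epsilon>\<close> makes the integral of each factor independent
  of the box. Equal masses are what makes the primitive of the difference of two factors vanish to
  the right of both intervals as well.\<close>

definition box_bump :: "real^'n \<Rightarrow> real \<Rightarrow> 'n::finite \<Rightarrow> real \<Rightarrow> real" where
  "box_bump a \<epsilon> = (\<lambda>j s. bump ((s - a $ j) / \<epsilon>) / \<epsilon>)"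

lemma smooth1_box_bump: "smooth1 (box_bump a \<epsilon> j)"
proof -
  have "smooth1 (\<lambda>s. bump ((1 / \<epsilon>) * s + (- (a $ j) / \<epsilon>)) * (1 / \<epsilon>))"
    by (intro smooth1_mult smooth1_const smooth1_compose_affine smooth1_bump)
  then show ?thesis
    by (simp add: box_bump_def diff_divide_distrib)
qed

lemma box_bump_eq_0: "\<epsilon> > 0 \<Longrightarrow> s \<notin> {a $ j..a $ j + \<epsilon>} \<Longrightarrow> box_bump a \<epsilon> j s = 0"
  by (auto simp: box_bump_def field_simps intro!: bump_eq_0)

lemma step_scaled_DERIV:
  assumes "\<epsilon> > 0"
  shows "((\<lambda>s. step ((s - a $ j) / \<epsilon>)) has_real_derivative box_bump a \<epsilon> j s) (at s)"
proof -
  have "((\<lambda>s. (s - a $ j) / \<epsilon>) has_real_derivative 1 / \<epsilon>) (at s)"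
    using assms by (auto intro!: derivative_eq_intros)
  from DERIV_chain2[OF step_DERIV this] show ?thesis
    by (simp add: box_bump_def)
qed

text \<open>The primitive of the difference of two factors lives on the convex hull of their two
  intervals. The product of these hulls contains the supports of all tensor products that occur on
  the way from one bump to the other.\<close>

definition hull_box :: "real^'n::finite \<Rightarrow> real \<Rightarrow> real^'n \<Rightarrow> real \<Rightarrow> (real^'n) set" where
  "hull_box a \<epsilon> a' \<epsilon>' = cbox (\<chi> j. min (a $ j) (a' $ j)) (\<chi> j. max (a $ j + \<epsilon>) (a' $ j + \<epsilon>'))"

lemma mem_hull_box: "z \<in> hull_box a \<epsilon> a' \<epsilon>' \<longleftrightarrow>
    (\<forall>j. min (a $ j) (a' $ j) \<le> z $ j \<and> z $ j \<le> max (a $ j + \<epsilon>) (a' $ j + \<epsilon>'))"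
  by (simp add: hull_box_def mem_box_cart)

text \<open>The factors are exchanged one coordinate at a time, each at the cost \<open>E\<close>;
  hence the factor \<open>CARD('n)\<close>. The factor being exchanged enters through its primitive
  \<open>V\<close>, bounded by \<open>1\<close> instead of \<open>M / \<delta>\<close>. This saves
  one power of \<open>\<delta>\<close>, so that for \<open>\<delta>\<close> comparable to
  \<open>\<rho>\<close> the bound has the order \<open>\<rho>^(m - n)\<close> of a Riesz
  kernel.\<close>

lemma (in weak_derivs) taylor_change_box:
  assumes \<epsilon>: "0 < \<delta>" "\<delta> \<le> \<epsilon>" "\<delta> \<le> \<epsilon>'" and U: "hull_box a \<epsilon> a' \<epsilon>' \<subseteq> U"
    and M: "M \<ge> 1" "\<And>s. \<bar>bump s\<bar> \<le> M"
    and near: "\<And>z j. z \<in> hull_box a \<epsilon> a' \<epsilon>' \<Longrightarrow> \<bar>x $ j - z $ j\<bar> \<le> \<rho>" and \<rho>: "0 \<le> \<rho>"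
  shows "ennreal \<bar>taylor (box_bump a \<epsilon>) x - taylor (box_bump a' \<epsilon>') x\<bar> \<le>
    ennreal (real CARD('n) * (real (card {\<alpha> :: 'n \<Rightarrow> nat. mi_order \<alpha> = m - 1}) * \<rho> ^ (m - 1) * (M / \<delta>) ^ (CARD('n) - 1)))
      * (\<integral>\<^sup>+z\<in>hull_box a \<epsilon> a' \<epsilon>'. grad z \<partial>lebesgue)"
proof -
  define K where "K = hull_box a \<epsilon> a' \<epsilon>'"
  define E where "E = ennreal (real (card {\<alpha> :: 'n \<Rightarrow> nat. mi_order \<alpha> = m - 1}) * \<rho> ^ (m - 1) * (M / \<delta>) ^ (CARD('n) - 1))
      * (\<integral>\<^sup>+z\<in>K. grad z \<partial>lebesgue)"
  define mix where "mix S j = (if j \<in> S then box_bump a' \<epsilon>' j else box_bump a \<epsilon> j)" for S j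
  have K: "compact K"
    by (simp add: K_def hull_box_def compact_cbox)
  have pos: "\<epsilon> > 0" "\<epsilon>' > 0" using \<epsilon> by auto
  have vanish: "tens u z = 0" if "z \<notin> K"
    and u: "\<And>j s. s \<notin> {min (a $ j) (a' $ j)..max (a $ j + \<epsilon>) (a' $ j + \<epsilon>')} \<Longrightarrow> u j s = 0" for u z
  proof -
    obtain j where "\<not> (min (a $ j) (a' $ j) \<le> z $ j \<and> z $ j \<le> max (a $ j + \<epsilon>) (a' $ j + \<epsilon>'))"
      using \<open>z \<notin> K\<close> unfolding K_def mem_hull_box by blast
    then have "u j (z $ j) = 0"
      by (intro u) simp
    then show ?thesis
      unfolding tens_def by (intro prod_zero) auto
  qed
  have bb: "box_bump a \<epsilon> j s = 0" "box_bump a' \<epsilon>' j s = 0"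
    if "s \<notin> {min (a $ j) (a' $ j)..max (a $ j + \<epsilon>) (a' $ j + \<epsilon>')}" for j s
    using that pos by (auto intro!: box_bump_eq_0)
  have mix0: "mix S j s = 0" if "s \<notin> {min (a $ j) (a' $ j)..max (a $ j + \<epsilon>) (a' $ j + \<epsilon>')}" for S j s
    using bb[OF that] by (simp add: mix_def)
  have smix: "smooth1 (mix S j)" for S j
    by (simp add: mix_def smooth1_box_bump)
  have mixM: "\<bar>mix S j s\<bar> \<le> M / \<delta>" for S j s
  proof -
    have "\<bar>box_bump b \<eta> j s\<bar> \<le> M / \<delta>" if "\<delta> \<le> \<eta>" for b \<eta>
      unfolding box_bump_def using M that \<epsilon>(1) by (auto simp: abs_divide intro!: frac_le)
    then show ?thesis
      using \<epsilon> by (simp add: mix_def)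
  qed
  have "ennreal \<bar>taylor (mix {}) x - taylor (mix S) x\<bar> \<le> of_nat (card S) * E" for S :: "'n set"
  proof (induction S rule: finite_induct[OF finite])
    case 1
    then show ?case by simp
  next
    case (2 i S)
    define V where "V s = step ((s - a $ i) / \<epsilon>) - step ((s - a' $ i) / \<epsilon>')" for s
    have upd: "mix (insert i S) = (mix S)(i := box_bump a' \<epsilon>' i)"
      using 2 by (auto simp: mix_def)
    have i: "mix S i = box_bump a \<epsilon> i"
      using 2 by (simp add: mix_def)
    have V0: "V s = 0" if "s \<notin> {min (a $ i) (a' $ i)..max (a $ i + \<epsilon>) (a' $ i + \<epsilon>')}" for s
    proof (cases "s < min (a $ i) (a' $ i)")
      case True
      then show ?thesis
        using pos by (simp add: V_def step_eq_0 divide_nonpos_pos)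
    next
      case False
      then have "a $ i + \<epsilon> < s" "a' $ i + \<epsilon>' < s"
        using that by auto
      then show ?thesis
        using pos by (simp add: V_def step_eq_1)
    qed
    have V1: "\<bar>V s\<bar> \<le> 1" for s
      using step_bounds[of "(s - a $ i) / \<epsilon>"] step_bounds[of "(s - a' $ i) / \<epsilon>'"] by (simp add: V_def)
    have dV: "(V has_real_derivative mix S i s - box_bump a' \<epsilon>' i s) (at s)" for s
      unfolding V_def i by (intro DERIV_diff step_scaled_DERIV pos)
    have sV: "smooth1 V"
    proof -
      have "smooth1 (\<lambda>s. step ((1 / \<eta>) * s + (- b / \<eta>)))" for \<eta> b
        by (rule smooth1_compose_affine[OF smooth1_step])
      then have *: "smooth1 (\<lambda>s. step ((s - b) / \<eta>))" for \<eta> b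
        by (simp add: diff_divide_distrib)
      show ?thesis
        unfolding V_def by (intro smooth1_diff *)
    qed
    have \<Lambda>: "\<bar>tens ((mix S)(i := V)) z\<bar> \<le> (M / \<delta>) ^ (CARD('n) - 1)" for z
    proof -
      have "\<bar>tens ((mix S)(i := V)) z\<bar> = \<bar>V (z $ i)\<bar> * (\<Prod>j\<in>UNIV - {i}. \<bar>mix S j (z $ j)\<bar>)"
        by (simp add: tens_fun_upd abs_mult abs_prod)
      also have "\<dots> \<le> 1 * (\<Prod>j\<in>UNIV - {i}. M / \<delta>)"
        using V1 mixM by (intro mult_mono prod_mono prod_nonneg) auto
      finally show ?thesis
        by (simp add: card_Diff_singleton)
    qed
    have "ennreal \<bar>taylor (mix S) x - taylor ((mix S)(i := box_bump a' \<epsilon>' i)) x\<bar> \<le> E"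
      unfolding E_def
    proof (rule taylor_change_coordinate_bound[where V = V])
      show "compact K" "K \<subseteq> U" using K U by (auto simp: K_def)
      show "\<And>z j. z \<in> K \<Longrightarrow> \<bar>x $ j - z $ j\<bar> \<le> \<rho>" using near by (simp add: K_def)
      show "tens (mix S) z = 0" if "z \<notin> K" for z
        by (rule vanish[OF that]) (rule mix0)
      show "tens ((mix S)(i := box_bump a' \<epsilon>' i)) z = 0" if "z \<notin> K" for z
        by (rule vanish[OF that]) (use mix0 bb in auto)
      show "tens ((mix S)(i := V)) z = 0" if "z \<notin> K" for z
        by (rule vanish[OF that]) (use mix0 V0 in auto)
    qed (use smix sV dV \<Lambda> \<rho> smooth1_box_bump in auto)
    then have E: "ennreal \<bar>taylor (mix S) x - taylor (mix (insert i S)) x\<bar> \<le> E"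
      by (simp add: upd)
    have "ennreal \<bar>taylor (mix {}) x - taylor (mix (insert i S)) x\<bar>
        \<le> ennreal \<bar>taylor (mix {}) x - taylor (mix S) x\<bar> + ennreal \<bar>taylor (mix S) x - taylor (mix (insert i S)) x\<bar>"
      unfolding ennreal_plus[OF abs_ge_zero abs_ge_zero, symmetric] by (rule ennreal_leI) linarith
    also have "\<dots> \<le> of_nat (card S) * E + E"
      by (intro add_mono 2 E)
    finally show ?case
      using 2 by (simp add: distrib_right add.commute)
  qed
  from this[of UNIV] have "ennreal \<bar>taylor (mix {}) x - taylor (mix UNIV) x\<bar> \<le> of_nat CARD('n) * E" .
  moreover have "mix {} = box_bump a \<epsilon>" "mix UNIV = box_bump a' \<epsilon>'"
    by (auto simp: mix_def)
  moreover have "of_nat CARD('n) * E = ennreal (real CARD('n) * (real (card {\<alpha> :: 'n \<Rightarrow> nat. mi_order \<alpha> = m - 1}) * \<rho> ^ (m - 1) * (M / \<delta>) ^ (CARD('n) - 1)))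
      * (\<integral>\<^sup>+z\<in>K. grad z \<partial>lebesgue)"
    unfolding E_def by (subst ennreal_mult) (use \<rho> M \<epsilon> in \<open>auto simp: ennreal_of_nat_eq_real_of_nat mult.assoc\<close>)
  ultimately show ?thesis
    by (simp add: K_def)
qed

section \<open>The pointwise estimate by a dyadic Riesz potential\<close>

lemma One_cart [simp]: "(One :: real^'n::finite) $ j = 1"
  by (simp add: cart_eq_inner_axis axis_in_Basis_iff inner_sum_left_Basis)

lemma sum_Basis_cart [simp]: "(\<Sum>b\<in>(Basis :: (real^'n::finite) set). b $ j) = 1"
  using One_cart[of j] by (simp del: One_cart)

lemma mem_corner_box: "z \<in> cbox x (x + \<epsilon> *\<^sub>R One) \<longleftrightarrow> (\<forall>j. x $ j \<le> z $ j \<and> z $ j \<le> x $ j + \<epsilon>)"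
  for x z :: "real^'n::finite"
  by (simp add: mem_box_cart)

lemma measure_corner_box:
  assumes "\<epsilon> \<ge> 0"
  shows "measure lebesgue (cbox x (x + \<epsilon> *\<^sub>R One :: real^'n::finite)) = \<epsilon> ^ CARD('n)"
proof -
  have "measure lborel (cbox x (x + \<epsilon> *\<^sub>R One)) = (\<Prod>b\<in>(Basis :: (real^'n) set). \<epsilon>)"
    using assms by (subst content_cbox) (auto simp: inner_add_left inner_sum_left_Basis intro!: prod.cong)
  then show ?thesis by (simp add: measure_completion)
qed

text \<open>The cubes have \<open>x\<close> as a corner and not as their centre because they are the
  supports of the bumps \<open>box_bump x \<epsilon>\<close>.\<close>

definition lebesgue_point :: "(real^'n::finite \<Rightarrow> real) \<Rightarrow> real^'n \<Rightarrow> bool" where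
  "lebesgue_point h x \<longleftrightarrow> (\<forall>e>0. \<exists>d>0. \<forall>\<epsilon>. 0 < \<epsilon> \<and> \<epsilon> < d \<longrightarrow>
     (LINT z:cbox x (x + \<epsilon> *\<^sub>R One)|lebesgue. \<bar>h z - h x\<bar>) \<le> e * \<epsilon> ^ CARD('n))"

lemma set_integrable_corner:
  assumes "integrable lebesgue (h :: real^'n::finite \<Rightarrow> real)"
  shows "set_integrable lebesgue (cbox a b) (\<lambda>z. \<bar>h z - q\<bar>)"
proof -
  have "set_integrable lebesgue (cbox a b) h"
    unfolding set_integrable_def by (rule integrable_mult_indicator[OF _ assms]) simp
  moreover have "set_integrable lebesgue (cbox a b) (\<lambda>z. q)"
    using integrable_on_const[of "cbox a b" q]
    by (metis absolutely_integrable_on_const lmeasurable_cbox)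
  ultimately show ?thesis
    by (intro set_integrable_abs set_integral_diff)
qed

text \<open>Differentiation of integrals concerns a fixed integrand, while the function to be
  averaged here depends on \<open>x\<close> through \<open>h x\<close>. It is therefore applied to
  the distance of \<open>h\<close> from \<open>q\<close> for all rational \<open>q\<close> at once;
  outside a countable union of null sets, \<open>q\<close> may then be chosen within
  \<open>e / 3\<close> of \<open>h x\<close>.\<close>

lemma AE_lebesgue_point:
  fixes h :: "real^'n::finite \<Rightarrow> real"
  assumes h: "integrable lebesgue h"
  shows "AE x in lebesgue. lebesgue_point h x"
proof -
  define LP where "LP q x \<longleftrightarrow> (\<forall>e>0. \<exists>d>0. \<forall>\<epsilon>. 0 < \<epsilon> \<and> \<epsilon> < d \<longrightarrow>
      norm (integral (cbox x (x + \<epsilon> *\<^sub>R One)) (\<lambda>z. \<bar>h z - q\<bar>) /\<^sub>R \<epsilon> ^ DIM(real^'n) - \<bar>h x - q\<bar>) < e)" for q x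
  have "\<exists>N. negligible N \<and> (\<forall>x. x \<notin> N \<longrightarrow> LP q x)" for q :: real
  proof -
    have "(\<lambda>z. \<bar>h z - q\<bar>) integrable_on cbox a b" for a b
      by (rule set_lebesgue_integral_eq_integral(1)[OF set_integrable_corner[OF h]])
    then show ?thesis
    proof (rule integrable_ccontinuous_explicit)
      fix N :: "(real^'n) set"
      assume "negligible N" and *: "\<And>x e. \<lbrakk>x \<notin> N; 0 < e\<rbrakk> \<Longrightarrow> \<exists>d>0. \<forall>\<epsilon>. 0 < \<epsilon> \<and> \<epsilon> < d \<longrightarrow>
        norm (integral (cbox x (x + \<epsilon> *\<^sub>R One)) (\<lambda>z. \<bar>h z - q\<bar>) /\<^sub>R \<epsilon> ^ DIM(real^'n) - \<bar>h x - q\<bar>) < e"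
      moreover have "LP q x" if "x \<notin> N" for x
        unfolding LP_def using *[OF that] by (intro allI impI)
      ultimately show "\<exists>N. negligible N \<and> (\<forall>x. x \<notin> N \<longrightarrow> LP q x)" by blast
    qed
  qed
  then have "\<forall>q. \<exists>N. negligible N \<and> (\<forall>x. x \<notin> N \<longrightarrow> LP q x)" by blast
  from choice[OF this] obtain N where N: "\<And>q. negligible (N q)" "\<And>q x. x \<notin> N q \<Longrightarrow> LP q x"
    by blast
  have "negligible (\<Union>q\<in>\<rat>. N q)"
    using N(1) countable_rat by (intro negligible_countable_Union) auto
  moreover have "lebesgue_point h x" if x: "x \<notin> (\<Union>q\<in>\<rat>. N q)" for x
    unfolding lebesgue_point_def
  proof (intro allI impI)
    fix e :: real assume "e > 0"
    obtain q where q: "q \<in> \<rat>" "h x < q" "q < h x + e / 3"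
      using Rats_dense_in_real[of "h x" "h x + e / 3"] \<open>e > 0\<close> by auto
    have lp: "LP q x"
      using N(2) x q(1) by blast
    obtain d where "d > 0" and d: "\<And>\<epsilon>. 0 < \<epsilon> \<Longrightarrow> \<epsilon> < d \<Longrightarrow>
        norm (integral (cbox x (x + \<epsilon> *\<^sub>R One)) (\<lambda>z. \<bar>h z - q\<bar>) /\<^sub>R \<epsilon> ^ DIM(real^'n) - \<bar>h x - q\<bar>) < e / 3"
      using lp[unfolded LP_def, rule_format, of "e / 3"] \<open>e > 0\<close> by auto
    have "(LINT z:cbox x (x + \<epsilon> *\<^sub>R One)|lebesgue. \<bar>h z - h x\<bar>) \<le> e * \<epsilon> ^ CARD('n)" if \<epsilon>: "0 < \<epsilon>" "\<epsilon> < d" for \<epsilon>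
    proof -
      let ?Q = "cbox x (x + \<epsilon> *\<^sub>R One)"
      have "integral ?Q (\<lambda>z. \<bar>h z - q\<bar>) / \<epsilon> ^ CARD('n) < \<bar>h x - q\<bar> + e / 3"
      proof -
        have *: "I / E < Y + b" if "norm (I /\<^sub>R E - Y) < b" for I E Y b :: real
          using that by (simp add: divide_inverse_commute abs_less_iff)
        show ?thesis
          by (rule *) (use d[OF \<epsilon>] in \<open>simp only: DIM_cart DIM_real mult_1_right\<close>)
      qed
      then have "integral ?Q (\<lambda>z. \<bar>h z - q\<bar>) / \<epsilon> ^ CARD('n) < e / 3 + e / 3"
        using q by linarith
      then have "integral ?Q (\<lambda>z. \<bar>h z - q\<bar>) < (e / 3 + e / 3) * \<epsilon> ^ CARD('n)"
        using \<epsilon> by (simp only: pos_divide_less_eq zero_less_power)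
      then have 1: "(LINT z:?Q|lebesgue. \<bar>h z - q\<bar>) \<le> (e / 3 + e / 3) * \<epsilon> ^ CARD('n)"
        using set_lebesgue_integral_eq_integral(2)[OF set_integrable_corner[OF h, of x "x + \<epsilon> *\<^sub>R One" q]] by simp
      have ic: "set_integrable lebesgue ?Q (\<lambda>z. e / 3)"
        by (metis absolutely_integrable_on_const lmeasurable_cbox)
      have "(LINT z:?Q|lebesgue. \<bar>h z - h x\<bar>) \<le> (LINT z:?Q|lebesgue. \<bar>h z - q\<bar> + e / 3)"
        using q by (intro set_integral_mono set_integral_add set_integrable_corner h ic) auto
      also have "\<dots> = (LINT z:?Q|lebesgue. \<bar>h z - q\<bar>) + (LINT z:?Q|lebesgue. e / 3)"
        by (intro set_integral_add set_integrable_corner h ic)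
      also have "(LINT z:?Q|lebesgue. e / 3) = e / 3 * \<epsilon> ^ CARD('n)"
        using measure_corner_box[of \<epsilon> x] \<epsilon> by (simp add: set_lebesgue_integral_def)
      finally show ?thesis
        using 1 by (simp add: algebra_simps)
    qed
    with \<open>d > 0\<close> show "\<exists>d>0. \<forall>\<epsilon>. 0 < \<epsilon> \<and> \<epsilon> < d \<longrightarrow>
       (LINT z:cbox x (x + \<epsilon> *\<^sub>R One)|lebesgue. \<bar>h z - h x\<bar>) \<le> e * \<epsilon> ^ CARD('n)"
      by blast
  qed
  ultimately show ?thesis
    unfolding negligible_iff_null_sets by (intro AE_I'[of "\<Union>q\<in>\<rat>. N q"]) auto
qed

section \<open>The mass of the bump, and the limit of shrinking boxes\<close>

definition bump_mass :: "'n::finite itself \<Rightarrow> real" where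
  "bump_mass _ = (LINT z|lebesgue. tens (\<lambda>_::'n. bump) z)"

lemma borel_measurable_tens:
  "(\<And>i. smooth1 (u i)) \<Longrightarrow> tens u \<in> borel_measurable borel"
  by (simp add: borel_measurable_continuous_onI continuous_on_tens)

lemma tens_box_bump_eq_0:
  assumes "\<epsilon> > 0" "z \<notin> cbox x (x + \<epsilon> *\<^sub>R One)"
  shows "tens (box_bump x \<epsilon>) z = 0"
proof -
  obtain j where "z $ j \<notin> {x $ j..x $ j + \<epsilon>}"
    using assms(2) unfolding mem_corner_box by auto
  then have "box_bump x \<epsilon> j (z $ j) = 0"
    by (rule box_bump_eq_0[OF assms(1)])
  then show ?thesis
    unfolding tens_def by (intro prod_zero) auto
qed

lemma integrable_tens_box_bump:
  assumes "\<epsilon> > 0"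
  shows "integrable lebesgue (tens (box_bump x \<epsilon>))"
proof -
  have "set_integrable lebesgue UNIV (\<lambda>z. 1 * tens (box_bump x \<epsilon>) z)"
  proof (rule set_integrable_tens[where K = "cbox x (x + \<epsilon> *\<^sub>R One)"])
    show "locally_integrable_on (\<lambda>z. 1) UNIV"
      unfolding locally_integrable_on_def
      by (metis absolutely_integrable_on_const lmeasurable_compact)
  qed (use assms tens_box_bump_eq_0 smooth1_box_bump in auto)
  then show ?thesis
    by (simp add: set_integrable_def)
qed

lemma integral_tens_box_bump:
  fixes x :: "real^'n::finite"
  assumes "\<epsilon> > 0"
  shows "(LINT z|lebesgue. tens (box_bump x \<epsilon>) z) = bump_mass TYPE('n)"
proof -
  have [measurable]: "tens (box_bump x \<epsilon>) \<in> borel_measurable borel" "tens (\<lambda>_::'n. bump) \<in> borel_measurable borel"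
    by (simp_all add: borel_measurable_tens smooth1_box_bump smooth1_bump)
  have sc: "\<epsilon> ^ CARD('n) * tens (box_bump x \<epsilon>) (x + \<epsilon> *\<^sub>R z) = tens (\<lambda>_. bump) z" for z
    using assms by (simp add: tens_def box_bump_def prod_dividef)
  have "(LINT z|lebesgue. tens (box_bump x \<epsilon>) z) = (LINT z|lborel. tens (box_bump x \<epsilon>) z)"
    by (rule integral_completion) simp
  also have "\<dots> = (LINT z|density (distr lborel borel (\<lambda>z. x + \<epsilon> *\<^sub>R z)) (\<lambda>_. \<epsilon> ^ CARD('n)). tens (box_bump x \<epsilon>) z)"
    using assms by (subst lborel_affine[of \<epsilon> x]) (auto simp: ennreal_power[symmetric])
  also have "\<dots> = (LINT z|lborel. \<epsilon> ^ CARD('n) * tens (box_bump x \<epsilon>) (x + \<epsilon> *\<^sub>R z))"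
    using assms by (subst integral_real_density) (auto simp: integral_distr)
  also have "\<dots> = (LINT z|lborel. tens (\<lambda>_::'n. bump) z)"
    by (simp only: sc)
  also have "\<dots> = (LINT z|lebesgue. tens (\<lambda>_::'n. bump) z)"
    by (rule integral_completion[symmetric]) simp
  finally show ?thesis
    by (simp add: bump_mass_def)
qed

lemma bump_mass_pos: "bump_mass TYPE('n::finite) > 0"
proof -
  let ?\<phi> = "tens (\<lambda>_::'n. bump)"
  have nonneg: "?\<phi> z \<ge> 0" for z
    unfolding tens_def by (intro prod_nonneg) (simp add: bump_nonneg)
  have eq: "box_bump 0 1 = (\<lambda>_::'n. bump)"
    by (auto simp: box_bump_def)
  have int: "integrable lebesgue ?\<phi>"
    using integrable_tens_box_bump[of 1 "0 :: real^'n"] by (simp add: eq)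
  have "bump_mass TYPE('n) \<noteq> 0"
  proof
    assume "bump_mass TYPE('n) = 0"
    then have "AE z in lebesgue. ?\<phi> z = 0"
      unfolding bump_mass_def using integral_nonneg_eq_0_iff_AE[OF int] nonneg by simp
    moreover have op: "open {z. ?\<phi> z \<noteq> 0}"
      using continuous_on_tens[of "\<lambda>_::'n. bump" UNIV] smooth1_bump
      by (intro open_Collect_neq continuous_intros) auto
    then have "{z. ?\<phi> z \<noteq> 0} \<in> sets lebesgue"
      by simp
    ultimately have "negligible {z. ?\<phi> z \<noteq> 0}"
      unfolding negligible_iff_null_sets by (simp add: AE_iff_null_sets)
    moreover obtain s where "bump s > 0"
      by (rule bump_pos)
    then have "(\<chi> j. s) \<in> {z. ?\<phi> z \<noteq> 0}"
      by (simp add: tens_def)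
    ultimately show False
      using open_not_negligible[OF op] by blast
  qed
  moreover have "bump_mass TYPE('n) \<ge> 0"
    unfolding bump_mass_def using nonneg by (intro integral_nonneg_AE) auto
  ultimately show ?thesis by simp
qed


context weak_derivs
begin

text \<open>The kernel is at most \<open>(M / \<epsilon>)^n\<close> on a cube of volume
  \<open>\<epsilon>^n\<close>, so at a Lebesgue point the oscillation of \<open>D \<alpha>\<close>
  disappears in the limit and \<open>D \<alpha> x\<close> times the integral of the kernel remains.
  If \<open>\<alpha>\<close> is not zero, the monomial makes that integral of order
  \<open>\<epsilon>\<close>.\<close>

lemma taylor_term_tendsto:
  assumes U: "open U" "x \<in> U" and h: "set_integrable lebesgue U (D \<alpha>)"
    and LP: "lebesgue_point (\<lambda>z. indicat_real U z * D \<alpha> z) x"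
  shows "((\<lambda>\<epsilon>. LINT z:U|lebesgue. D \<alpha> z * tens (taylor_factor x \<alpha> (box_bump x \<epsilon>)) z)
    \<longlongrightarrow> (if mi_order \<alpha> = 0 then bump_mass TYPE('n) * D \<alpha> x else 0)) (at_right 0)"
proof -
  obtain M where M: "M \<ge> 1" "\<And>s. \<bar>bump s\<bar> \<le> M"
    by (rule bump_bounded) blast
  define h where "h z = indicat_real U z * D \<alpha> z" for z
  have hx: "h x = D \<alpha> x"
    using U by (simp add: h_def)
  have hint: "integrable lebesgue h"
    using assms(3) by (simp add: h_def[abs_def] set_integrable_def)
  define \<tau> where "\<tau> \<epsilon> = tens (taylor_factor x \<alpha> (box_bump x \<epsilon>))" for \<epsilon>
  let ?Q = "\<lambda>\<epsilon>. cbox x (x + \<epsilon> *\<^sub>R One)"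
  define L where "L = (if mi_order \<alpha> = 0 then bump_mass TYPE('n) * D \<alpha> x else 0)"
  have sm: "smooth1 (taylor_factor x \<alpha> (box_bump x \<epsilon>) j)" for \<epsilon> j
    by (intro smooth1_taylor_factor smooth1_box_bump)
  have \<tau>m [measurable]: "\<tau> \<epsilon> \<in> borel_measurable lebesgue" for \<epsilon>
    unfolding \<tau>_def by (intro measurable_completion) (simp add: borel_measurable_tens sm)
  have \<tau>_le: "\<bar>\<tau> \<epsilon> z\<bar> \<le> \<epsilon> ^ mi_order \<alpha> * (M / \<epsilon>) ^ CARD('n) * indicator (?Q \<epsilon>) z" if "\<epsilon> > 0" for \<epsilon> z
  proof (cases "z \<in> ?Q \<epsilon>")
    case True
    have near: "\<bar>x $ j - z $ j\<bar> \<le> \<epsilon>" for j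
    proof -
      have "x $ j \<le> z $ j \<and> z $ j \<le> x $ j + \<epsilon>"
        using True unfolding mem_corner_box by blast
      then show ?thesis by linarith
    qed
    have "\<bar>\<Prod>j\<in>UNIV. (x $ j - z $ j) ^ \<alpha> j\<bar> = (\<Prod>j\<in>UNIV. \<bar>x $ j - z $ j\<bar> ^ \<alpha> j)"
      by (simp add: abs_prod power_abs)
    also have "\<dots> \<le> (\<Prod>j\<in>UNIV. \<epsilon> ^ \<alpha> j)"
      using near by (intro prod_mono) (auto intro: power_mono)
    also have "\<dots> = \<epsilon> ^ mi_order \<alpha>"
      by (simp add: power_sum[symmetric] mi_order_def)
    finally have 1: "\<bar>\<Prod>j\<in>UNIV. (x $ j - z $ j) ^ \<alpha> j\<bar> \<le> \<epsilon> ^ mi_order \<alpha>" .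
    have "\<bar>tens (box_bump x \<epsilon>) z\<bar> = (\<Prod>j\<in>UNIV. \<bar>box_bump x \<epsilon> j (z $ j)\<bar>)"
      by (simp add: tens_def abs_prod)
    also have "\<dots> \<le> (\<Prod>j\<in>(UNIV :: 'n set). M / \<epsilon>)"
      using M that by (intro prod_mono) (auto simp: box_bump_def abs_divide divide_right_mono)
    finally have 2: "\<bar>tens (box_bump x \<epsilon>) z\<bar> \<le> (M / \<epsilon>) ^ CARD('n)"
      by simp
    show ?thesis
      using mult_mono[OF 1 2] that True by (simp add: \<tau>_def tens_taylor_factor abs_mult)
  next
    case False
    then show ?thesis
      using tens_box_bump_eq_0[OF that False] by (simp add: \<tau>_def tens_taylor_factor)
  qed
  have Q_int: "integrable lebesgue (indicat_real (?Q \<epsilon>))" for \<epsilon>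
    by (intro integrable_real_indicator) (simp_all add: emeasure_lborel_cbox_finite[unfolded infinity_ennreal_def])
  have \<tau>_int: "integrable lebesgue (\<tau> \<epsilon>)" if "\<epsilon> > 0" for \<epsilon>
  proof (rule Bochner_Integration.integrable_bound)
    show "integrable lebesgue (\<lambda>z. \<epsilon> ^ mi_order \<alpha> * (M / \<epsilon>) ^ CARD('n) * indicator (?Q \<epsilon>) z)"
      by (intro integrable_mult_right Q_int)
    show "AE z in lebesgue. norm (\<tau> \<epsilon> z) \<le> norm (\<epsilon> ^ mi_order \<alpha> * (M / \<epsilon>) ^ CARD('n) * indicat_real (?Q \<epsilon>) z)"
      unfolding real_norm_def by (intro AE_I2 order.trans[OF \<tau>_le[OF that] abs_ge_self])
  qed (rule \<tau>m)
  have bound: "\<bar>(LINT z:U|lebesgue. D \<alpha> z * \<tau> \<epsilon> z) - L\<bar> \<le> M ^ CARD('n) * (e + \<epsilon> * \<bar>h x\<bar>)"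
    if \<epsilon>: "0 < \<epsilon>" "\<epsilon> \<le> 1" and e: "(LINT z:?Q \<epsilon>|lebesgue. \<bar>h z - h x\<bar>) \<le> e * \<epsilon> ^ CARD('n)" for \<epsilon> e
  proof -
    have si: "set_integrable lebesgue (?Q \<epsilon>) (\<lambda>z. \<bar>h z - h x\<bar>)"
      by (rule set_integrable_corner[OF hint])
    have i1: "integrable lebesgue (\<lambda>z. (M / \<epsilon>) ^ CARD('n) * (indicator (?Q \<epsilon>) z * \<bar>h z - h x\<bar>))"
      using si by (intro integrable_mult_right) (simp add: set_integrable_def)
    have le1: "\<bar>(h z - h x) * \<tau> \<epsilon> z\<bar> \<le> (M / \<epsilon>) ^ CARD('n) * (indicator (?Q \<epsilon>) z * \<bar>h z - h x\<bar>)" for z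
    proof -
      have "\<epsilon> ^ mi_order \<alpha> \<le> 1"
        using \<epsilon> by (intro power_le_one) auto
      then have "\<epsilon> ^ mi_order \<alpha> * (M / \<epsilon>) ^ CARD('n) * indicat_real (?Q \<epsilon>) z \<le> 1 * (M / \<epsilon>) ^ CARD('n) * indicat_real (?Q \<epsilon>) z"
        using \<epsilon> M by (intro mult_right_mono) auto
      then have "\<bar>\<tau> \<epsilon> z\<bar> \<le> (M / \<epsilon>) ^ CARD('n) * indicator (?Q \<epsilon>) z"
        using \<tau>_le[OF \<epsilon>(1), of z] by linarith
      then have "\<bar>h z - h x\<bar> * \<bar>\<tau> \<epsilon> z\<bar> \<le> \<bar>h z - h x\<bar> * ((M / \<epsilon>) ^ CARD('n) * indicator (?Q \<epsilon>) z)"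
        by (rule mult_left_mono) simp
      then show ?thesis
        by (simp add: abs_mult mult_ac)
    qed
    have hm [measurable]: "h \<in> borel_measurable lebesgue"
      using hint by (rule borel_measurable_integrable)
    have i2: "integrable lebesgue (\<lambda>z. (h z - h x) * \<tau> \<epsilon> z)"
    proof (rule Bochner_Integration.integrable_bound[OF i1])
      show "AE z in lebesgue. norm ((h z - h x) * \<tau> \<epsilon> z) \<le> norm ((M / \<epsilon>) ^ CARD('n) * (indicator (?Q \<epsilon>) z * \<bar>h z - h x\<bar>))"
        unfolding real_norm_def by (intro AE_I2 order.trans[OF le1 abs_ge_self])
    qed measurable
    have "(LINT z:U|lebesgue. D \<alpha> z * \<tau> \<epsilon> z) = (LINT z|lebesgue. (h z - h x) * \<tau> \<epsilon> z + h x * \<tau> \<epsilon> z)"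
      by (simp add: set_lebesgue_integral_def h_def algebra_simps)
    also have "\<dots> = (LINT z|lebesgue. (h z - h x) * \<tau> \<epsilon> z) + h x * (LINT z|lebesgue. \<tau> \<epsilon> z)"
      using i2 \<tau>_int[OF \<epsilon>(1)] by simp
    finally have eq: "(LINT z:U|lebesgue. D \<alpha> z * \<tau> \<epsilon> z) - L
      = (LINT z|lebesgue. (h z - h x) * \<tau> \<epsilon> z) + (h x * (LINT z|lebesgue. \<tau> \<epsilon> z) - L)" by simp
    have "\<bar>LINT z|lebesgue. (h z - h x) * \<tau> \<epsilon> z\<bar> \<le> (LINT z|lebesgue. \<bar>(h z - h x) * \<tau> \<epsilon> z\<bar>)"
      by (rule integral_abs_bound)
    also have "\<dots> \<le> (LINT z|lebesgue. (M / \<epsilon>) ^ CARD('n) * (indicator (?Q \<epsilon>) z * \<bar>h z - h x\<bar>))"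
      using i1 i2 le1 by (intro integral_mono integrable_abs) auto
    also have "\<dots> = (M / \<epsilon>) ^ CARD('n) * (LINT z:?Q \<epsilon>|lebesgue. \<bar>h z - h x\<bar>)"
      by (simp add: set_lebesgue_integral_def)
    also have "\<dots> \<le> (M / \<epsilon>) ^ CARD('n) * (e * \<epsilon> ^ CARD('n))"
      using \<epsilon> M e by (intro mult_left_mono) auto
    also have "\<dots> = M ^ CARD('n) * e"
      using \<epsilon> by (simp add: power_divide)
    finally have b1: "\<bar>LINT z|lebesgue. (h z - h x) * \<tau> \<epsilon> z\<bar> \<le> M ^ CARD('n) * e" .
    have b2: "\<bar>h x * (LINT z|lebesgue. \<tau> \<epsilon> z) - L\<bar> \<le> M ^ CARD('n) * (\<epsilon> * \<bar>h x\<bar>)"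
    proof (cases "mi_order \<alpha> = 0")
      case True
      then have "\<tau> \<epsilon> = tens (box_bump x \<epsilon>)"
        by (auto simp: \<tau>_def taylor_factor_def mi_order_def)
      then have "(LINT z|lebesgue. \<tau> \<epsilon> z) = bump_mass TYPE('n)"
        using integral_tens_box_bump[OF \<epsilon>(1)] by simp
      then show ?thesis
        using True M \<epsilon> hx by (simp add: L_def)
    next
      case False
      have "\<bar>LINT z|lebesgue. \<tau> \<epsilon> z\<bar> \<le> (LINT z|lebesgue. \<bar>\<tau> \<epsilon> z\<bar>)"
        by (rule integral_abs_bound)
      also have "\<dots> \<le> (LINT z|lebesgue. \<epsilon> ^ mi_order \<alpha> * (M / \<epsilon>) ^ CARD('n) * indicator (?Q \<epsilon>) z)"
        using \<tau>_le[OF \<epsilon>(1)] \<tau>_int[OF \<epsilon>(1)] Q_int by (intro integral_mono integrable_abs integrable_mult_right) auto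
      also have "\<dots> = \<epsilon> ^ mi_order \<alpha> * M ^ CARD('n)"
        using \<epsilon> measure_corner_box[of \<epsilon> x] by (simp add: power_divide)
      also have "\<dots> \<le> \<epsilon> ^ 1 * M ^ CARD('n)"
        using \<epsilon> False M by (intro mult_right_mono power_decreasing) auto
      finally have "\<bar>h x\<bar> * \<bar>LINT z|lebesgue. \<tau> \<epsilon> z\<bar> \<le> \<bar>h x\<bar> * (\<epsilon> * M ^ CARD('n))"
        by (intro mult_left_mono) auto
      then show ?thesis
        using False by (simp add: L_def abs_mult mult_ac)
    qed
    show ?thesis
      unfolding eq distrib_left using b1 b2 by linarith
  qed
  show ?thesis
    unfolding \<tau>_def[symmetric] L_def[symmetric]
  proof (rule tendstoI)
    fix e :: real assume "e > 0"
    define e1 where "e1 = e / (4 * M ^ CARD('n))"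
    have e1: "e1 > 0" "M ^ CARD('n) * e1 = e / 4"
      using \<open>e > 0\<close> M by (auto simp: e1_def)
    obtain d where d: "d > 0" "\<And>\<epsilon>. 0 < \<epsilon> \<Longrightarrow> \<epsilon> < d \<Longrightarrow> (LINT z:?Q \<epsilon>|lebesgue. \<bar>h z - h x\<bar>) \<le> e1 * \<epsilon> ^ CARD('n)"
      using LP e1(1) unfolding lebesgue_point_def h_def[symmetric] by blast
    define d' where "d' = min (min d 1) (e1 / (\<bar>h x\<bar> + 1))"
    have "d' > 0"
      using d e1 by (simp add: d'_def add_nonneg_pos)
    moreover have "dist (LINT z:U|lebesgue. D \<alpha> z * \<tau> \<epsilon> z) L < e" if "0 < \<epsilon>" "\<epsilon> < d'" for \<epsilon>
    proof -
      have "\<epsilon> * (\<bar>h x\<bar> + 1) < e1"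
        using that by (simp add: d'_def pos_less_divide_eq add_nonneg_pos)
      then have *: "\<epsilon> * \<bar>h x\<bar> \<le> e1"
        using that by (simp add: algebra_simps)
      have "\<bar>(LINT z:U|lebesgue. D \<alpha> z * \<tau> \<epsilon> z) - L\<bar> \<le> M ^ CARD('n) * (e1 + \<epsilon> * \<bar>h x\<bar>)"
        by (rule bound) (use that d in \<open>auto simp: d'_def\<close>)
      also have "\<dots> \<le> M ^ CARD('n) * (e1 + e1)"
        using * M by (intro mult_left_mono) auto
      also have "\<dots> < e"
        unfolding distrib_left e1(2) using \<open>e > 0\<close> by simp
      finally show ?thesis
        by (simp add: dist_real_def)
    qed
    ultimately show "\<forall>\<^sub>F \<epsilon> in at_right 0. dist (LINT z:U|lebesgue. D \<alpha> z * \<tau> \<epsilon> z) L < e"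
      unfolding eventually_at_right_field by blast
  qed
qed

lemma taylor_tendsto:
  assumes U: "open U" "x \<in> U" and h: "\<And>\<alpha>. mi_order \<alpha> < m \<Longrightarrow> set_integrable lebesgue U (D \<alpha>)"
    and LP: "\<And>\<alpha>. mi_order \<alpha> < m \<Longrightarrow> lebesgue_point (\<lambda>z. indicat_real U z * D \<alpha> z) x"
  shows "((\<lambda>\<epsilon>. taylor (box_bump x \<epsilon>) x) \<longlongrightarrow> bump_mass TYPE('n) * D (\<lambda>_. 0) x) (at_right 0)"
proof -
  have "((\<lambda>\<epsilon>. taylor (box_bump x \<epsilon>) x) \<longlongrightarrow> (\<Sum>\<alpha> | mi_order \<alpha> < m. (1 / mi_fact \<alpha>) *
      (if mi_order \<alpha> = 0 then bump_mass TYPE('n) * D \<alpha> x else 0))) (at_right 0)"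
    unfolding taylor_def by (intro tendsto_sum tendsto_mult tendsto_const taylor_term_tendsto U h LP) auto
  also have "(\<Sum>\<alpha> | mi_order \<alpha> < m. (1 / mi_fact \<alpha>) * (if mi_order \<alpha> = 0 then bump_mass TYPE('n) * D \<alpha> x else 0))
      = (\<Sum>\<alpha>\<in>{\<lambda>_::'n. 0}. (1 / mi_fact \<alpha>) * (if mi_order \<alpha> = 0 then bump_mass TYPE('n) * D \<alpha> x else 0))"
    using m_pos by (intro sum.mono_neutral_right finite_mi_order_less) (auto simp: mi_order_def fun_eq_iff)
  also have "\<dots> = bump_mass TYPE('n) * D (\<lambda>_. 0) x"
    by (simp add: mi_order_def mi_fact_def)
  finally show ?thesis .
qed

end

text \<open>For \<open>m < n\<close> this is comparable to the integral of \<open>G\<close> against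
  the kernel \<open>|x - z|^(m - n)\<close> on the ball of radius \<open>2 R\<close> about
  \<open>x\<close>. The largest radius is \<open>2 R\<close> because a ball of radius
  \<open>R\<close> is contained in the ball of radius \<open>2 R\<close> about each of its
  points.\<close>

definition riesz :: "nat \<Rightarrow> real \<Rightarrow> ('a::euclidean_space \<Rightarrow> ennreal) \<Rightarrow> 'a \<Rightarrow> ennreal" where
  "riesz m R G x = (\<Sum>k. ennreal ((2 * R / 2 ^ k) ^ m / (2 * R / 2 ^ k) ^ DIM('a)) *
     (\<integral>\<^sup>+z\<in>ball x (2 * R / 2 ^ k). G z \<partial>lebesgue))"

section \<open>The chain of boxes from the centre of the ball to the point\<close>

lemma norm_le_norm_add_cart:
  fixes v d :: "real^'n::finite"
  assumes "\<And>j. \<bar>v $ j\<bar> \<le> \<bar>d $ j\<bar> + e" "0 \<le> e"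
  shows "norm v \<le> norm d + real CARD('n) * e"
proof -
  have "norm v \<le> norm ((\<chi> j. \<bar>d $ j\<bar>) + (\<chi> j. e) :: real^'n)"
    using assms by (intro norm_le_componentwise_cart) auto
  also have "\<dots> \<le> norm (\<chi> j. \<bar>d $ j\<bar> :: real^'n) + norm (\<chi> j. e :: real^'n)"
    by (rule norm_triangle_ineq)
  also have "norm (\<chi> j. \<bar>d $ j\<bar> :: real^'n) \<le> norm d"
    by (intro norm_le_componentwise_cart) auto
  also have "norm (\<chi> j. e :: real^'n) \<le> real CARD('n) * e"
    using norm_le_l1_cart[of "\<chi> j. e :: real^'n"] assms(2) by simp
  finally show ?thesis by simp
qed

context weak_derivs
begin

text \<open>
  The boxes shrink to \<open>x\<close> along the segment from the centre of the ball, so that they and the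
  hulls of consecutive ones stay inside the ball even when \<open>x\<close> is close to its boundary.
\<close>

lemma taylor_chain:
  fixes c x :: "real^'n" and R M :: real
  assumes U: "U = ball c R" and x: "x \<in> U" and M: "M \<ge> 1" "\<And>s. \<bar>bump s\<bar> \<le> M"
    and t: "0 < t" "t \<le> 1"
    and a: "a = x + t *\<^sub>R (c - x)" "a' = x + s *\<^sub>R (c - x)" "\<epsilon> = t * (R / (4 * CARD('n)))" 
    and st: "s = t / 2 \<and> \<epsilon>' = \<epsilon> / 2 \<or> s = 0 \<and> \<epsilon>' = \<epsilon> \<and> 2 * R * t < R - dist c x"
  shows "ennreal \<bar>taylor (box_bump a \<epsilon>) x - taylor (box_bump a' \<epsilon>') x\<bar> \<le>
    ennreal (real CARD('n) * (real (card {\<alpha> :: 'n \<Rightarrow> nat. mi_order \<alpha> = m - 1}) * (16 * CARD('n) * M) ^ (CARD('n) - 1))) *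
    (ennreal ((2 * R * t) ^ m / (2 * R * t) ^ CARD('n)) * (\<integral>\<^sup>+z\<in>ball x (2 * R * t). (grad z * indicator U z) \<partial>lebesgue))"
proof -
  define n where "n = CARD('n)"
  have n: "n > 0" by (simp add: n_def)
  define N where "N = real (card {\<alpha> :: 'n \<Rightarrow> nat. mi_order \<alpha> = m - 1})"
  have cx: "norm (c - x) < R"
    using x U by (simp add: dist_norm)
  then have R: "R > 0" using norm_ge_zero[of "c - x"] by linarith
  have \<epsilon>: "\<epsilon> > 0" using a(3) t R by simp
  have n\<epsilon>: "n * \<epsilon> = t * R / 4" using a(3) n by (simp add: n_def)
  have sub: "z \<in> U \<and> z \<in> ball x (2 * R * t)" if z: "z \<in> hull_box a \<epsilon> a' \<epsilon>'" for z
    using st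
  proof
    assume A: "s = t / 2 \<and> \<epsilon>' = \<epsilon> / 2"
    have "\<bar>(z - a) $ j\<bar> \<le> \<bar>(a' - a) $ j\<bar> + \<epsilon>" for j
      using z[unfolded mem_hull_box, rule_format, of j] A \<epsilon> by (auto simp: min_def max_def split: if_splits)
    from norm_le_norm_add_cart[OF this] \<epsilon> have "norm (z - a) \<le> norm (a' - a) + n * \<epsilon>"
      by (simp add: n_def)
    also have "a' - a = (- t / 2) *\<^sub>R (c - x)"
    proof -
      have "a' - a = (s - t) *\<^sub>R (c - x)"
        by (simp add: a scaleR_left_diff_distrib)
      also have "s - t = - t / 2"
        using A by simp
      finally show ?thesis .
    qed
    also have "norm \<dots> = t / 2 * norm (c - x)"
      using t by simp
    also have "t / 2 * norm (c - x) \<le> t / 2 * R"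
      using t cx by (intro mult_left_mono) auto
    finally have za: "norm (z - a) \<le> 3 / 4 * (t * R)"
      unfolding n\<epsilon> by (simp add: mult.commute)
    \<comment> \<open>The point \<open>a\<close> has distance at least \<open>t * R\<close> from the
      boundary, and the hull reaches at most
      \<open>t * R / 2 + n * \<epsilon> = 3 / 4 * (t * R)\<close> away from \<open>a\<close>. The
      factor \<open>1 / (4 * CARD('n))\<close> in \<open>\<epsilon>\<close> is chosen for this
      purpose.\<close>
    have "c - a = (1 - t) *\<^sub>R (c - x)"
      by (simp add: a algebra_simps)
    then have "norm (c - a) = (1 - t) * norm (c - x)"
      using t by simp
    also have "\<dots> \<le> (1 - t) * R"
      using t cx by (intro mult_left_mono) auto
    finally have "norm (c - z) \<le> (1 - t) * R + 3 / 4 * (t * R)"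
      using za norm_triangle_ineq4[of "c - a" "z - a"] by simp
    also have "\<dots> < R"
      using t R by (simp add: algebra_simps)
    finally have 1: "z \<in> U" by (simp add: U dist_norm)
    have "norm (a - x) = t * norm (c - x)"
      using t by (simp add: a)
    also have "\<dots> \<le> t * R"
      using t cx by (intro mult_left_mono) auto
    finally have "norm (z - x) \<le> 3 / 4 * (t * R) + t * R"
      using za norm_triangle_ineq[of "z - a" "a - x"] by (simp add: mult.commute)
    also have "\<dots> < 2 * R * t"
      using t R by (simp add: algebra_simps)
    finally show ?thesis
      using 1 by (simp add: dist_norm norm_minus_commute)
  next
    \<comment> \<open>The jump from the segment to the box at \<open>x\<close> itself does not use
      the shape of the ball; it has to wait until \<open>2 * R * t\<close> is smaller than the
      distance of \<open>x\<close> from the boundary.\<close>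
    assume A: "s = 0 \<and> \<epsilon>' = \<epsilon> \<and> 2 * R * t < R - dist c x"
    have "\<bar>(z - x) $ j\<bar> \<le> \<bar>(a - x) $ j\<bar> + \<epsilon>" for j
      using z[unfolded mem_hull_box, rule_format, of j] A \<epsilon> a(2) by (auto simp: min_def max_def split: if_splits)
    from norm_le_norm_add_cart[OF this] \<epsilon> have "norm (z - x) \<le> norm (a - x) + n * \<epsilon>"
      by (simp add: n_def)
    also have "norm (a - x) = t * norm (c - x)"
      using t by (simp add: a)
    also have "\<dots> \<le> t * R"
      using t cx by (intro mult_left_mono) auto
    finally have zx: "norm (z - x) \<le> t * R + t * R / 4"
      unfolding n\<epsilon> by simp
    also have "\<dots> < 2 * R * t"
      using t R by (simp add: algebra_simps)
    finally have "norm (z - x) < 2 * R * t" .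
    moreover from this have "norm (c - z) < R"
      using A norm_triangle_ineq4[of "c - x" "z - x"] by (simp add: dist_norm)
    ultimately show ?thesis
      by (simp add: U dist_norm norm_minus_commute)
  qed
  have "ennreal \<bar>taylor (box_bump a \<epsilon>) x - taylor (box_bump a' \<epsilon>') x\<bar> \<le>
    ennreal (real CARD('n) * (real (card {\<alpha> :: 'n \<Rightarrow> nat. mi_order \<alpha> = m - 1}) * (2 * R * t) ^ (m - 1) * (M / (\<epsilon> / 2)) ^ (CARD('n) - 1)))
      * (\<integral>\<^sup>+z\<in>hull_box a \<epsilon> a' \<epsilon>'. grad z \<partial>lebesgue)"
  proof (rule taylor_change_box[OF _ _ _ _ M])
    show "0 < \<epsilon> / 2" "\<epsilon> / 2 \<le> \<epsilon>" "\<epsilon> / 2 \<le> \<epsilon>'" using \<epsilon> st by auto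
    show "hull_box a \<epsilon> a' \<epsilon>' \<subseteq> U" using sub by blast
    show "0 \<le> 2 * R * t" using R t by simp
    show "\<bar>x $ j - z $ j\<bar> \<le> 2 * R * t" if "z \<in> hull_box a \<epsilon> a' \<epsilon>'" for z j
    proof -
      have "\<bar>(x - z) $ j\<bar> \<le> norm (x - z)" by (rule component_le_norm_cart)
      also have "\<dots> \<le> 2 * R * t" using sub[OF that] by (simp add: dist_norm)
      finally show ?thesis by simp
    qed
  qed
  also have "\<dots> \<le> ennreal (n * (N * (16 * n * M) ^ (n - 1)) * ((2 * R * t) ^ m / (2 * R * t) ^ n))
      * (\<integral>\<^sup>+z\<in>ball x (2 * R * t). (grad z * indicator U z) \<partial>lebesgue)"
  proof (rule mult_mono[OF ennreal_leI nn_integral_mono])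
    \<comment> \<open>The smallest side \<open>\<epsilon> / 2\<close> is the fraction
      \<open>1 / (16 n)\<close> of the radius \<open>2 * R * t\<close>; this is the origin of the
      constant \<open>16\<close>.\<close>
    have "M / (\<epsilon> / 2) = 16 * n * M / (2 * R * t)"
      unfolding a(3) n_def using t R by (simp add: field_simps)
    moreover have "(2 * R * t) ^ m = (2 * R * t) ^ (m - 1) * (2 * R * t)" "(2 * R * t) ^ n = (2 * R * t) ^ (n - 1) * (2 * R * t)"
      using m_pos n by (simp_all add: power_Suc2[symmetric] del: power_Suc)
    moreover have "X ^ (m - 1) * (Y / X) ^ (n - 1) = Y ^ (n - 1) * ((X ^ (m - 1) * X) / (X ^ (n - 1) * X))"
      if "X > 0" for X Y :: real
      using that by (simp add: power_divide)
    ultimately have "(2 * R * t) ^ (m - 1) * (M / (\<epsilon> / 2)) ^ (n - 1) = (16 * n * M) ^ (n - 1) * ((2 * R * t) ^ m / (2 * R * t) ^ n)"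
      using R t by (simp only: mult_pos_pos zero_less_numeral)
    then have "n * (N * ((2 * R * t) ^ (m - 1) * (M / (\<epsilon> / 2)) ^ (n - 1))) = n * (N * (16 * n * M) ^ (n - 1)) * ((2 * R * t) ^ m / (2 * R * t) ^ n)"
      by (simp only: mult_ac)
    then show "real CARD('n) * (real (card {\<alpha> :: 'n \<Rightarrow> nat. mi_order \<alpha> = m - 1}) * (2 * R * t) ^ (m - 1) * (M / (\<epsilon> / 2)) ^ (CARD('n) - 1))
      \<le> n * (N * (16 * n * M) ^ (n - 1)) * ((2 * R * t) ^ m / (2 * R * t) ^ n)"
      by (simp add: n_def N_def mult.assoc)
    show "grad z * indicator (hull_box a \<epsilon> a' \<epsilon>') z \<le> grad z * indicator U z * indicator (ball x (2 * R * t)) z" for z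
      using sub[of z] by (auto simp: indicator_def)
  qed auto
  also have "\<dots> = ennreal (n * (N * (16 * n * M) ^ (n - 1))) * (ennreal ((2 * R * t) ^ m / (2 * R * t) ^ n)
      * (\<integral>\<^sup>+z\<in>ball x (2 * R * t). (grad z * indicator U z) \<partial>lebesgue))"
    using R t M by (subst ennreal_mult) (auto simp: N_def mult.assoc)
  finally show ?thesis
    by (simp add: n_def N_def)
qed

text \<open>The differences along the segment telescope from \<open>T 0\<close>, whose box lies at
  the centre \<open>c\<close>, and a single jump to the box at \<open>x\<close> ends the chain at a
  finite stage. Each difference costs one term of the potential, the jump the next one. As the stage
  grows, the boxes at \<open>x\<close> shrink and \<open>T'\<close> tends to the mass of the bump
  times the value at \<open>x\<close>.\<close>

lemma taylor_pointwise:
  fixes c x :: "real^'n" and R M :: real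
  assumes U: "U = ball c R" and x: "x \<in> U" and M: "M \<ge> 1" "\<And>s. \<bar>bump s\<bar> \<le> M"
    and h: "\<And>\<alpha>. mi_order \<alpha> < m \<Longrightarrow> set_integrable lebesgue U (D \<alpha>)"
    and LP: "\<And>\<alpha>. mi_order \<alpha> < m \<Longrightarrow> lebesgue_point (\<lambda>z. indicat_real U z * D \<alpha> z) x"
  shows "ennreal \<bar>D (\<lambda>_. 0) x - taylor (box_bump c (R / (4 * CARD('n)))) x / bump_mass TYPE('n)\<bar> \<le>
    ennreal (real CARD('n) * (real (card {\<alpha> :: 'n \<Rightarrow> nat. mi_order \<alpha> = m - 1}) * (16 * CARD('n) * M) ^ (CARD('n) - 1))
      / bump_mass TYPE('n)) * riesz m R (\<lambda>z. grad z * indicator U z) x"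
proof -
  define C1 where "C1 = real CARD('n) * (real (card {\<alpha> :: 'n \<Rightarrow> nat. mi_order \<alpha> = m - 1}) * (16 * CARD('n) * M) ^ (CARD('n) - 1))"
  have C1: "C1 \<ge> 0" using M by (simp add: C1_def)
  define \<epsilon>0 where "\<epsilon>0 = R / (4 * CARD('n))"
  have cx: "norm (c - x) < R"
    using x U by (simp add: dist_norm)
  then have R: "R > 0" using norm_ge_zero[of "c - x"] by linarith
  define q where "q k = ennreal ((2 * R / 2 ^ k) ^ m / (2 * R / 2 ^ k) ^ DIM(real^'n)) *
     (\<integral>\<^sup>+z\<in>ball x (2 * R / 2 ^ k). (grad z * indicator U z) \<partial>lebesgue)" for k :: nat
  define T where "T k = taylor (box_bump (x + (1 / 2 ^ k) *\<^sub>R (c - x)) (1 / 2 ^ k * \<epsilon>0)) x" for k :: nat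
  define T' where "T' k = taylor (box_bump x (1 / 2 ^ k * \<epsilon>0)) x" for k :: nat
  have e: "1 / 2 ^ Suc k = (1 / 2 ^ k) / (2 :: real)" "1 / 2 ^ k / 2 * \<epsilon>0 = 1 / 2 ^ k * \<epsilon>0 / 2"
    "2 * R / 2 ^ k = 2 * R * (1 / 2 ^ k)" for k
    by simp_all
  have step: "ennreal \<bar>T k - T (Suc k)\<bar> \<le> ennreal C1 * q k" for k
    unfolding T_def q_def C1_def e DIM_cart DIM_real mult_1_right
    by (rule taylor_chain[OF U x M, where s = "1 / 2 ^ k / 2"]) (simp_all add: \<epsilon>0_def)
  have last: "ennreal \<bar>T k - T' k\<bar> \<le> ennreal C1 * q k" if "2 * R * (1 / 2 ^ k) < R - dist c x" for k
    unfolding T_def T'_def q_def C1_def e DIM_cart DIM_real mult_1_right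
    by (rule taylor_chain[OF U x M, where s = 0]) (use that in \<open>simp_all add: \<epsilon>0_def\<close>)
  have tri: "ennreal \<bar>a - b\<bar> \<le> ennreal \<bar>a - d\<bar> + ennreal \<bar>d - b\<bar>" for a b d :: real
    unfolding ennreal_plus[OF abs_ge_zero abs_ge_zero, symmetric] by (rule ennreal_leI) linarith
  have sum: "ennreal \<bar>T 0 - T K\<bar> \<le> ennreal C1 * (\<Sum>k<K. q k)" for K
  proof (induction K)
    case (Suc K)
    have "ennreal \<bar>T 0 - T (Suc K)\<bar> \<le> ennreal C1 * (\<Sum>k<K. q k) + ennreal C1 * q K"
      by (rule order.trans[OF tri[of _ _ "T K"]]) (intro add_mono Suc step)
    then show ?case by (simp add: distrib_left)
  qed simp
  have bnd: "ennreal \<bar>T 0 - T' K\<bar> \<le> ennreal C1 * riesz m R (\<lambda>z. grad z * indicator U z) x"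
    if "2 * R * (1 / 2 ^ K) < R - dist c x" for K
  proof -
    have "ennreal \<bar>T 0 - T' K\<bar> \<le> ennreal C1 * (\<Sum>k<K. q k) + ennreal C1 * q K"
      by (rule order.trans[OF tri[of _ _ "T K"]]) (intro add_mono sum last that)
    also have "\<dots> = ennreal C1 * (\<Sum>k<Suc K. q k)" by (simp add: distrib_left)
    also have "\<dots> \<le> ennreal C1 * riesz m R (\<lambda>z. grad z * indicator U z) x"
      unfolding riesz_def q_def by (intro mult_left_mono sum_le_suminf) auto
    finally show ?thesis .
  qed
  have lim0: "(\<lambda>K. 1 / 2 ^ K * \<epsilon>0) \<longlonglongrightarrow> 0" "(\<lambda>K. 2 * R * (1 / 2 ^ K)) \<longlonglongrightarrow> 0"
    by (simp_all add: LIMSEQ_divide_realpow_zero)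
  have "filterlim (\<lambda>K. 1 / 2 ^ K * \<epsilon>0) (at_right 0) sequentially"
    using lim0(1) R unfolding filterlim_at by (auto simp: \<epsilon>0_def)
  from filterlim_compose[OF taylor_tendsto this] have "T' \<longlonglongrightarrow> bump_mass TYPE('n) * D (\<lambda>_. 0) x"
    using x h LP U by (simp add: T'_def[abs_def])
  then have "(\<lambda>K. ennreal \<bar>T 0 - T' K\<bar>) \<longlonglongrightarrow> ennreal \<bar>T 0 - bump_mass TYPE('n) * D (\<lambda>_. 0) x\<bar>"
    by (intro tendsto_intros)
  moreover have "\<forall>\<^sub>F K in sequentially. ennreal \<bar>T 0 - T' K\<bar> \<le> ennreal C1 * riesz m R (\<lambda>z. grad z * indicator U z) x"
    using order_tendstoD(2)[OF lim0(2), of "R - dist c x"] cx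
    by (auto simp: dist_norm elim!: eventually_mono intro: bnd)
  ultimately have main: "ennreal \<bar>T 0 - bump_mass TYPE('n) * D (\<lambda>_. 0) x\<bar> \<le> ennreal C1 * riesz m R (\<lambda>z. grad z * indicator U z) x"
    by (intro tendsto_upperbound) auto
  let ?\<kappa> = "bump_mass TYPE('n)"
  have \<kappa>: "?\<kappa> > 0" by (rule bump_mass_pos)
  have "\<bar>D (\<lambda>_. 0) x - T 0 / ?\<kappa>\<bar> = (1 / ?\<kappa>) * \<bar>T 0 - ?\<kappa> * D (\<lambda>_. 0) x\<bar>"
    using \<kappa> by (simp add: abs_if field_simps)
  then have "ennreal \<bar>D (\<lambda>_. 0) x - T 0 / ?\<kappa>\<bar> = ennreal (1 / ?\<kappa>) * ennreal \<bar>T 0 - ?\<kappa> * D (\<lambda>_. 0) x\<bar>"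
    using \<kappa> by (simp add: ennreal_mult'[symmetric])
  also have "\<dots> \<le> ennreal (1 / ?\<kappa>) * (ennreal C1 * riesz m R (\<lambda>z. grad z * indicator U z) x)"
    by (intro mult_left_mono main) simp
  also have "\<dots> = ennreal (C1 / ?\<kappa>) * riesz m R (\<lambda>z. grad z * indicator U z) x"
    using \<kappa> C1 by (simp add: mult.assoc[symmetric] ennreal_mult[symmetric])
  finally show ?thesis
    by (simp add: T_def C1_def \<epsilon>0_def)
qed

end

section \<open>Muckenhoupt weights\<close>

text \<open>Young's inequality, normalized by \<open>J\<close> and \<open>S\<close>, is applied
  pointwise and then integrated. Since only finite \<open>u\<close> and \<open>v\<close> below
  \<open>U\<close> and \<open>V\<close> are asked for, \<open>U\<close> and \<open>V\<close> may be
  infinite; exponents \<open>0\<close> and \<open>1\<close> are included, which covers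
  \<open>r = p\<close> later.\<close>

lemma nn_integral_Hoelder:
  fixes F U V :: "'a \<Rightarrow> ennreal"
  assumes ab: "\<alpha> \<ge> 0" "\<beta> \<ge> 0" "\<alpha> + \<beta> = 1" and J: "J > 0" "S > 0"
    and meas: "U \<in> borel_measurable M" "V \<in> borel_measurable M"
    and le: "(\<integral>\<^sup>+x. U x \<partial>M) \<le> ennreal J" "(\<integral>\<^sup>+x. V x \<partial>M) \<le> ennreal S"
    and F: "AE x in M. \<exists>u\<ge>0. \<exists>v\<ge>0. F x \<le> ennreal (u powr \<alpha> * v powr \<beta>) \<and> ennreal u \<le> U x \<and> ennreal v \<le> V x"
  shows "(\<integral>\<^sup>+x. F x \<partial>M) \<le> ennreal (J powr \<alpha> * S powr \<beta>)"
proof -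
  define K where "K = J powr \<alpha> * S powr \<beta>"
  have K: "K > 0" using J by (simp add: K_def)
  have "AE x in M. F x \<le> ennreal (K * \<alpha> / J) * U x + ennreal (K * \<beta> / S) * V x"
    using F
  proof eventually_elim
    fix x
    assume "\<exists>u\<ge>0. \<exists>v\<ge>0. F x \<le> ennreal (u powr \<alpha> * v powr \<beta>) \<and> ennreal u \<le> U x \<and> ennreal v \<le> V x"
    then obtain u v where uv: "0 \<le> u" "0 \<le> v" "F x \<le> ennreal (u powr \<alpha> * v powr \<beta>)"
      "ennreal u \<le> U x" "ennreal v \<le> V x"
      by blast
    have "u powr \<alpha> * v powr \<beta> \<le> K * \<alpha> / J * u + K * \<beta> / S * v"
    proof (cases "u = 0 \<or> v = 0")
      case True
      then show ?thesis using K J ab uv by auto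
    next
      case False
      then have "(u / J) powr \<alpha> * (v / S) powr \<beta> \<le> \<alpha> * (u / J) + \<beta> * (v / S)"
        using Youngs_inequality_0[OF ab, of "u / J" "v / S"] J uv by simp
      then have "K * ((u / J) powr \<alpha> * (v / S) powr \<beta>) \<le> K * (\<alpha> * (u / J) + \<beta> * (v / S))"
        using K by (intro mult_left_mono) auto
      moreover have "K * ((u / J) powr \<alpha> * (v / S) powr \<beta>) = u powr \<alpha> * v powr \<beta>"
        using J uv by (simp add: K_def powr_divide)
      ultimately show ?thesis
        by (simp add: algebra_simps)
    qed
    then have "F x \<le> ennreal (K * \<alpha> / J * u + K * \<beta> / S * v)"
      using uv(3) by (meson ennreal_leI order.trans)
    also have "\<dots> = ennreal (K * \<alpha> / J) * ennreal u + ennreal (K * \<beta> / S) * ennreal v"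
      using K J ab uv by (simp add: ennreal_mult[symmetric] ennreal_plus[symmetric] del: ennreal_plus)
    also have "\<dots> \<le> ennreal (K * \<alpha> / J) * U x + ennreal (K * \<beta> / S) * V x"
      using uv by (intro add_mono mult_left_mono) auto
    finally show "F x \<le> ennreal (K * \<alpha> / J) * U x + ennreal (K * \<beta> / S) * V x" .
  qed
  then have "(\<integral>\<^sup>+x. F x \<partial>M) \<le> (\<integral>\<^sup>+x. ennreal (K * \<alpha> / J) * U x + ennreal (K * \<beta> / S) * V x \<partial>M)"
    by (rule nn_integral_mono_AE)
  also have "\<dots> = ennreal (K * \<alpha> / J) * (\<integral>\<^sup>+x. U x \<partial>M) + ennreal (K * \<beta> / S) * (\<integral>\<^sup>+x. V x \<partial>M)"
    using meas by (simp add: nn_integral_add nn_integral_cmult)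
  also have "\<dots> \<le> ennreal (K * \<alpha> / J) * ennreal J + ennreal (K * \<beta> / S) * ennreal S"
    using le by (intro add_mono mult_left_mono) auto
  also have "\<dots> = ennreal (K * \<alpha> + K * \<beta>)"
    using K J ab by (simp add: ennreal_mult[symmetric] ennreal_plus[symmetric] del: ennreal_plus)
  also have "K * \<alpha> + K * \<beta> = K"
    using ab by (simp add: distrib_left[symmetric])
  finally show ?thesis by (simp add: K_def)
qed

section \<open>Powers in \<open>[0, \<infinity>]\<close>, volumes of balls and finiteness of
  weights\<close>

lemma epowr_measurable [measurable]: "(\<lambda>x. epowr x a) \<in> borel_measurable borel"
  unfolding epowr_def by measurable

lemma epowr_1: "epowr x 1 = x"
  by (auto simp: epowr_def less_top)

lemma epowr_ennreal: "x > 0 \<Longrightarrow> epowr (ennreal x) a = ennreal (x powr a)"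
  by (simp add: epowr_def)

lemma emeasure_lebesgue_ball:
  "emeasure lebesgue (ball x r :: 'a::euclidean_space set) = ennreal (measure lebesgue (ball x r))"
  using emeasure_lborel_ball_finite[of x r] by (simp add: emeasure_eq_ennreal_measure infinity_ennreal_def)

lemma measure_lebesgue_ball:
  "r \<ge> 0 \<Longrightarrow> measure lebesgue (ball x r :: 'a::euclidean_space set) = unit_ball_vol DIM('a) * r ^ DIM('a)"
  by (simp add: content_ball measure_completion)

lemma measure_lebesgue_ball_pos: "r > 0 \<Longrightarrow> measure lebesgue (ball x r :: 'a::euclidean_space set) > 0"
  by (simp add: measure_lebesgue_ball unit_ball_vol_pos)

lemma wmeas_mono: "A \<subseteq> B \<Longrightarrow> wmeas w A \<le> wmeas w B"
  unfolding wmeas_def by (intro nn_integral_mono) (auto simp: indicator_def)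

lemma wmeas_ball_finite:
  assumes "weight w"
  shows "wmeas w (ball x r) < \<infinity>"
proof -
  have "wmeas w (ball x r) \<le> wmeas w (cball x r)"
    by (intro wmeas_mono) auto
  also have "\<dots> < \<infinity>"
    using assms compact_cball by (auto simp: weight_def wmeas_def)
  finally show ?thesis .
qed

lemma weight_measurable: "weight w \<Longrightarrow> w \<in> borel_measurable lebesgue"
  by (simp add: weight_def)

lemma AE_weight_finite:
  assumes "weight w"
  shows "AE x in lebesgue. x \<in> ball c r \<longrightarrow> w x < \<infinity>"
proof -
  have [measurable]: "w \<in> borel_measurable lebesgue" by (rule weight_measurable[OF assms])
  have [measurable]: "ball c r \<in> sets lebesgue" by simp
  have "(\<integral>\<^sup>+x. w x * indicator (ball c r) x \<partial>lebesgue) \<noteq> \<infinity>"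
    using wmeas_ball_finite[OF assms, of c r] by (simp add: wmeas_def)
  then have "AE x in lebesgue. w x * indicator (ball c r) x \<noteq> \<infinity>"
    by (intro nn_integral_noteq_infinite) measurable
  then show ?thesis
    by eventually_elim (auto simp: indicator_def less_top)
qed

section \<open>The \<open>A_r\<close> condition on a single ball\<close>

definition dual_weight :: "real \<Rightarrow> ('a \<Rightarrow> ennreal) \<Rightarrow> 'a \<Rightarrow> ennreal" where
  "dual_weight r w = (\<lambda>x. epowr (w x) (1 - conj_exp r))"

lemma one_minus_conj_exp: "r \<noteq> 1 \<Longrightarrow> 1 - conj_exp r = - 1 / (r - 1)"
  by (simp add: conj_exp_def field_simps)

lemma ball_in_balls: "0 < \<rho> \<Longrightarrow> ball c \<rho> \<in> balls"
  by (auto simp: balls_def)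

text \<open>The ball \<open>D\<close> competes in the supremum \<open>maximal w x\<close> for each
  of its points, so the mean over \<open>D\<close> is at most the \<open>A_1\<close> constant times
  \<open>w x\<close>. A positive mean divided by \<open>0\<close> is \<open>\<infinity>\<close>,
  which excludes \<open>w x = 0\<close> almost everywhere.\<close>

lemma Ap_ball_r1:
  fixes w :: "'a::euclidean_space \<Rightarrow> ennreal"
  assumes w: "w \<in> Ap_class 1" and D: "D = ball c \<rho>" "\<rho> > 0" and pos: "wmeas w D > 0"
  shows "AE x in lebesgue. x \<in> D \<longrightarrow>
    enn2real (wmeas w D) / measure lebesgue D \<le> enn2real (Ap_const 1 w) * enn2real (w x) \<and> w x > 0"
proof -
  have wt: "weight w" and W: "Ap_const 1 w < \<infinity>" using w by (auto simp: Ap_class_def)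
  have "AE x in lebesgue. maximal w x / w x \<le> Ap_const 1 w"
    unfolding Ap_const_def using esssup_AE[of "\<lambda>x. maximal w x / w x" lebesgue] by simp
  then show ?thesis
    using AE_weight_finite[OF wt, of c \<rho>]
  proof eventually_elim
    fix x
    assume 1: "maximal w x / w x \<le> Ap_const 1 w" and 2: "x \<in> ball c \<rho> \<longrightarrow> w x < \<infinity>"
    show "x \<in> D \<longrightarrow> enn2real (wmeas w D) / measure lebesgue D \<le> enn2real (Ap_const 1 w) * enn2real (w x) \<and> w x > 0"
    proof
      assume x: "x \<in> D"
      then have fin: "w x < \<infinity>" using 2 D by simp
      have "eavg D w = eavg D w * indicator D x" using x by simp
      also have "\<dots> \<le> maximal w x"
        unfolding maximal_def by (rule SUP_upper) (use D in \<open>auto intro: ball_in_balls\<close>)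
      finally have "eavg D w / w x \<le> Ap_const 1 w"
        using 1 by (meson divide_right_mono_ennreal order.trans)
      have vol: "measure lebesgue D > 0"
        using D by (simp add: measure_lebesgue_ball_pos)
      have wD: "wmeas w D = ennreal (enn2real (wmeas w D))"
        using wmeas_ball_finite[OF wt, of c \<rho>] D by simp
      have av: "eavg D w = ennreal (enn2real (wmeas w D) / measure lebesgue D)"
        unfolding eavg_def wmeas_def[symmetric] using D vol
        by (subst wD) (simp add: emeasure_lebesgue_ball divide_ennreal)
      have avpos: "enn2real (wmeas w D) / measure lebesgue D > 0"
      proof -
        have "enn2real (wmeas w D) > 0"
          using pos wmeas_ball_finite[OF wt, of c \<rho>] D by (simp add: enn2real_positive_iff)
        then show ?thesis using vol by simp
      qed
      from \<open>eavg D w / w x \<le> Ap_const 1 w\<close> have le: "ennreal (enn2real (wmeas w D) / measure lebesgue D) / w x \<le> Ap_const 1 w"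
        unfolding av .
      have wx: "w x > 0"
      proof (rule ccontr)
        assume "\<not> w x > 0"
        then have "w x = 0" by simp
        then have "ennreal (enn2real (wmeas w D) / measure lebesgue D) / w x = \<infinity>"
          using avpos by (simp add: ennreal_divide_zero) (metis divide_eq_0_iff less_irrefl)
        then show False using le W by simp
      qed
      obtain v where v: "w x = ennreal v" "v > 0"
        using wx fin by (metis enn2real_positive_iff ennreal_enn2real infinity_ennreal_def)
      obtain W' where W': "Ap_const 1 w = ennreal W'" "W' \<ge> 0"
        using W by (metis enn2real_nonneg ennreal_enn2real infinity_ennreal_def)
      have "enn2real (wmeas w D) / measure lebesgue D / v \<le> W'"
        using le avpos v W' by (simp add: divide_ennreal)
      then show "enn2real (wmeas w D) / measure lebesgue D \<le> enn2real (Ap_const 1 w) * enn2real (w x) \<and> w x > 0"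
        unfolding pos_divide_le_eq[OF v(2)] using v W' wx by simp
    qed
  qed
qed

text \<open>Since \<open>0 * \<infinity> = 0\<close>, the zero weight belongs to the class. Once
  \<open>w\<close> is positive on \<open>D\<close>, the product in the \<open>A_r\<close> condition
  carries information: the mean of \<open>\<sigma>\<close> must be finite, which forces
  \<open>w > 0\<close> almost everywhere in \<open>D\<close>, and it is positive because
  \<open>w\<close> is finite almost everywhere.\<close>

lemma Ap_ball_gt1:
  fixes w :: "'a::euclidean_space \<Rightarrow> ennreal"
  assumes w: "w \<in> Ap_class r" and r: "r > 1" and D: "D = ball c \<rho>" "\<rho> > 0" and pos: "wmeas w D > 0"
  defines "\<sigma> \<equiv> dual_weight r w"
  shows "wmeas \<sigma> D < \<infinity>" "wmeas \<sigma> D > 0" "AE x in lebesgue. x \<in> D \<longrightarrow> w x > 0"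
    "enn2real (wmeas \<sigma> D) powr (r - 1) \<le>
      enn2real (Ap_const r w) * measure lebesgue D powr r / enn2real (wmeas w D)"
    "Ap_const r w > 0"
proof -
  have wt: "weight w" and W: "Ap_const r w < \<infinity>" using w by (auto simp: Ap_class_def)
  have [measurable]: "w \<in> borel_measurable lebesgue" by (rule weight_measurable[OF wt])
  have \<sigma>m [measurable]: "\<sigma> \<in> borel_measurable lebesgue"
    unfolding \<sigma>_def dual_weight_def by measurable
  have Dm [measurable]: "D \<in> sets lebesgue" using D by simp
  have vol: "measure lebesgue D > 0"
    using D by (simp add: measure_lebesgue_ball_pos)
  have emD: "emeasure lebesgue D = ennreal (measure lebesgue D)"
    using D by (simp add: emeasure_lebesgue_ball)
  define wD where "wD = enn2real (wmeas w D)"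
  have wfin: "wmeas w D < \<infinity>" using wmeas_ball_finite[OF wt] D by simp
  then have wD: "wmeas w D = ennreal wD" "wD > 0"
    using pos by (simp_all add: wD_def enn2real_positive_iff)
  have avw: "eavg D w = ennreal (wD / measure lebesgue D)"
    unfolding eavg_def wmeas_def[symmetric] using vol wD by (simp add: emD divide_ennreal)
  have "eavg D w * epowr (eavg D \<sigma>) (r - 1) \<le> Ap_const r w"
    unfolding Ap_const_def \<sigma>_def dual_weight_def using r D
    by (auto intro!: SUP_upper2[of D] ball_in_balls)
  then have A: "ennreal (wD / measure lebesgue D) * epowr (eavg D \<sigma>) (r - 1) \<le> Ap_const r w"
    by (simp add: avw)
  have ep: "epowr (eavg D \<sigma>) (r - 1) \<noteq> \<infinity>"
  proof
    assume "epowr (eavg D \<sigma>) (r - 1) = \<infinity>"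
    then show False using A W wD vol by (simp add: ennreal_mult_top)
  qed
  then have avfin: "eavg D \<sigma> \<noteq> \<infinity>"
    using r by (auto simp: epowr_def)
  show \<sigma>fin: "wmeas \<sigma> D < \<infinity>"
  proof (rule ccontr)
    assume "\<not> wmeas \<sigma> D < \<infinity>"
    then have "eavg D \<sigma> = \<infinity>"
      unfolding eavg_def wmeas_def[symmetric] using emD by (simp add: not_less top_unique ennreal_top_divide)
    then show False using avfin by simp
  qed
  have "(\<integral>\<^sup>+x. \<sigma> x * indicator D x \<partial>lebesgue) \<noteq> \<infinity>"
    using \<sigma>fin by (simp add: wmeas_def)
  then have "AE x in lebesgue. \<sigma> x * indicator D x \<noteq> \<infinity>"
    by (intro nn_integral_noteq_infinite) measurable
  then show wpos: "AE x in lebesgue. x \<in> D \<longrightarrow> w x > 0"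
  proof eventually_elim
    fix x assume 1: "\<sigma> x * indicator D x \<noteq> \<infinity>"
    show "x \<in> D \<longrightarrow> w x > 0"
    proof
      assume "x \<in> D"
      then have "\<sigma> x \<noteq> \<infinity>" using 1 by simp
      then show "w x > 0"
        using r unfolding \<sigma>_def dual_weight_def epowr_def one_minus_conj_exp[of r, OF less_imp_neq[OF r, symmetric]]
        by (auto simp: zero_less_iff_neq_zero split: if_splits)
    qed
  qed
  show \<sigma>pos: "wmeas \<sigma> D > 0"
  proof (rule ccontr)
    assume "\<not> wmeas \<sigma> D > 0"
    then have "(\<integral>\<^sup>+x. \<sigma> x * indicator D x \<partial>lebesgue) = 0"
      by (simp add: wmeas_def)
    then have "AE x in lebesgue. \<sigma> x * indicator D x = 0"
      by (subst (asm) nn_integral_0_iff_AE) auto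
    then have "AE x in lebesgue. x \<notin> D"
      using AE_weight_finite[OF wt, of c \<rho>] wpos
    proof eventually_elim
      fix x assume "\<sigma> x * indicator D x = 0" "x \<in> ball c \<rho> \<longrightarrow> w x < \<infinity>" "x \<in> D \<longrightarrow> w x > 0"
      then show "x \<notin> D"
        using D r unfolding \<sigma>_def dual_weight_def epowr_def
        by (auto simp: one_minus_conj_exp enn2real_eq_0_iff split: if_splits)
    qed
    then have "D \<in> null_sets lebesgue"
      by (simp add: AE_iff_null_sets)
    then have "emeasure lebesgue D = 0" by (rule null_setsD1)
    then show False using emD vol by simp
  qed
  define sD where "sD = enn2real (wmeas \<sigma> D)"
  have sD: "wmeas \<sigma> D = ennreal sD" "sD > 0"
    using \<sigma>pos \<sigma>fin by (simp_all add: sD_def enn2real_positive_iff)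
  have avs: "eavg D \<sigma> = ennreal (sD / measure lebesgue D)"
    unfolding eavg_def wmeas_def[symmetric] using vol sD by (simp add: emD divide_ennreal)
  have B: "ennreal (wD / measure lebesgue D * (sD / measure lebesgue D) powr (r - 1)) \<le> Ap_const r w"
  proof -
    have "epowr (eavg D \<sigma>) (r - 1) = ennreal ((sD / measure lebesgue D) powr (r - 1))"
      unfolding avs using vol sD by (intro epowr_ennreal) simp
    with A show ?thesis
      using vol wD by (simp only:) (subst ennreal_mult, auto)
  qed
  then have "wD / measure lebesgue D * (sD / measure lebesgue D) powr (r - 1) \<le> enn2real (Ap_const r w)"
    using W by (metis enn2real_mono enn2real_ennreal infinity_ennreal_def mult_nonneg_nonneg divide_nonneg_nonneg
        powr_ge_zero vol wD(2) order_less_imp_le)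
  then have "wD * sD powr (r - 1) / measure lebesgue D powr r \<le> enn2real (Ap_const r w)"
    using vol sD by (simp add: powr_divide powr_diff field_simps)
  then show "enn2real (wmeas \<sigma> D) powr (r - 1) \<le>
      enn2real (Ap_const r w) * measure lebesgue D powr r / enn2real (wmeas w D)"
    unfolding sD_def[symmetric] wD_def[symmetric] using vol wD(2) by (simp add: field_simps)
  have "0 < ennreal (wD / measure lebesgue D * (sD / measure lebesgue D) powr (r - 1))"
    using vol sD wD by simp
  then show "Ap_const r w > 0"
    using B by (rule less_le_trans)
qed

text \<open>A weight of the class vanishes on no ball or on all of them: on a ball that contains the
  two given ones, positive total weight already forces \<open>w > 0\<close> almost
  everywhere.\<close>

lemma Ap_positive:
  fixes w :: "'a::euclidean_space \<Rightarrow> ennreal"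
  assumes w: "w \<in> Ap_class r" and r: "r \<ge> 1" and pos: "wmeas w (ball c \<rho>) > 0" and \<rho>': "\<rho>' > 0"
  shows "wmeas w (ball c' \<rho>') > 0"
proof -
  have [measurable]: "w \<in> borel_measurable lebesgue"
    using w by (auto simp: Ap_class_def weight_measurable)
  have [measurable]: "ball c' \<rho>' \<in> sets lebesgue" by simp
  define R where "R = max (dist c c' + \<rho>') \<rho>"
  have R: "R > 0" using \<rho>' by (simp add: R_def less_max_iff_disj add_nonneg_pos)
  have sub: "ball c \<rho> \<subseteq> ball c R" "ball c' \<rho>' \<subseteq> ball c R"
    by (auto simp: R_def less_max_iff_disj subset_ball) (smt (verit) dist_triangle)
  have "wmeas w (ball c R) > 0"
    using pos wmeas_mono[OF sub(1), of w] by (rule less_le_trans)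
  then have ae: "AE x in lebesgue. x \<in> ball c R \<longrightarrow> w x > 0"
    using Ap_ball_gt1(3)[OF w _ refl R] Ap_ball_r1[OF _ refl R, of w c] w r
    by (cases "r = 1") (auto elim!: eventually_mono)
  show ?thesis
  proof (rule ccontr)
    assume "\<not> ?thesis"
    then have "(\<integral>\<^sup>+x. w x * indicator (ball c' \<rho>') x \<partial>lebesgue) = 0"
      by (simp add: wmeas_def)
    then have "AE x in lebesgue. w x * indicator (ball c' \<rho>') x = 0"
      by (subst (asm) nn_integral_0_iff_AE) auto
    then have "AE x in lebesgue. x \<notin> ball c' \<rho>'"
      using ae by eventually_elim (use sub in \<open>auto simp: indicator_def split: if_splits\<close>)
    then have "ball c' \<rho>' \<in> null_sets lebesgue"
      by (simp add: AE_iff_null_sets)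
    then have "emeasure lebesgue (ball c' \<rho>') = 0" by (rule null_setsD1)
    then show False using \<rho>' measure_lebesgue_ball_pos[OF \<rho>', of c'] by (simp add: emeasure_lebesgue_ball)
  qed
qed

text \<open>
  With \<open>\<delta> = 1\<close> this is the usual consequence of the \<open>A\<^sub>r\<close> condition; a smaller \<open>\<delta>\<close> encodes that the
  dual weight of \<open>E\<close> is small in comparison with that of \<open>D\<close>.
\<close>

lemma Ap_average:
  fixes w :: "'a::euclidean_space \<Rightarrow> ennreal" and F :: "'a \<Rightarrow> ennreal"
  assumes w: "w \<in> Ap_class r" and r: "r \<ge> 1" and D: "D = ball c \<rho>" "\<rho> > 0" and pos: "wmeas w D > 0"
    and E: "E \<in> sets lebesgue" "E \<subseteq> D" and F: "F \<in> borel_measurable lebesgue"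
    and J: "J > 0" "(\<integral>\<^sup>+x\<in>E. epowr (F x) r * w x \<partial>lebesgue) \<le> ennreal J"
    and \<delta>: "\<delta> > 0" "r > 1 \<Longrightarrow> wmeas (dual_weight r w) E \<le> ennreal \<delta> * wmeas (dual_weight r w) D"
  shows "(\<integral>\<^sup>+x\<in>E. F x \<partial>lebesgue) \<le> ennreal (measure lebesgue D *
    (J * enn2real (Ap_const r w) / enn2real (wmeas w D)) powr (1 / r) * \<delta> powr ((r - 1) / r))"
proof -
  have wt: "weight w" and W: "Ap_const r w < \<infinity>" using w by (auto simp: Ap_class_def)
  have [measurable]: "w \<in> borel_measurable lebesgue" by (rule weight_measurable[OF wt])
  note [measurable] = E(1) F
  have vol: "measure lebesgue D > 0"
    using D by (simp add: measure_lebesgue_ball_pos)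
  define W' where "W' = enn2real (Ap_const r w)"
  define wD where "wD = enn2real (wmeas w D)"
  have wfin: "wmeas w D < \<infinity>" using wmeas_ball_finite[OF wt] D by simp
  then have wD: "wmeas w D = ennreal wD" "wD > 0"
    using pos by (simp_all add: wD_def enn2real_positive_iff)
  show ?thesis
  proof (cases "r = 1")
    case True
    have "AE x in lebesgue. F x * indicator E x \<le>
        ennreal (W' * measure lebesgue D / wD) * (epowr (F x) r * w x * indicator E x)"
      using Ap_ball_r1[OF w[unfolded True] D pos] AE_weight_finite[OF wt, of c \<rho>] unfolding True
    proof eventually_elim
      fix x
      assume 1: "x \<in> D \<longrightarrow> enn2real (wmeas w D) / measure lebesgue D \<le> enn2real (Ap_const 1 w) * enn2real (w x) \<and> w x > 0"
        and 2: "x \<in> ball c \<rho> \<longrightarrow> w x < \<infinity>"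
      show "F x * indicator E x \<le> ennreal (W' * measure lebesgue D / wD) * (epowr (F x) 1 * w x * indicator E x)"
      proof (cases "x \<in> E")
        case xE: True
        then have x: "x \<in> D" using E by blast
        obtain v where v: "w x = ennreal v" "v > 0"
          using 1 2 x D by (metis enn2real_positive_iff ennreal_enn2real infinity_ennreal_def)
        have "1 \<le> W' * measure lebesgue D / wD * v"
          using 1 x vol wD v by (simp add: W'_def wD_def[symmetric] True field_simps)
        then have "F x * 1 \<le> F x * ennreal (W' * measure lebesgue D / wD * v)"
          by (intro mult_left_mono) (auto simp: ennreal_1[symmetric] simp del: ennreal_1 intro: ennreal_leI)
        also have "\<dots> = ennreal (W' * measure lebesgue D / wD) * (F x * w x)"
          using v wD by (subst ennreal_mult) (auto simp: W'_def mult_ac)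
        finally show ?thesis using xE by (simp add: epowr_1)
      qed simp
    qed
    then have "(\<integral>\<^sup>+x\<in>E. F x \<partial>lebesgue) \<le> (\<integral>\<^sup>+x. ennreal (W' * measure lebesgue D / wD) * (epowr (F x) r * w x * indicator E x) \<partial>lebesgue)"
      by (rule nn_integral_mono_AE)
    also have "\<dots> = ennreal (W' * measure lebesgue D / wD) * (\<integral>\<^sup>+x\<in>E. epowr (F x) r * w x \<partial>lebesgue)"
      by (rule nn_integral_cmult) measurable
    also have "\<dots> \<le> ennreal (W' * measure lebesgue D / wD) * ennreal J"
      by (intro mult_left_mono J) simp
    also have "\<dots> = ennreal (measure lebesgue D * (J * W' / wD))"
      using J vol wD by (subst ennreal_mult[symmetric]) (auto simp: W'_def mult_ac)
    finally show ?thesis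
      unfolding W'_def[symmetric] wD_def[symmetric] using J wD(2) \<delta>(1) True by (simp add: W'_def)
  next
    case False
    then have r1: "r > 1" using r by simp
    define \<sigma> where "\<sigma> = dual_weight r w"
    note A = Ap_ball_gt1[OF w r1 D pos, folded \<sigma>_def]
    have [measurable]: "\<sigma> \<in> borel_measurable lebesgue"
      unfolding \<sigma>_def dual_weight_def by measurable
    define sD where "sD = enn2real (wmeas \<sigma> D)"
    have sD: "wmeas \<sigma> D = ennreal sD" "sD > 0"
      using A(1,2) by (simp_all add: sD_def enn2real_positive_iff)
    have S: "(\<integral>\<^sup>+x. \<sigma> x * indicator E x \<partial>lebesgue) \<le> ennreal (\<delta> * sD)"
      using \<delta>(2)[OF r1] \<delta>(1) sD by (simp add: \<sigma>_def[symmetric] wmeas_def[symmetric] ennreal_mult)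
    have "AE x in lebesgue. epowr (F x) r * w x * indicator E x \<noteq> \<infinity>"
      using J by (intro nn_integral_noteq_infinite) (auto simp: top_unique less_top[symmetric])
    then have "AE x in lebesgue. \<exists>u\<ge>0. \<exists>v\<ge>0. F x * indicator E x \<le> ennreal (u powr (1 / r) * v powr (1 - 1 / r)) \<and>
        ennreal u \<le> epowr (F x) r * w x * indicator E x \<and> ennreal v \<le> \<sigma> x * indicator E x"
      using A(3) AE_weight_finite[OF wt, of c \<rho>]
    proof eventually_elim
      fix x
      assume 0: "epowr (F x) r * w x * indicator E x \<noteq> \<infinity>"
        and 1: "x \<in> D \<longrightarrow> w x > 0" and 2: "x \<in> ball c \<rho> \<longrightarrow> w x < \<infinity>"
      show "\<exists>u\<ge>0. \<exists>v\<ge>0. F x * indicator E x \<le> ennreal (u powr (1 / r) * v powr (1 - 1 / r)) \<and>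
        ennreal u \<le> epowr (F x) r * w x * indicator E x \<and> ennreal v \<le> \<sigma> x * indicator E x"
      proof (cases "x \<in> E \<and> F x \<noteq> 0")
        case True
        then have x: "x \<in> D" using E by blast
        obtain v where v: "w x = ennreal v" "v > 0"
          using 1 2 x D by (metis enn2real_positive_iff ennreal_enn2real infinity_ennreal_def)
        have "F x \<noteq> \<infinity>"
        proof
          assume "F x = \<infinity>"
          then show False using 0 True r1 v by (simp add: epowr_def ennreal_top_mult)
        qed
        then obtain y where y0: "F x = ennreal y" "y \<ge> 0"
          by (cases "F x") auto
        with True have y: "F x = ennreal y" "y > 0"
          by (auto simp: less_le)
        have \<sigma>: "\<sigma> x = ennreal (v powr (- 1 / (r - 1)))"
          using v r1 by (simp add: \<sigma>_def dual_weight_def epowr_ennreal one_minus_conj_exp)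
        have F': "epowr (F x) r * w x = ennreal (y powr r * v)"
          using y v by (simp add: epowr_ennreal ennreal_mult)
        \<comment> \<open>This is \<open>F = (F^r w)^(1/r) * \<sigma>^(1 - 1/r)\<close>: the powers
          of \<open>w\<close> cancel, and the exponent of the dual weight is made for that.\<close>
        have "(y powr r * v) powr (1 / r) * (v powr (- 1 / (r - 1))) powr (1 - 1 / r) = y * (v powr (1 / r) * v powr ((- 1 / (r - 1)) * (1 - 1 / r)))"
          using y v r1 by (simp add: powr_mult powr_powr)
        also have "(- 1 / (r - 1)) * (1 - 1 / r) = - (1 / r)"
          using r1 by (simp add: field_simps)
        also have "y * (v powr (1 / r) * v powr (- (1 / r))) = y"
          using v by (simp add: powr_add[symmetric])
        finally have eq: "(y powr r * v) powr (1 / r) * (v powr (- 1 / (r - 1))) powr (1 - 1 / r) = y" .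
        show ?thesis
          by (rule exI[of _ "y powr r * v"], rule conjI, use v in simp,
              rule exI[of _ "v powr (- 1 / (r - 1))"])
             (use True \<sigma> F' eq y in simp)
      qed (auto intro!: exI[of _ 0])
    qed
    from nn_integral_Hoelder[OF _ _ _ J(1) _ _ _ J(2) S this]
    have "(\<integral>\<^sup>+x\<in>E. F x \<partial>lebesgue) \<le> ennreal (J powr (1 / r) * (\<delta> * sD) powr (1 - 1 / r))"
      using r1 \<delta> sD by simp
    also have "\<dots> \<le> ennreal (measure lebesgue D * (J * W' / wD) powr (1 / r) * \<delta> powr ((r - 1) / r))"
    proof (rule ennreal_leI)
      have "sD powr (1 - 1 / r) = (sD powr (r - 1)) powr (1 / r)"
        using r1 by (simp add: powr_powr field_simps)
      also have "\<dots> \<le> (W' * measure lebesgue D powr r / wD) powr (1 / r)"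
        using A(4) r1 unfolding sD_def W'_def wD_def by (intro powr_mono2) auto
      also have "\<dots> = measure lebesgue D * (W' / wD) powr (1 / r)"
        using vol r1 wD by (simp add: powr_mult powr_divide powr_powr W'_def)
      finally have "J powr (1 / r) * (\<delta> powr (1 - 1 / r) * sD powr (1 - 1 / r))
          \<le> J powr (1 / r) * (\<delta> powr (1 - 1 / r) * (measure lebesgue D * (W' / wD) powr (1 / r)))"
        by (intro mult_left_mono) auto
      also have "1 - 1 / r = (r - 1) / r" using r1 by (simp add: field_simps)
      finally show "J powr (1 / r) * (\<delta> * sD) powr (1 - 1 / r)
          \<le> measure lebesgue D * (J * W' / wD) powr (1 / r) * \<delta> powr ((r - 1) / r)"
        using J \<delta> sD wD \<open>1 - 1 / r = (r - 1) / r\<close> by (simp add: powr_mult powr_divide W'_def mult_ac)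
    qed
    finally show ?thesis unfolding W'_def wD_def .
  qed
qed

section \<open>Decay of \<open>A_\<infinity>\<close> weights along concentric balls\<close>

lemma ennreal_divide_leD:
  fixes a b c :: ennreal
  assumes "a / b \<le> c" "0 < b" "b < \<infinity>"
  shows "a \<le> c * b"
proof -
  obtain t where t: "b = ennreal t" "t > 0"
    using assms(2,3) by (metis enn2real_positive_iff ennreal_enn2real infinity_ennreal_def)
  show ?thesis
  proof (cases a)
    case (real a')
    show ?thesis
    proof (cases c)
      case (real c')
      then show ?thesis
        using assms(1) t \<open>a = ennreal a'\<close> \<open>0 \<le> a'\<close>
        by (simp add: divide_ennreal ennreal_mult[symmetric] pos_divide_le_eq)
    next
      case top
      then show ?thesis using t by (simp add: ennreal_top_mult)
    qed
  next
    case top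
    then have "c = top" using assms(1) t by (simp add: ennreal_top_divide top_unique)
    then show ?thesis using t by (simp add: ennreal_top_mult)
  qed
qed

text \<open>On the shell \<open>\<beta> j - \<beta> (j - 1)\<close> the maximal function is at least
  the mean of \<open>\<sigma>\<close> over \<open>\<beta> j\<close>, hence at least
  \<open>\<sigma>(\<beta> 0) / |\<beta> j|\<close>. In dimension at least \<open>2\<close> the shell
  keeps at least \<open>3 / 4\<close> of the volume of \<open>\<beta> j\<close>. So each of the
  \<open>J\<close> shells contributes \<open>3 / 4\<close> of \<open>\<sigma>(\<beta> 0)\<close> to
  the integral that the \<open>A_\<infinity>\<close> constant controls, and the innermost ball
  contributes all of it.\<close>

lemma Ainf_shells:
  fixes \<sigma> :: "'a::euclidean_space \<Rightarrow> ennreal"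
  assumes dim: "DIM('a) \<ge> 2" and \<rho>: "\<rho> > 0"
    and A: "Ainf_const \<sigma> < \<infinity>"
    and fin: "wmeas \<sigma> (ball x (2 ^ J * \<rho>)) < \<infinity>" and pos: "wmeas \<sigma> (ball x \<rho>) > 0"
  shows "enn2real (wmeas \<sigma> (ball x \<rho>)) * (1 + 3 / 4 * real J) \<le>
    enn2real (Ainf_const \<sigma>) * enn2real (wmeas \<sigma> (ball x (2 ^ J * \<rho>)))"
proof -
  define \<beta> where "\<beta> j = ball x (2 ^ j * \<rho>)" for j
  define vol where "vol j = measure lebesgue (\<beta> j)" for j
  define Sh where "Sh j = (if j = 0 then \<beta> 0 else \<beta> j - \<beta> (j - 1))" for j
  have mono: "\<beta> i \<subseteq> \<beta> j" if "i \<le> j" for i j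
    unfolding \<beta>_def using that \<rho> by (intro subset_ball mult_right_mono power_increasing) auto
  have vol: "vol j > 0" for j
    using \<rho> by (simp add: vol_def \<beta>_def measure_lebesgue_ball_pos)
  have volem: "emeasure lebesgue (\<beta> j) = ennreal (vol j)" for j
    unfolding vol_def \<beta>_def by (rule emeasure_lebesgue_ball)
  have [measurable]: "\<beta> j \<in> sets lebesgue" "Sh j \<in> sets lebesgue" for j
    by (auto simp: \<beta>_def Sh_def)
  define s0 where "s0 = enn2real (wmeas \<sigma> (\<beta> 0))"
  have wm: "wmeas \<sigma> (\<beta> 0) \<le> wmeas \<sigma> (\<beta> j)" for j
    by (intro wmeas_mono mono) simp
  have posJ: "wmeas \<sigma> (\<beta> J) > 0" using pos wm[of J] by (simp add: \<beta>_def)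
  have finJ: "wmeas \<sigma> (\<beta> J) < \<infinity>" using fin by (simp add: \<beta>_def)
  then have s0: "wmeas \<sigma> (\<beta> 0) = ennreal s0" "s0 > 0"
    using wm[of J] pos by (auto simp: s0_def \<beta>_def enn2real_positive_iff intro!: ennreal_enn2real[symmetric])
  let ?Mx = "\<lambda>y. maximal (\<lambda>z. \<sigma> z * indicator (\<beta> J) z) y"
  define h where "h y = (\<Sum>j\<le>J. ennreal (s0 / vol j) * indicator (Sh j) y)" for y
  have h_le: "h y \<le> ?Mx y * indicator (\<beta> J) y" for y
  proof (cases "\<exists>j\<le>J. y \<in> Sh j")
    case False
    then have "h y = 0" unfolding h_def by (intro sum.neutral) auto
    then show ?thesis by simp
  next
    case True
    then obtain j where j: "j \<le> J" "y \<in> Sh j" by blast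
    have yj: "y \<in> \<beta> j" using j by (auto simp: Sh_def split: if_splits)
    have "y \<notin> Sh i" if "i \<noteq> j" for i
    proof (cases "i < j")
      case True
      then have "\<beta> i \<subseteq> \<beta> (j - 1)" by (intro mono) simp
      moreover have "Sh i \<subseteq> \<beta> i" by (auto simp: Sh_def)
      ultimately have "Sh i \<subseteq> \<beta> (j - 1)" by blast
      then show ?thesis using j True by (auto simp: Sh_def)
    next
      case False
      then have "\<beta> j \<subseteq> \<beta> (i - 1)" "i \<noteq> 0" using that mono[of j "i - 1"] by auto
      then show ?thesis using yj by (auto simp: Sh_def)
    qed
    then have "h y = (\<Sum>i\<in>{j}. ennreal (s0 / vol i) * indicator (Sh i) y)"
      unfolding h_def using j by (intro sum.mono_neutral_right) (auto simp: indicator_def)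
    also have "\<dots> = ennreal (s0 / vol j)" using j by simp
    also have "\<dots> = wmeas \<sigma> (\<beta> 0) / emeasure lebesgue (\<beta> j)"
      using s0 vol[of j] by (simp add: volem divide_ennreal)
    also have "\<dots> \<le> eavg (\<beta> j) (\<lambda>z. \<sigma> z * indicator (\<beta> J) z) * indicator (\<beta> j) y"
    proof -
      have "wmeas \<sigma> (\<beta> 0) \<le> (\<integral>\<^sup>+z\<in>\<beta> j. (\<sigma> z * indicator (\<beta> J) z) \<partial>lebesgue)"
        unfolding wmeas_def using mono[of 0 J] mono[of 0 j]
        by (intro nn_integral_mono) (auto simp: indicator_def)
      then show ?thesis
        unfolding eavg_def using yj by (simp add: divide_right_mono_ennreal)
    qed
    also have "\<dots> \<le> ?Mx y"
      unfolding maximal_def by (rule SUP_upper) (use \<rho> in \<open>auto simp: \<beta>_def intro!: ball_in_balls\<close>)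
    finally show ?thesis using yj mono[OF j(1)] by auto
  qed
  have "ennreal (s0 * (1 + 3 / 4 * real J)) \<le> (\<Sum>j\<le>J. ennreal (s0 / vol j) * emeasure lebesgue (Sh j))"
  proof -
    have em: "ennreal (s0 / vol j) * emeasure lebesgue (Sh j) \<ge> ennreal (if j = 0 then s0 else s0 * (3 / 4))" for j
    proof (cases "j = 0")
      case True
      then show ?thesis
        using s0 vol[of 0] by (simp add: Sh_def volem ennreal_mult[symmetric])
    next
      case False
      have "2 * (2 ^ (j - 1) * \<rho>) = 2 ^ j * \<rho>"
        using False by (cases j) auto
      then have "vol j = 2 ^ DIM('a) * vol (j - 1)"
      proof -
        have "vol i = unit_ball_vol DIM('a) * (2 ^ i * \<rho>) ^ DIM('a)" for i
          unfolding vol_def \<beta>_def using \<rho> by (intro measure_lebesgue_ball) auto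
        then show ?thesis
          by (simp only: \<open>2 * (2 ^ (j - 1) * \<rho>) = 2 ^ j * \<rho>\<close>[symmetric] power_mult_distrib[of 2] mult.left_commute)
      qed
      moreover have "(2 :: real) ^ DIM('a) \<ge> 2 ^ 2"
        using dim by (intro power_increasing) auto
      ultimately have v: "vol (j - 1) \<le> vol j / 4"
        using vol[of "j - 1"] by (simp add: mult_right_mono)
      have "emeasure lebesgue (Sh j) = emeasure lebesgue (\<beta> j) - emeasure lebesgue (\<beta> (j - 1))"
      proof -
        have eq: "Sh j = \<beta> j - \<beta> (j - 1)" using False by (simp add: Sh_def)
        have "emeasure lebesgue (\<beta> (j - 1)) \<noteq> \<infinity>" unfolding volem by simp
        then show ?thesis
          unfolding eq by (rule emeasure_Diff) (auto intro!: mono)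
      qed
      also have "\<dots> = ennreal (vol j - vol (j - 1))"
        using vol[of "j - 1"] by (simp add: volem ennreal_minus)
      finally have "ennreal (s0 / vol j) * emeasure lebesgue (Sh j) = ennreal (s0 / vol j * (vol j - vol (j - 1)))"
        using s0 vol[of j] v by (subst ennreal_mult) auto
      moreover have "s0 / vol j * (vol j - vol (j - 1)) \<ge> s0 / vol j * (vol j * (3 / 4))"
        using s0 vol[of j] v by (intro mult_left_mono) auto
      ultimately show ?thesis
        using False vol[of j] by (auto intro!: ennreal_leI)
    qed
    have "s0 * (1 + 3 / 4 * real J) = (\<Sum>j\<le>J. if j = 0 then s0 else s0 * (3 / 4))"
    proof (induction J)
      case (Suc J)
      have eq: "s0 * (1 + 3 / 4 * real (Suc J)) = s0 * (1 + 3 / 4 * real J) + s0 * (3 / 4)"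
        by (simp add: field_simps)
      show ?case unfolding eq Suc sum.atMost_Suc by simp
    qed simp
    also have "ennreal \<dots> = (\<Sum>j\<le>J. ennreal (if j = 0 then s0 else s0 * (3 / 4)))"
      using s0(2) by (intro sum_ennreal[symmetric]) auto
    also have "\<dots> \<le> (\<Sum>j\<le>J. ennreal (s0 / vol j) * emeasure lebesgue (Sh j))"
      by (intro sum_mono em)
    finally show ?thesis .
  qed
  also have "\<dots> = (\<integral>\<^sup>+y. h y \<partial>lebesgue)"
  proof -
    have "(\<integral>\<^sup>+y. h y \<partial>lebesgue) = (\<Sum>j\<le>J. \<integral>\<^sup>+y. ennreal (s0 / vol j) * indicator (Sh j) y \<partial>lebesgue)"
      unfolding h_def by (rule nn_integral_sum) measurable
    also have "\<dots> = (\<Sum>j\<le>J. ennreal (s0 / vol j) * emeasure lebesgue (Sh j))"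
      by (intro sum.cong refl nn_integral_cmult_indicator) measurable
    finally show ?thesis by (rule sym)
  qed
  also have "\<dots> \<le> (\<integral>\<^sup>+y\<in>\<beta> J. ?Mx y \<partial>lebesgue)"
    by (intro nn_integral_mono h_le)
  also have "\<dots> \<le> Ainf_const \<sigma> * wmeas \<sigma> (\<beta> J)"
  proof (rule ennreal_divide_leD[OF _ posJ finJ])
    show "(\<integral>\<^sup>+y\<in>\<beta> J. ?Mx y \<partial>lebesgue) / wmeas \<sigma> (\<beta> J) \<le> Ainf_const \<sigma>"
      unfolding Ainf_const_def using \<rho>
      by (intro SUP_upper2[of "\<beta> J"]) (auto simp: \<beta>_def intro!: ball_in_balls)
  qed
  also have "\<dots> = ennreal (enn2real (Ainf_const \<sigma>) * enn2real (wmeas \<sigma> (\<beta> J)))"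
    using A finJ by (simp add: ennreal_mult)
  finally show ?thesis
    by (simp add: s0_def \<beta>_def)
qed

text \<open>With about \<open>4 [\<sigma>]\<close> shells the previous estimate gives the factor
  \<open>1 / 2\<close> for \<open>J\<close> halvings of the radius. Iteration yields the rate
  \<open>2^(-k / J)\<close>, and the factor \<open>2\<close> pays for an incomplete last block.
  Finally \<open>n J \<le> 4 n [\<sigma>] \<le> 2^(n+1) [\<sigma>] = T\<close> because
  \<open>2 n \<le> 2^n\<close>; this is how the constant \<open>2^(n+1)\<close> in the exponent
  \<open>q_r\<close> arises.\<close>

lemma Ainf_decay:
  fixes \<sigma> :: "'a::euclidean_space \<Rightarrow> ennreal"
  assumes dim: "DIM('a) \<ge> 2" and R: "R > 0" and A: "Ainf_const \<sigma> < \<infinity>"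
    and fin: "wmeas \<sigma> (ball x R) < \<infinity>" and pos: "\<And>\<rho>. \<rho> > 0 \<Longrightarrow> wmeas \<sigma> (ball x \<rho>) > 0"
  defines "T \<equiv> 2 ^ (DIM('a) + 1) * enn2real (Ainf_const \<sigma>)"
  shows "enn2real (Ainf_const \<sigma>) \<ge> 1"
    "wmeas \<sigma> (ball x (R / 2 ^ k)) \<le> ennreal (2 * 2 powr (- (real k * DIM('a) / T))) * wmeas \<sigma> (ball x R)"
proof -
  define a where "a = enn2real (Ainf_const \<sigma>)"
  define s where "s k = enn2real (wmeas \<sigma> (ball x (R / 2 ^ k)))" for k :: nat
  have sub: "wmeas \<sigma> (ball x (R / 2 ^ k)) \<le> wmeas \<sigma> (ball x R)" for k :: nat
  proof (intro wmeas_mono subset_ball)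
    show "R / 2 ^ k \<le> R" using R by (simp add: divide_le_eq)
  qed
  have fin': "wmeas \<sigma> (ball x (R / 2 ^ k)) < \<infinity>" for k
    using sub[of k] fin by simp
  have s: "wmeas \<sigma> (ball x (R / 2 ^ k)) = ennreal (s k)" "s k > 0" for k
    using fin'[of k] pos[of "R / 2 ^ k"] R by (auto simp: s_def enn2real_positive_iff)
  have s0: "s k \<le> s 0" for k
    using sub[of k] s(1)[of k] s(1)[of 0] s(2)[of 0] by simp
  have shell: "s k * (1 + 3 / 4 * real J) \<le> a * s (k - J)" if "J \<le> k" for k J
  proof -
    have e: "2 ^ J * (R / 2 ^ k) = R / 2 ^ (k - J)"
      using that by (simp add: power_diff)
    show ?thesis
      using Ainf_shells[OF dim _ A, of "R / 2 ^ k" x J] R fin'[of "k - J"] pos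
      unfolding e s_def a_def by simp
  qed
  \<comment> \<open>The case without shells already shows that the \<open>A_\<infinity>\<close>
    constant is at least \<open>1\<close>.\<close>
  have "s 0 * 1 \<le> s 0 * a" using shell[of 0 0] by (simp add: mult.commute)
  then have a1: "a \<ge> 1" using s(2)[of 0] by simp
  then show "enn2real (Ainf_const \<sigma>) \<ge> 1" by (simp add: a_def)
  define J where "J = nat \<lfloor>4 * a\<rfloor>"
  have J: "real J \<le> 4 * a" "real J \<ge> 4 * a - 1" "J \<ge> 1"
    using a1 by (auto simp: J_def le_nat_floor)
  have half: "s k \<le> s (k - J) / 2" if "J \<le> k" for k
  proof -
    \<comment> \<open>From \<open>J \<ge> 4 a - 1\<close> one gets
      \<open>1 + 3 / 4 * J \<ge> 3 a + 1 / 4\<close>, with room to spare over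
      \<open>2 a\<close>.\<close>
    have "s k * (2 * a) \<le> s k * (1 + 3 / 4 * real J)"
      using J a1 s(2)[of k] by (intro mult_left_mono) auto
    also have "\<dots> \<le> a * s (k - J)" by (rule shell[OF that])
    finally have "a * (2 * s k) \<le> a * s (k - J)" by (simp add: mult_ac)
    then show ?thesis using a1 by simp
  qed
  have dec: "s k \<le> 2 * 2 powr (- (real k / J)) * s 0" for k
  proof (induction k rule: less_induct)
    case (less k)
    show ?case
    proof (cases "J \<le> k")
      case False
      have "2 * 2 powr (- (real k / J)) = 2 powr (1 - real k / J)"
        by (simp add: powr_diff powr_minus_divide)
      also have "\<dots> \<ge> 2 powr 0"
        using False J by (intro powr_mono) (auto simp: divide_le_eq)
      finally have "1 * s 0 \<le> 2 * 2 powr (- (real k / J)) * s 0"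
        using s(2)[of 0] by (intro mult_right_mono) auto
      then show ?thesis using s0[of k] by simp
    next
      case True
      have "s k \<le> s (k - J) / 2" by (rule half[OF True])
      also have "\<dots> \<le> (2 * 2 powr (- (real (k - J) / J)) * s 0) / 2"
        using less[of "k - J"] True J by (intro divide_right_mono) auto
      also have "2 powr (- (real (k - J) / J)) = 2 * 2 powr (- (real k / J))"
      proof -
        have "- (real (k - J) / J) = 1 + - (real k / J)"
          using True J by (simp add: of_nat_diff diff_divide_distrib)
        then show ?thesis by (simp only: powr_add) simp
      qed
      finally show ?thesis by (simp add: mult_ac)
    qed
  qed
  have "real DIM('a) / T \<le> 1 / J"
  proof -
    have "2 * d \<le> 2 ^ d" if "d \<ge> 2" for d :: nat
      using that by (induction d rule: dec_induct) auto
    from this[OF dim] have "2 * real DIM('a) \<le> 2 ^ DIM('a)"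
      by (metis of_nat_le_iff of_nat_mult of_nat_numeral of_nat_power)
    then have "real DIM('a) * real J \<le> 2 ^ DIM('a) / 2 * (4 * a)"
      using J a1 by (intro mult_mono) auto
    then have "real DIM('a) * real J \<le> T"
      by (simp add: T_def a_def mult_ac)
    moreover have "T > 0" using a1 by (simp add: T_def a_def)
    ultimately show ?thesis
      using J by (simp add: field_simps)
  qed
  then have "real k * (real DIM('a) / T) \<le> real k * (1 / J)"
    by (rule mult_left_mono) simp
  then have "2 * 2 powr (- (real k / J)) * s 0 \<le> 2 * 2 powr (- (real k * DIM('a) / T)) * s 0"
    using s(2)[of 0] by (intro mult_right_mono mult_left_mono powr_mono) auto
  then have "s k \<le> 2 * 2 powr (- (real k * DIM('a) / T)) * s 0"
    using dec[of k] by linarith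
  then have "ennreal (s k) \<le> ennreal (2 * 2 powr (- (real k * DIM('a) / T))) * ennreal (s 0)"
    by (subst ennreal_mult[symmetric]) (use s(2)[of 0] in \<open>auto intro!: ennreal_leI\<close>)
  then show "wmeas \<sigma> (ball x (R / 2 ^ k)) \<le> ennreal (2 * 2 powr (- (real k * DIM('a) / T))) * wmeas \<sigma> (ball x R)"
    using s(1)[of k] s(1)[of 0] by simp
qed

text \<open>
  Because the weight is measured on the enlarged balls, the Vitali covering lemma gives a weak type
  estimate whose constant does not involve the doubling constant of the weight.
\<close>

lemma Vitali_weighted:
  fixes w H :: "'a::euclidean_space \<Rightarrow> ennreal"
  assumes wm: "w \<in> borel_measurable lebesgue" and Hm: "H \<in> borel_measurable lebesgue"
    and J: "(\<integral>\<^sup>+x. H x \<partial>lebesgue) \<le> J"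
    and S: "\<And>x. x \<in> S \<Longrightarrow> 0 < \<rho> x \<and> \<rho> x \<le> B \<and> \<theta> * wmeas w (ball x (5 * \<rho> x)) \<le> (\<integral>\<^sup>+y\<in>ball x (\<rho> x). H y \<partial>lebesgue)"
  obtains V where "V \<in> sets lebesgue" "S \<subseteq> V" "\<theta> * wmeas w V \<le> J"
proof -
  note [measurable] = wm Hm
  have [measurable]: "ball i s \<in> sets lebesgue" for i :: 'a and s by simp
  have "S \<subseteq> (\<Union>i\<in>S. ball i (\<rho> i))" "\<And>i. i \<in> S \<Longrightarrow> 0 < \<rho> i \<and> \<rho> i \<le> B" using S by auto
  then obtain C where C: "countable C" "C \<subseteq> S"
    "pairwise (\<lambda>i j. disjnt (ball i (\<rho> i)) (ball j (\<rho> j))) C"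
    "S \<subseteq> (\<Union>i\<in>C. ball i (5 * \<rho> i))"
    by (rule Vitali_covering_lemma_balls[where a = "\<lambda>x. x" and r = \<rho> and K = S]) blast
  \<comment> \<open>The set \<open>S\<close> may fail to be measurable; the open set
    \<open>V\<close> stands in for it in the conclusion.\<close>
  define V where "V = (\<Union>i\<in>C. ball i (5 * \<rho> i))"
  have Vs: "V \<in> sets lebesgue"
  proof -
    have "open V" unfolding V_def by (intro open_UN) auto
    then show ?thesis by simp
  qed
  have wmeas_eq: "wmeas w E = emeasure (density lebesgue w) E" if "E \<in> sets lebesgue" for E
    using that by (simp add: wmeas_def emeasure_density)
  have finite_part: "\<theta> * wmeas w (\<Union>i\<in>C'. ball i (5 * \<rho> i)) \<le> J" if C': "finite C'" "C' \<subseteq> C" for C'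
  proof -
    have "wmeas w (\<Union>i\<in>C'. ball i (5 * \<rho> i)) \<le> (\<Sum>i\<in>C'. wmeas w (ball i (5 * \<rho> i)))"
    proof -
      have "(\<lambda>i. ball i (5 * \<rho> i)) ` C' \<subseteq> sets (density lebesgue w)"
        by (simp add: image_subset_iff)
      from emeasure_subadditive_finite[OF C'(1) this] show ?thesis
        by (simp add: wmeas_eq open_UN)
    qed
    then have "\<theta> * wmeas w (\<Union>i\<in>C'. ball i (5 * \<rho> i)) \<le> (\<Sum>i\<in>C'. \<theta> * wmeas w (ball i (5 * \<rho> i)))"
      unfolding sum_distrib_left[symmetric] by (rule mult_left_mono) simp
    also have "\<dots> \<le> (\<Sum>i\<in>C'. \<integral>\<^sup>+y\<in>ball i (\<rho> i). H y \<partial>lebesgue)"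
      using S C C' by (intro sum_mono) auto
    also have "\<dots> = (\<integral>\<^sup>+y. (\<Sum>i\<in>C'. H y * indicator (ball i (\<rho> i)) y) \<partial>lebesgue)"
      by (rule nn_integral_sum[symmetric]) measurable
    also have "\<dots> \<le> (\<integral>\<^sup>+y. H y \<partial>lebesgue)"
    proof (rule nn_integral_mono)
      fix y
      show "(\<Sum>i\<in>C'. H y * indicator (ball i (\<rho> i)) y) \<le> H y"
      proof (cases "\<exists>i\<in>C'. y \<in> ball i (\<rho> i)")
        case True
        then obtain i where i: "i \<in> C'" "y \<in> ball i (\<rho> i)" by blast
        have "y \<notin> ball j (\<rho> j)" if "j \<in> C'" "j \<noteq> i" for j
          using C(3) i that C' unfolding pairwise_def disjnt_def by blast
        then have "(\<Sum>j\<in>C'. H y * indicator (ball j (\<rho> j)) y) = (\<Sum>j\<in>{i}. H y * indicator (ball j (\<rho> j)) y)"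
          using i C' by (intro sum.mono_neutral_right) (auto simp: indicator_def)
        also have "\<dots> = H y * indicator (ball i (\<rho> i)) y"
          by (subst sum.insert) auto
        finally show ?thesis using i by simp
      next
        case False
        then have "(\<Sum>i\<in>C'. H y * indicator (ball i (\<rho> i)) y) = 0"
          by (intro sum.neutral) auto
        then show ?thesis by simp
      qed
    qed
    finally show ?thesis using J by simp
  qed
  have "\<theta> * wmeas w V \<le> J"
  proof (cases "C = {}")
    case True
    then show ?thesis by (simp add: V_def wmeas_def)
  next
    case False
    \<comment> \<open>Initial segments of an enumeration of \<open>C\<close>, with repetitions if
      \<open>C\<close> is finite, exhaust \<open>V\<close>; the bound for finite subfamilies passes
      to the supremum.\<close>
    define F where "F k = (\<Union>i\<in>from_nat_into C ` {..<k}. ball i (5 * \<rho> i))" for k :: nat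
    have sub: "from_nat_into C ` {..<k} \<subseteq> C" for k
      using from_nat_into[OF False] by auto
    have Fs: "F k \<in> sets lebesgue" for k
    proof -
      have "open (F k)" unfolding F_def by (intro open_UN) auto
      then show ?thesis by simp
    qed
    have "V = (\<Union>k. F k)"
    proof
      show "V \<subseteq> (\<Union>k. F k)"
      proof
        fix y assume "y \<in> V"
        then obtain i where i: "i \<in> C" "y \<in> ball i (5 * \<rho> i)" by (auto simp: V_def)
        then obtain k where "from_nat_into C k = i"
          using from_nat_into_surj[OF C(1)] by blast
        then have "y \<in> F (Suc k)" using i by (auto simp: F_def)
        then show "y \<in> (\<Union>k. F k)" by blast
      qed
      show "(\<Union>k. F k) \<subseteq> V"
        using sub by (fastforce simp: F_def V_def)
    qed
    moreover have "incseq F"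
      unfolding F_def incseq_def by (intro allI impI UN_mono image_mono) auto
    ultimately have "wmeas w V = (SUP k. wmeas w (F k))"
      using SUP_emeasure_incseq[of F "density lebesgue w"] Fs Vs by (simp add: wmeas_eq image_subset_iff)
    then have "\<theta> * wmeas w V = (SUP k. \<theta> * wmeas w (F k))"
      by (simp add: SUP_mult_left_ennreal)
    also have "\<dots> \<le> J"
      unfolding F_def by (intro SUP_least finite_part sub) auto
    finally show ?thesis .
  qed
  with that[OF Vs _ this] C(4) show ?thesis by (simp add: V_def)
qed

section \<open>Summing the smaller of two bounds over dyadic scales\<close>

lemma sum_geometric_le:
  fixes q :: real
  assumes "0 \<le> q" "q < 1"
  shows "(\<Sum>k<n. q ^ k) \<le> 1 / (1 - q)"
  using assms by (simp add: sum_gp_strict divide_right_mono)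

text \<open>The two bounds cross at the real index \<open>y\<close> with
  \<open>A = B * 2 powr (y * \<nu>)\<close>, where both are of the size of the right-hand side.
  Above \<open>y\<close> the bound decays with ratio \<open>2 powr (- \<mu>) \<le> 1 / 2\<close>,
  below \<open>y\<close> with ratio \<open>2 powr (- (\<nu> - \<mu>))\<close>. The two geometric
  series contribute \<open>2\<close> and \<open>1 + 2 / (\<nu> - \<mu>)\<close>.\<close>

lemma dyadic_min_sum:
  fixes \<mu> \<nu> A B :: real
  assumes AB: "A > 0" "B > 0" and \<mu>: "\<mu> \<ge> 1" "\<mu> < \<nu>"
    and a: "\<And>k. a k \<le> 2 powr (- (real k * \<mu>)) * min A (B * 2 powr (real k * \<nu>))"
  shows "(\<Sum>k<M. a k) \<le> (3 + 2 / (\<nu> - \<mu>)) * (A powr (1 - \<mu> / \<nu>) * B powr (\<mu> / \<nu>))"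
proof -
  define e where "e = \<nu> - \<mu>"
  have e: "e > 0" using \<mu> by (simp add: e_def)
  define y where "y = log 2 (A / B) / \<nu>"
  have Ay: "A = B * 2 powr (y * \<nu>)"
    using AB \<mu> by (simp add: y_def)
  define G where "G = A powr (1 - \<mu> / \<nu>) * B powr (\<mu> / \<nu>)"
  have G: "G = B * 2 powr (y * e)"
  proof -
    have "G = B powr (1 - \<mu> / \<nu>) * B powr (\<mu> / \<nu>) * (2 powr (y * \<nu>)) powr (1 - \<mu> / \<nu>)"
      unfolding G_def Ay using AB by (simp add: powr_mult)
    also have "B powr (1 - \<mu> / \<nu>) * B powr (\<mu> / \<nu>) = B"
      using AB by (simp add: powr_add[symmetric])
    also have "(2 powr (y * \<nu>)) powr (1 - \<mu> / \<nu>) = 2 powr (y * e)"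
    proof -
      have "y * \<nu> * (1 - \<mu> / \<nu>) = y * (\<nu> * (1 - \<mu> / \<nu>))" by simp
      also have "\<nu> * (1 - \<mu> / \<nu>) = e" using \<mu> by (simp add: e_def right_diff_distrib)
      finally show ?thesis by (simp only: powr_powr)
    qed
    finally show ?thesis .
  qed
  \<comment> \<open>If the crossing lies before the first scale, \<open>nat\<close> gives
    \<open>K = 0\<close> and the lower range is empty.\<close>
  define K where "K = nat \<lceil>y\<rceil>"
  define g1 where "g1 = (2 :: real) powr (- \<mu>)"
  define g2 where "g2 = (2 :: real) powr (- e)"
  have g1: "0 \<le> g1" "g1 \<le> 1 / 2"
  proof -
    have "g1 \<le> 2 powr (- 1)" unfolding g1_def using \<mu> by (intro powr_mono) auto
    then show "g1 \<le> 1 / 2" by (simp add: powr_minus_divide)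
  qed (simp add: g1_def)
  \<comment> \<open>As \<open>ln 2 \<ge> 1 / 2\<close>, the ratio is at most
    \<open>1 / (1 + e / 2)\<close>. This turns \<open>1 / (1 - g2)\<close> into the linear
    expression \<open>1 + 2 / e\<close>, uniformly for all \<open>e > 0\<close>.\<close>
  have g2: "0 \<le> g2" "g2 \<le> 1 / (1 + e / 2)"
  proof -
    have ln2: "ln 2 \<ge> (1 / 2 :: real)"
      using ln_add_one_self_le_self2 ln_one_minus_pos_upper_bound[of "1/2 :: real"] by (simp add: ln_div)
    have "1 + e / 2 \<le> 1 + e * ln 2" using e ln2 by (simp add: mult_left_mono)
    also have "\<dots> \<le> exp (e * ln 2)" by (rule exp_ge_add_one_self)
    also have "\<dots> = 2 powr e" by (simp add: powr_def)
    finally have "1 / 2 powr e \<le> 1 / (1 + e / 2)" using e by (intro divide_left_mono) auto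
    then show "g2 \<le> 1 / (1 + e / 2)" by (simp add: g2_def powr_minus_divide)
  qed (simp add: g2_def)
  have hi: "a k \<le> G * g1 ^ (k - K)" if "k \<ge> K" for k
  proof -
    have ky: "real K \<ge> y" by (simp add: K_def) linarith
    have "a k \<le> 2 powr (- (real k * \<mu>)) * A"
      using a[of k] by (rule order.trans) (intro mult_left_mono, auto)
    also have "\<dots> = B * 2 powr (y * e) * 2 powr ((y - real k) * \<mu>)"
      unfolding Ay by (simp add: powr_add[symmetric] e_def algebra_simps)
    also have "\<dots> \<le> B * 2 powr (y * e) * 2 powr (real (k - K) * (- \<mu>))"
    proof (intro mult_left_mono powr_mono)
      have "(y - real k) * \<mu> \<le> (real K - real k) * \<mu>" using ky \<mu> by (intro mult_right_mono) auto
      then show "(y - real k) * \<mu> \<le> real (k - K) * - \<mu>" using that by (simp add: of_nat_diff algebra_simps)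
    qed (use AB in auto)
    also have "2 powr (real (k - K) * (- \<mu>)) = g1 ^ (k - K)"
      by (simp add: g1_def powr_realpow[symmetric] powr_powr mult.commute)
    finally show ?thesis by (simp add: G)
  qed
  have lo: "a k \<le> G * g2 ^ (K - 1 - k)" if "k < K" for k
  proof -
    have "real_of_int \<lceil>y\<rceil> \<le> y + 1" by linarith
    moreover have "\<lceil>y\<rceil> > 0" using that unfolding K_def by linarith
    ultimately have ky: "real K \<le> y + 1" by (simp add: K_def)
    have "a k \<le> 2 powr (- (real k * \<mu>)) * (B * 2 powr (real k * \<nu>))"
      using a[of k] by (rule order.trans) (intro mult_left_mono, auto)
    also have "\<dots> = B * 2 powr (y * e) * 2 powr ((real k - y) * e)"
      by (simp add: powr_add[symmetric] e_def algebra_simps)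
    also have "\<dots> \<le> B * 2 powr (y * e) * 2 powr (real (K - 1 - k) * (- e))"
    proof (intro mult_left_mono powr_mono)
      have "(real k - y) * e \<le> (real k - (real K - 1)) * e" using ky e by (intro mult_right_mono) auto
      then show "(real k - y) * e \<le> real (K - 1 - k) * - e" using that by (simp add: of_nat_diff algebra_simps)
    qed (use AB in auto)
    also have "2 powr (real (K - 1 - k) * (- e)) = g2 ^ (K - 1 - k)"
      by (simp add: g2_def powr_realpow[symmetric] powr_powr mult.commute)
    finally show ?thesis by (simp add: G)
  qed
  have G0: "G \<ge> 0" using AB by (simp add: G_def)
  define b where "b k = (if k < K then G * g2 ^ (K - 1 - k) else G * g1 ^ (k - K))" for k
  have "(\<Sum>k<M. a k) \<le> (\<Sum>k<M. b k)"
    using hi lo by (intro sum_mono) (auto simp: b_def)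
  also have "\<dots> \<le> (\<Sum>k<K + M. b k)"
    using G0 g1 g2 by (intro sum_mono2) (auto simp: b_def)
  also have "\<dots> = (\<Sum>k<K. b k) + (\<Sum>k<M. b (K + k))"
    by (induction M) (simp_all add: add.assoc)
  also have "(\<Sum>k<K. b k) = G * (\<Sum>k<K. g2 ^ k)"
  proof -
    have "(\<Sum>k<K. b k) = (\<Sum>k<K. G * g2 ^ (K - 1 - k))" by (simp add: b_def)
    also have "\<dots> = (\<Sum>k<K. G * g2 ^ k)"
      by (rule sum.reindex_bij_witness[where i = "\<lambda>k. K - 1 - k" and j = "\<lambda>k. K - 1 - k"]) auto
    finally show ?thesis by (simp add: sum_distrib_left)
  qed
  also have "(\<Sum>k<M. b (K + k)) = G * (\<Sum>k<M. g1 ^ k)"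
    by (simp add: b_def sum_distrib_left)
  also have "G * (\<Sum>k<K. g2 ^ k) + G * (\<Sum>k<M. g1 ^ k) \<le> G * (1 + 2 / e) + G * 2"
  proof (intro add_mono mult_left_mono G0)
    have e2: "1 / (1 + e / 2) < 1" using e by simp
    then have g3: "g2 < 1" using g2 by linarith
    then have "(\<Sum>k<K. g2 ^ k) \<le> 1 / (1 - g2)" using g2(1) by (intro sum_geometric_le)
    also have "\<dots> \<le> 1 / (1 - 1 / (1 + e / 2))" using g2 e2 g3 by (intro divide_left_mono mult_pos_pos) linarith+
    also have "\<dots> = 1 + 2 / e" using e by (simp add: field_simps)
    finally show "(\<Sum>k<K. g2 ^ k) \<le> 1 + 2 / e" .
    have "(\<Sum>k<M. g1 ^ k) \<le> 1 / (1 - g1)" using g1 by (intro sum_geometric_le) auto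
    also have "\<dots> \<le> 1 / (1 - 1 / 2)" using g1 by (intro divide_left_mono) auto
    finally show "(\<Sum>k<M. g1 ^ k) \<le> 2" by simp
  qed
  also have "G * (1 + 2 / e) + G * 2 = (3 + 2 / e) * G"
    by (simp add: algebra_simps)
  finally show ?thesis
    unfolding G_def e_def .
qed

section \<open>The weighted weak type estimate for the potential\<close>

lemma epowr_epowr:
  assumes "a > 0" "b > 0"
  shows "epowr (epowr x a) b = epowr x (a * b)"
proof (cases x)
  case (real y)
  then show ?thesis
    using assms by (cases "y = 0") (auto simp: epowr_def powr_powr mult_less_0_iff)
next
  case top
  then show ?thesis using assms by (simp add: epowr_def mult_less_0_iff)
qed

lemma Ap_const_pos:
  assumes w: "w \<in> Ap_class r" and r: "r \<ge> 1" and D: "D = ball c \<rho>" "\<rho> > 0" and pos: "wmeas w D > 0"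
  shows "enn2real (Ap_const r w) > 0"
proof (cases "r = 1")
  case True
  have wt: "weight w" using w by (auto simp: Ap_class_def)
  have vol: "measure lebesgue D > 0"
    using D by (simp add: measure_lebesgue_ball_pos)
  have "enn2real (wmeas w D) > 0"
    using pos wmeas_ball_finite[OF wt, of c \<rho>] D by (simp add: enn2real_positive_iff)
  then have a: "enn2real (wmeas w D) / measure lebesgue D > 0" using vol by simp
  show ?thesis
  proof (rule ccontr)
    assume "\<not> ?thesis"
    then have "enn2real (Ap_const 1 w) = 0" using True by (simp add: not_less) (metis enn2real_nonneg antisym)
    then have "AE x in lebesgue. x \<notin> D"
      using Ap_ball_r1[OF w[unfolded True] D pos] a by (auto elim!: eventually_mono)
    then have "D \<in> null_sets lebesgue"
      using D by (simp add: AE_iff_null_sets)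
    then have "emeasure lebesgue D = 0" by (rule null_setsD1)
    then show False using vol by (simp add: measure_def)
  qed
next
  case False
  then have "r > 1" using r by simp
  from Ap_ball_gt1(5)[OF w this D pos] show ?thesis
    using w by (simp add: enn2real_positive_iff Ap_class_def)
qed

text \<open>\<open>Ap_average\<close> is applied to \<open>G^(p/r)\<close>, and Hoelder's inequality
  against the indicator of \<open>E\<close> lowers the exponent. The second step leaves the volume
  of the small ball \<open>E\<close> to the power \<open>1 - r / p\<close>. For radii in the ratio
  \<open>2^(-k)\<close> the two volumes together give \<open>|E| * 2^(k n r / p)\<close>, so that
  only the exponent \<open>r / p\<close> is lost.\<close>

lemma Ap_average_p:
  fixes w :: "'a::euclidean_space \<Rightarrow> ennreal" and G :: "'a \<Rightarrow> ennreal"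
  assumes w: "w \<in> Ap_class r" and r: "r \<ge> 1" "r \<le> p" and D: "D = ball c \<rho>" "\<rho> > 0" and pos: "wmeas w D > 0"
    and E: "E = ball c' \<rho>'" "\<rho>' > 0" "E \<subseteq> D" and G: "G \<in> borel_measurable lebesgue"
    and J: "J > 0" "(\<integral>\<^sup>+x\<in>E. epowr (G x) p * w x \<partial>lebesgue) \<le> ennreal J"
    and \<delta>: "\<delta> > 0" "r > 1 \<Longrightarrow> wmeas (dual_weight r w) E \<le> ennreal \<delta> * wmeas (dual_weight r w) D"
  shows "(\<integral>\<^sup>+x\<in>E. G x \<partial>lebesgue) \<le> ennreal (measure lebesgue E powr (1 - r / p) * measure lebesgue D powr (r / p) *
    ((J * enn2real (Ap_const r w) / enn2real (wmeas w D)) powr (1 / p) * \<delta> powr ((r - 1) / p)))"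
proof -
  have wt: "weight w" using w by (auto simp: Ap_class_def)
  note [measurable] = G
  have Es [measurable]: "E \<in> sets lebesgue" using E by simp
  have vol: "measure lebesgue D > 0" "measure lebesgue E > 0"
    using D E by (simp_all add: measure_lebesgue_ball_pos)
  have wD: "enn2real (wmeas w D) > 0"
    using pos wmeas_ball_finite[OF wt, of c \<rho>] D by (simp add: enn2real_positive_iff)
  have W: "enn2real (Ap_const r w) > 0" by (rule Ap_const_pos[OF w r(1) D pos])
  define F where "F x = epowr (G x) (p / r)" for x
  have F [measurable]: "F \<in> borel_measurable lebesgue" unfolding F_def by measurable
  have "p / r * r = p" using r by simp
  then have Fr: "epowr (F x) r = epowr (G x) p" for x
    unfolding F_def using r by (subst epowr_epowr) auto
  define b where "b = measure lebesgue D *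
    (J * enn2real (Ap_const r w) / enn2real (wmeas w D)) powr (1 / r) * \<delta> powr ((r - 1) / r)"
  have b: "b > 0" using vol J W wD \<delta> by (simp add: b_def)
  have FE: "(\<integral>\<^sup>+x\<in>E. F x \<partial>lebesgue) \<le> ennreal b"
    unfolding b_def by (rule Ap_average[OF w r(1) D pos Es E(3) F J(1) _ \<delta>]) (use J(2) in \<open>simp_all add: Fr\<close>)
  have Eint: "(\<integral>\<^sup>+x. indicator E x \<partial>lebesgue) \<le> ennreal (measure lebesgue E)"
    unfolding nn_integral_indicator[OF Es] unfolding E(1) by (rule eq_refl[OF emeasure_lebesgue_ball])
  have "(\<integral>\<^sup>+x. F x * indicator E x \<partial>lebesgue) \<noteq> \<infinity>"
    using FE by (auto simp: top_unique)
  then have "AE x in lebesgue. F x * indicator E x \<noteq> \<infinity>"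
    by (intro nn_integral_noteq_infinite) measurable
  then have "AE x in lebesgue. \<exists>u\<ge>0. \<exists>v\<ge>0. G x * indicator E x \<le> ennreal (u powr (r / p) * v powr (1 - r / p)) \<and>
      ennreal u \<le> F x * indicator E x \<and> ennreal v \<le> indicator E x"
  proof eventually_elim
    fix x assume fin: "F x * indicator E x \<noteq> \<infinity>"
    show "\<exists>u\<ge>0. \<exists>v\<ge>0. G x * indicator E x \<le> ennreal (u powr (r / p) * v powr (1 - r / p)) \<and>
      ennreal u \<le> F x * indicator E x \<and> ennreal v \<le> indicator E x"
    proof (cases "x \<in> E \<and> G x \<noteq> 0")
      case True
      have "G x \<noteq> \<infinity>"
      proof
        assume "G x = \<infinity>"
        then show False using fin True r by (simp add: F_def epowr_def divide_less_0_iff)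
      qed
      then obtain y where y0: "G x = ennreal y" "y \<ge> 0" by (cases "G x") auto
      with True have y: "y > 0" by (auto simp: less_le)
      have "F x = ennreal (y powr (p / r))" using y y0 by (simp add: F_def epowr_ennreal)
      then show ?thesis
        using True y y0 r by (intro exI[of _ "y powr (p / r)"] conjI exI[of _ 1]) (auto simp: powr_powr)
    qed (auto intro!: exI[of _ 0])
  qed
  from nn_integral_Hoelder[OF _ _ _ b vol(2) _ _ FE Eint this]
  have "(\<integral>\<^sup>+x\<in>E. G x \<partial>lebesgue) \<le> ennreal (b powr (r / p) * measure lebesgue E powr (1 - r / p))"
    using r by simp
  also have "b powr (r / p) = measure lebesgue D powr (r / p) *
    ((J * enn2real (Ap_const r w) / enn2real (wmeas w D)) powr (1 / p) * \<delta> powr ((r - 1) / p))"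
  proof -
    have "r \<noteq> 0" "p \<noteq> 0" using r by auto
    then show ?thesis
      unfolding b_def using vol J(1) W wD \<delta>(1) by (simp add: powr_mult powr_powr)
  qed
  finally show ?thesis by (simp add: mult_ac)
qed

text \<open>Hedberg's argument in weighted form. A point is good if for no dyadic scale the integral
  of \<open>H = G^p w\<close> over the ball exceeds \<open>\<theta>\<close> times the weight of the
  fivefold ball. At good points the potential is at most a multiple of
  \<open>\<theta>^(1/q)\<close>; the bad points are covered by Vitali's lemma. Matching
  \<open>\<theta>\<close> with the level \<open>t\<close> gives the weak norm. \<open>J\<close> is
  an arbitrary positive bound, so that no integral has to be divided by while it may vanish.\<close>

lemma riesz_weak_estimate:
  fixes w G :: "'a::euclidean_space \<Rightarrow> ennreal" and f :: "'a \<Rightarrow> real" and m :: nat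
  assumes dim: "DIM('a) \<ge> 2" and m: "m \<ge> 1" and p: "1 \<le> p" "real m * p < real DIM('a)"
    and r: "r \<ge> 1" "r \<le> p" and w: "w \<in> Ap_class r" and R: "R > 0" and B: "B = ball c R" and pos: "wmeas w B > 0"
    and \<eta>: "s = r - (r - 1) * \<eta>" "s \<ge> 1"
    and decay: "\<And>x k. r > 1 \<Longrightarrow> wmeas (dual_weight r w) (ball x (2 * R / 2 ^ k)) \<le>
      ennreal (2 * 2 powr (- (real k * DIM('a) * \<eta>))) * wmeas (dual_weight r w) (ball x (2 * R))"
    and q: "q > 0" "1 / p - 1 / q = real m / (real DIM('a) * s)"
    and G: "G \<in> borel_measurable lebesgue" and f: "\<And>t. {x \<in> B. \<bar>f x\<bar> > t} \<in> sets lebesgue"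
    and C1: "C1 > 0" "AE x in lebesgue. x \<in> B \<longrightarrow> ennreal \<bar>f x\<bar> \<le> ennreal C1 * riesz m R G x"
    and J: "J > 0" "(\<integral>\<^sup>+x. epowr (G x) p * w x \<partial>lebesgue) \<le> ennreal J"
  shows "weak_avg q B w f \<le> ennreal (C1 * (8 * unit_ball_vol DIM('a) * 5 ^ DIM('a) * 2 ^ m) * sobolev_exp DIM('a) m p *
     enn2real (Ap_const r w) powr (1 / p) * R ^ m * (J / enn2real (wmeas w B)) powr (1 / p))"
proof -
  define n where "n = DIM('a)"
  have n: "n \<ge> 2" using dim by (simp add: n_def)
  define \<omega> where "\<omega> = unit_ball_vol (real DIM('a))"
  have \<omega>: "\<omega> > 0" by (simp add: \<omega>_def unit_ball_vol_pos)
  define W where "W = enn2real (Ap_const r w)"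
  have W: "W > 0" unfolding W_def by (rule Ap_const_pos[OF w r(1) B R pos])
  have wt: "weight w" using w by (auto simp: Ap_class_def)
  have wm [measurable]: "w \<in> borel_measurable lebesgue" by (rule weight_measurable[OF wt])
  note [measurable] = G
  define wB where "wB = enn2real (wmeas w B)"
  have wB: "wmeas w B = ennreal wB" "wB > 0"
    using pos wmeas_ball_finite[OF wt, of c R] B by (simp_all add: wB_def enn2real_positive_iff)
  have wpos: "wmeas w (ball x \<rho>) > 0" if "\<rho> > 0" for x \<rho>
    by (rule Ap_positive[OF w r(1) _ that]) (use pos B in auto)
  define H where "H x = epowr (G x) p * w x" for x
  have Hm [measurable]: "H \<in> borel_measurable lebesgue" unfolding H_def by measurable
  \<comment> \<open>The rate \<open>2^(k \<nu>)\<close> at which the bound by the norm on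
    \<open>B\<close> deteriorates.\<close>
  define \<nu> where "\<nu> = real n * s / p"
  have \<nu>m: "(real n - real m * p) / p \<le> \<nu> - real m"
  proof -
    have "real n * 1 \<le> real n * s" using \<eta>(2) by (intro mult_left_mono) auto
    then have "real n / p \<le> \<nu>" unfolding \<nu>_def using p by (intro divide_right_mono) auto
    then show ?thesis using p by (simp add: diff_divide_distrib)
  qed
  have npos: "(real n - real m * p) / p > 0" using p by (simp add: n_def)
  then have \<nu>: "real m < \<nu>" using \<nu>m by linarith
  define pst where "pst = sobolev_exp n m p"
  \<comment> \<open>The Sobolev exponent \<open>pst\<close> is at least \<open>1\<close>, and
    \<open>\<nu> - m \<ge> n / pst \<ge> 2 / pst\<close>. Hence \<open>3\<close> costs
    \<open>3 * pst\<close> and the other summand costs at most \<open>pst\<close>.\<close>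
  have pst: "3 + 2 / (\<nu> - real m) \<le> 4 * pst" "pst > 0"
  proof -
    have np: "real n - real m * p > 0" using p by (simp add: n_def)
    have "2 / (\<nu> - real m) \<le> 2 / ((real n - real m * p) / p)"
      using \<nu>m npos \<nu> by (intro divide_left_mono mult_pos_pos) auto
    also have "\<dots> = 2 * p / (real n - real m * p)" by simp
    also have "\<dots> \<le> real n * p / (real n - real m * p)"
      using n p np by (intro divide_right_mono mult_right_mono) auto
    finally have 1: "2 / (\<nu> - real m) \<le> pst" by (simp add: pst_def sobolev_exp_def)
    have "real n - real m * p \<le> real n * 1" using p by simp
    also have "\<dots> \<le> real n * p" using p by (intro mult_left_mono) auto
    finally have "1 \<le> pst" unfolding pst_def sobolev_exp_def using np by simp
    then show "3 + 2 / (\<nu> - real m) \<le> 4 * pst" "pst > 0" using 1 by auto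
  qed
  have exps: "(1 - real m / \<nu>) / p = 1 / q" "real m / \<nu> / p = 1 / p - 1 / q"
  proof -
    show "real m / \<nu> / p = 1 / p - 1 / q"
      unfolding q(2) \<nu>_def n_def using p by simp
    then show "(1 - real m / \<nu>) / p = 1 / q" by (simp add: diff_divide_distrib)
  qed
  \<comment> \<open>\<open>5 ^ n\<close> is due to the enlarged balls in \<open>b1\<close>, the
    \<open>2\<close> to the factor in the decay of the dual weight in \<open>b2\<close>. One
    constant is used for both bounds.\<close>
  define K0 where "K0 = 2 * \<omega> * 5 ^ n * (2 * R) ^ m"
  have K0: "K0 > 0" using \<omega> R by (simp add: K0_def)
  have good: "riesz m R G x \<le> ennreal (K0 * (4 * pst) * ((W * \<theta>) powr (1 / q) * (W * J / wB) powr (1 / p - 1 / q)))"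
    if x: "x \<in> B" and \<theta>: "\<theta> > 0"
      and ng: "\<And>k. (\<integral>\<^sup>+y\<in>ball x (2 * R / 2 ^ k). H y \<partial>lebesgue) \<le> ennreal \<theta> * wmeas w (ball x (5 * (2 * R / 2 ^ k)))" for x \<theta>
  proof -
    define A where "A = (W * \<theta>) powr (1 / p)"
    define B' where "B' = (W * J / wB) powr (1 / p)"
    have AB: "A > 0" "B' > 0" using W \<theta> J wB by (simp_all add: A_def B'_def)
    define \<rho> where "\<rho> k = 2 * R / 2 ^ k" for k :: nat
    have \<rho>: "\<rho> k > 0" for k using R by (simp add: \<rho>_def)
    define I where "I k = (\<integral>\<^sup>+y\<in>ball x (\<rho> k). G y \<partial>lebesgue)" for k
    have ballm: "measure lebesgue (ball x t) = \<omega> * t ^ n" if "t \<ge> 0" for t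
      unfolding \<omega>_def n_def by (rule measure_lebesgue_ball[OF that])
    \<comment> \<open>The \<open>A_r\<close> condition is used on the fivefold ball that also
      appears in the definition of a good point, with \<open>\<delta> = 1\<close>. Its weight
      cancels, so the weights of the two concentric balls are never compared.\<close>
    have b1: "I k \<le> ennreal (\<omega> * (5 * \<rho> k) ^ n * A)" for k
    proof -
      let ?D = "ball x (5 * \<rho> k)" and ?E = "ball x (\<rho> k)"
      define wD where "wD = enn2real (wmeas w ?D)"
      have pD: "wmeas w ?D > 0" using \<rho> by (intro wpos) simp
      have wD: "wmeas w ?D = ennreal wD" "wD > 0"
        using pD wmeas_ball_finite[OF wt, of x "5 * \<rho> k"] by (simp_all add: wD_def enn2real_positive_iff)
      have sub: "?E \<subseteq> ?D" using \<rho>[of k] by (intro subset_ball) simp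
      have Jk: "\<theta> * wD > 0" "(\<integral>\<^sup>+y\<in>?E. epowr (G y) p * w y \<partial>lebesgue) \<le> ennreal (\<theta> * wD)"
        using ng[of k] \<theta> wD by (simp_all add: H_def \<rho>_def ennreal_mult)
      have "I k \<le> ennreal (measure lebesgue ?E powr (1 - r / p) * measure lebesgue ?D powr (r / p) *
          ((\<theta> * wD * enn2real (Ap_const r w) / enn2real (wmeas w ?D)) powr (1 / p) * 1 powr ((r - 1) / p)))"
        unfolding I_def
        by (rule Ap_average_p[OF w r refl _ pD refl _ sub G Jk]) (use \<rho>[of k] sub in \<open>auto intro: wmeas_mono\<close>)
      also have "\<dots> \<le> ennreal (measure lebesgue ?D powr (1 - r / p) * measure lebesgue ?D powr (r / p) * A)"
      proof (intro ennreal_leI mult_mono powr_mono2)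
        show "measure lebesgue ?E \<le> measure lebesgue ?D"
          using \<rho>[of k] \<omega> by (simp only: ballm mult_nonneg_nonneg less_imp_le zero_le_numeral)
            (intro mult_left_mono power_mono, auto)
        show "(\<theta> * wD * enn2real (Ap_const r w) / enn2real (wmeas w ?D)) powr (1 / p) * 1 powr ((r - 1) / p) \<le> A"
          unfolding wD_def[symmetric] W_def[symmetric] using wD by (simp add: A_def mult.commute)
      qed (use r p in auto)
      also have "measure lebesgue ?D powr (1 - r / p) * measure lebesgue ?D powr (r / p) = measure lebesgue ?D"
        using \<rho>[of k] measure_lebesgue_ball_pos[of "5 * \<rho> k" x] by (simp add: powr_add[symmetric])
      also have "measure lebesgue ?D = \<omega> * (5 * \<rho> k) ^ n"
        using \<rho>[of k] by (intro ballm) simp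
      finally show ?thesis .
    qed
    \<comment> \<open>Here the \<open>A_r\<close> condition is used on
      \<open>ball x (2 * R)\<close>, which contains \<open>B\<close> and has at least its weight.
      The decay of the dual weight lowers the loss from \<open>2^(k n r / p)\<close> to
      \<open>2^(k n s / p)\<close>.\<close>
    have b2: "I k \<le> ennreal (\<omega> * \<rho> k ^ n * 2 * 2 powr (real k * \<nu>) * B')" for k
    proof -
      let ?D = "ball x (2 * R)" and ?E = "ball x (\<rho> k)"
      define wD where "wD = enn2real (wmeas w ?D)"
      have pD: "wmeas w ?D > 0" using R by (intro wpos) simp
      have wD: "wmeas w ?D = ennreal wD" "wD > 0"
        using pD wmeas_ball_finite[OF wt, of x "2 * R"] by (simp_all add: wD_def enn2real_positive_iff)
      have "B \<subseteq> ?D"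
      proof
        fix y assume "y \<in> B"
        then show "y \<in> ?D" using x B dist_triangle[of x y c] by (simp add: dist_commute)
      qed
      then have "wmeas w B \<le> wmeas w ?D" by (rule wmeas_mono)
      then have wle: "wB \<le> wD" using wB wD by simp
      have "\<rho> k \<le> 2 * R" using R by (simp add: \<rho>_def divide_le_eq)
      then have sub: "?E \<subseteq> ?D" by (rule subset_ball)
      define \<delta> where "\<delta> = 2 * 2 powr (- (real k * DIM('a) * \<eta>))"
      have Jk: "(\<integral>\<^sup>+y\<in>?E. epowr (G y) p * w y \<partial>lebesgue) \<le> ennreal J"
        by (rule order.trans[OF nn_integral_mono J(2)]) (simp add: indicator_def)
      have "I k \<le> ennreal (measure lebesgue ?E powr (1 - r / p) * measure lebesgue ?D powr (r / p) *
          ((J * enn2real (Ap_const r w) / enn2real (wmeas w ?D)) powr (1 / p) * \<delta> powr ((r - 1) / p)))"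
        unfolding I_def
        by (rule Ap_average_p[OF w r refl _ pD refl _ sub G J(1) Jk]) (use \<rho>[of k] R decay in \<open>auto simp: \<delta>_def \<rho>_def\<close>)
      also have "\<dots> \<le> ennreal (measure lebesgue ?E powr (1 - r / p) * measure lebesgue ?D powr (r / p) *
          (B' * \<delta> powr ((r - 1) / p)))"
      proof (intro ennreal_leI mult_mono order.refl)
        have "J * W / wD \<le> W * J / wB"
          using wle wB J W by (simp add: mult.commute[of J] divide_left_mono)
        then show "(J * enn2real (Ap_const r w) / enn2real (wmeas w ?D)) powr (1 / p) \<le> B'"
          unfolding wD_def[symmetric] W_def[symmetric] B'_def using p J W wD by (intro powr_mono2) auto
      qed (use AB in auto)
      also have "\<dots> \<le> ennreal (\<omega> * \<rho> k ^ n * 2 * 2 powr (real k * \<nu>) * B')"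
      proof (rule ennreal_leI)
        define v where "v = measure lebesgue ?E"
        have v: "v > 0" unfolding v_def by (rule measure_lebesgue_ball_pos[OF \<rho>])
        have vE: "v = \<omega> * \<rho> k ^ n" using \<rho>[of k] by (simp only: v_def ballm less_imp_le)
        have mD: "measure lebesgue ?D = \<omega> * (2 * R) ^ n" using R by (intro ballm) simp
        have "2 * R = 2 ^ k * \<rho> k" by (simp add: \<rho>_def)
        then have "(2 * R) ^ n = 2 powr (real k * real n) * \<rho> k ^ n"
          by (simp add: power_mult_distrib powr_realpow[symmetric] powr_powr)
        then have D: "measure lebesgue ?D = 2 powr (real k * real n) * v"
          unfolding mD vE by simp
        have "v powr (1 - r / p) * measure lebesgue ?D powr (r / p) = v * 2 powr (real k * real n * (r / p))"
        proof -
          have "measure lebesgue ?D powr (r / p) = 2 powr (real k * real n * (r / p)) * v powr (r / p)"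
            unfolding D using v by (simp add: powr_mult powr_powr)
          then show ?thesis using v by (simp add: powr_diff)
        qed
        moreover have "\<delta> powr ((r - 1) / p) \<le> 2 * 2 powr (- (real k * real n * \<eta>) * ((r - 1) / p))"
        proof -
          have "\<delta> powr ((r - 1) / p) = 2 powr ((r - 1) / p) * 2 powr (- (real k * real n * \<eta>) * ((r - 1) / p))"
            by (simp add: \<delta>_def powr_mult powr_powr n_def)
          moreover have "(2::real) powr ((r - 1) / p) \<le> 2 powr 1"
            using r by (intro powr_mono) (auto simp: divide_le_eq)
          ultimately show ?thesis by (simp add: mult_right_mono)
        qed
        ultimately have "v powr (1 - r / p) * measure lebesgue ?D powr (r / p) * (B' * \<delta> powr ((r - 1) / p))
          \<le> v * 2 powr (real k * real n * (r / p)) * (B' * (2 * 2 powr (- (real k * real n * \<eta>) * ((r - 1) / p))))"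
          using v AB by (simp only:) (intro mult_left_mono, auto)
        also have "\<dots> = v * 2 * (2 powr (real k * real n * (r / p)) * 2 powr (- (real k * real n * \<eta>) * ((r - 1) / p))) * B'"
          by simp
        also have "2 powr (real k * real n * (r / p)) * 2 powr (- (real k * real n * \<eta>) * ((r - 1) / p)) = 2 powr (real k * \<nu>)"
          unfolding powr_add[symmetric] \<nu>_def \<eta>(1) using p by (simp add: field_simps)
        finally show "measure lebesgue ?E powr (1 - r / p) * measure lebesgue ?D powr (r / p) * (B' * \<delta> powr ((r - 1) / p))
          \<le> \<omega> * \<rho> k ^ n * 2 * 2 powr (real k * \<nu>) * B'"
          unfolding v_def[symmetric] by (simp add: vE)
      qed
      finally show ?thesis .
    qed
    define i where "i k = enn2real (I k)" for k
    have I: "I k = ennreal (i k)" "i k \<ge> 0" for k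
      using b1[of k] by (auto simp: i_def less_top[symmetric] top_unique intro!: ennreal_enn2real[symmetric])
    define a where "a k = \<rho> k ^ m / \<rho> k ^ n * i k / K0" for k
    have rm: "\<rho> k ^ m = (2 * R) ^ m * 2 powr (- (real k * real m))" for k
      by (simp add: \<rho>_def power_divide powr_minus_divide powr_realpow[symmetric] powr_powr)
    have a_le: "a k \<le> 2 powr (- (real k * real m)) * min A (B' * 2 powr (real k * \<nu>))" for k
    proof -
      have "i k \<le> \<omega> * (5 * \<rho> k) ^ n * A"
        using b1[of k] \<omega> \<rho>[of k] AB unfolding I(1) by (subst (asm) ennreal_le_iff) auto
      then have "a k \<le> \<rho> k ^ m / \<rho> k ^ n * (\<omega> * (5 * \<rho> k) ^ n * A) / K0"
        unfolding a_def using \<rho>[of k] K0 by (intro divide_right_mono mult_left_mono) auto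
      also have "\<dots> = 2 powr (- (real k * real m)) * A / 2"
        using \<rho>[of k] \<omega> R by (simp add: K0_def rm power_mult_distrib)
      also have "\<dots> \<le> 2 powr (- (real k * real m)) * A" using AB by simp
      finally have 1: "a k \<le> 2 powr (- (real k * real m)) * A" .
      have "i k \<le> \<omega> * \<rho> k ^ n * 2 * 2 powr (real k * \<nu>) * B'"
        using b2[of k] \<omega> \<rho>[of k] AB unfolding I(1) by (subst (asm) ennreal_le_iff) auto
      then have "a k \<le> \<rho> k ^ m / \<rho> k ^ n * (\<omega> * \<rho> k ^ n * 2 * 2 powr (real k * \<nu>) * B') / K0"
        unfolding a_def using \<rho>[of k] K0 by (intro divide_right_mono mult_left_mono) auto
      also have "\<dots> = 2 powr (- (real k * real m)) * (B' * 2 powr (real k * \<nu>)) / 5 ^ n"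
        using \<rho>[of k] \<omega> R by (simp add: K0_def rm)
      also have "\<dots> \<le> 2 powr (- (real k * real m)) * (B' * 2 powr (real k * \<nu>)) / 1"
        using AB by (intro divide_left_mono) auto
      finally have "a k \<le> 2 powr (- (real k * real m)) * (B' * 2 powr (real k * \<nu>))" by simp
      with 1 show ?thesis by (simp add: min_def)
    qed
    have "(\<Sum>k<M. a k) \<le> 4 * pst * ((W * \<theta>) powr (1 / q) * (W * J / wB) powr (1 / p - 1 / q))" for M
    proof -
      have "(\<Sum>k<M. a k) \<le> (3 + 2 / (\<nu> - real m)) * (A powr (1 - real m / \<nu>) * B' powr (real m / \<nu>))"
        using m \<nu> by (intro dyadic_min_sum AB a_le) auto
      also have "\<dots> \<le> 4 * pst * (A powr (1 - real m / \<nu>) * B' powr (real m / \<nu>))"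
        using pst by (intro mult_right_mono) auto
      also have "A powr (1 - real m / \<nu>) = (W * \<theta>) powr (1 / q)"
        using W \<theta> unfolding A_def exps(1)[symmetric] by (simp add: powr_powr)
      also have "B' powr (real m / \<nu>) = (W * J / wB) powr (1 / p - 1 / q)"
        using W wB J unfolding B'_def exps(2)[symmetric] by (simp add: powr_powr mult.commute)
      finally show ?thesis .
    qed
    then have part: "K0 * (\<Sum>k<M. a k) \<le> K0 * (4 * pst * ((W * \<theta>) powr (1 / q) * (W * J / wB) powr (1 / p - 1 / q)))" for M
      using K0 by (intro mult_left_mono) auto
    have "riesz m R G x = (\<Sum>k. ennreal (K0 * a k))"
      unfolding riesz_def
    proof (rule suminf_cong)
      fix k
      have "ennreal (\<rho> k ^ m / \<rho> k ^ n) * I k = ennreal (K0 * a k)"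
        unfolding I(1) using K0 \<rho>[of k] I(2)[of k] by (subst ennreal_mult[symmetric]) (auto simp: a_def)
      then show "ennreal ((2 * R / 2 ^ k) ^ m / (2 * R / 2 ^ k) ^ DIM('a)) * (\<integral>\<^sup>+z\<in>ball x (2 * R / 2 ^ k). G z \<partial>lebesgue) = ennreal (K0 * a k)"
        by (simp add: \<rho>_def n_def I_def)
    qed
    also have "\<dots> \<le> ennreal (K0 * (4 * pst * ((W * \<theta>) powr (1 / q) * (W * J / wB) powr (1 / p - 1 / q))))"
    proof (rule suminf_le_const[OF summableI])
      fix M
      have "a k \<ge> 0" for k using I(2) K0 \<rho>[of k] by (simp add: a_def)
      then have "(\<Sum>k<M. ennreal (K0 * a k)) = ennreal (K0 * (\<Sum>k<M. a k))"
        using K0 by (subst sum_ennreal) (auto simp: sum_distrib_left)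
      then show "(\<Sum>k<M. ennreal (K0 * a k)) \<le> ennreal (K0 * (4 * pst * ((W * \<theta>) powr (1 / q) * (W * J / wB) powr (1 / p - 1 / q))))"
        using part[of M] by (simp add: ennreal_leI)
    qed
    finally show ?thesis by (simp add: mult.assoc)
  qed
  define Q where "Q = C1 * (K0 * (4 * pst)) * W powr (1 / p)"
  have Q: "Q > 0" using C1 K0 pst W by (simp add: Q_def)
  have "ennreal t * epowr (wmeas w {x \<in> B. \<bar>f x\<bar> > t} / wmeas w B) (1 / q) \<le> ennreal (Q * (J / wB) powr (1 / p))"
    if t: "t > 0" for t
  proof -
    define E where "E = {x \<in> B. \<bar>f x\<bar> > t}"
    have Es [measurable]: "E \<in> sets lebesgue" unfolding E_def by (rule f)
    \<comment> \<open>At good points \<open>C1\<close> times the potential is at most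
      \<open>d * \<theta> powr (1 / q)\<close>; the next definition makes this equal to
      \<open>t\<close>. Thus, up to a null set, the level set lies in \<open>S\<close>.\<close>
    define d where "d = Q * (J / wB) powr (1 / p - 1 / q)"
    have d: "d > 0" using Q J wB by (simp add: d_def)
    define \<theta> where "\<theta> = (t / d) powr q"
    have \<theta>: "\<theta> > 0" "\<theta> powr (1 / q) = t / d" using t d q by (simp_all add: \<theta>_def powr_powr)
    define S where "S = {x \<in> B. \<exists>k. ennreal \<theta> * wmeas w (ball x (5 * (2 * R / 2 ^ k))) < (\<integral>\<^sup>+y\<in>ball x (2 * R / 2 ^ k). H y \<partial>lebesgue)}"
    have notS: "\<bar>f x\<bar> \<le> t" if x: "x \<in> B" "x \<notin> S" and fx: "ennreal \<bar>f x\<bar> \<le> ennreal C1 * riesz m R G x" for x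
    proof -
      have "riesz m R G x \<le> ennreal (K0 * (4 * pst) * ((W * \<theta>) powr (1 / q) * (W * J / wB) powr (1 / p - 1 / q)))"
        by (rule good[OF x(1) \<theta>(1)]) (use x in \<open>auto simp: S_def not_less\<close>)
      then have "ennreal C1 * riesz m R G x \<le> ennreal C1 * ennreal (K0 * (4 * pst) * ((W * \<theta>) powr (1 / q) * (W * J / wB) powr (1 / p - 1 / q)))"
        by (rule mult_left_mono) simp
      also have "\<dots> = ennreal (C1 * (K0 * (4 * pst) * ((W * \<theta>) powr (1 / q) * (W * J / wB) powr (1 / p - 1 / q))))"
        using C1 K0 pst by (subst ennreal_mult) auto
      also have "C1 * (K0 * (4 * pst) * ((W * \<theta>) powr (1 / q) * (W * J / wB) powr (1 / p - 1 / q))) = t"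
      proof -
        have "(W * \<theta>) powr (1 / q) * (W * J / wB) powr (1 / p - 1 / q)
            = (W powr (1 / q) * W powr (1 / p - 1 / q)) * (\<theta> powr (1 / q) * (J / wB) powr (1 / p - 1 / q))"
          using W \<theta> J wB by (simp add: powr_mult powr_divide)
        also have "W powr (1 / q) * W powr (1 / p - 1 / q) = W powr (1 / p)"
          using W by (simp add: powr_add[symmetric])
        finally have "C1 * (K0 * (4 * pst) * ((W * \<theta>) powr (1 / q) * (W * J / wB) powr (1 / p - 1 / q))) = d * (t / d)"
          by (simp add: \<theta>(2) d_def Q_def)
        then show ?thesis using d by simp
      qed
      finally have "ennreal \<bar>f x\<bar> \<le> ennreal t" using fx by (rule order.trans[rotated])
      then show ?thesis using t by simp
    qed
    define k where "k x = (SOME k. ennreal \<theta> * wmeas w (ball x (5 * (2 * R / 2 ^ k))) < (\<integral>\<^sup>+y\<in>ball x (2 * R / 2 ^ k). H y \<partial>lebesgue))" for x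
    have kS: "ennreal \<theta> * wmeas w (ball x (5 * (2 * R / 2 ^ k x))) < (\<integral>\<^sup>+y\<in>ball x (2 * R / 2 ^ k x). H y \<partial>lebesgue)" if "x \<in> S" for x
      using that unfolding k_def S_def by (auto intro: someI_ex)
    have "\<And>x. x \<in> S \<Longrightarrow> 0 < 2 * R / 2 ^ k x \<and> 2 * R / 2 ^ k x \<le> 2 * R \<and>
        ennreal \<theta> * wmeas w (ball x (5 * (2 * R / 2 ^ k x))) \<le> (\<integral>\<^sup>+y\<in>ball x (2 * R / 2 ^ k x). H y \<partial>lebesgue)"
      using kS R by (auto simp: divide_le_eq intro: less_imp_le)
    moreover have "(\<integral>\<^sup>+x. H x \<partial>lebesgue) \<le> ennreal J" using J(2) by (simp add: H_def)
    ultimately obtain V where V: "V \<in> sets lebesgue" "S \<subseteq> V" "ennreal \<theta> * wmeas w V \<le> ennreal J"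
      using Vitali_weighted[OF wm Hm, of "ennreal J" S "\<lambda>x. 2 * R / 2 ^ k x" "2 * R" "ennreal \<theta>"] by blast
    have "AE x in lebesgue. w x * indicator E x \<le> w x * indicator V x"
      using C1(2)
    proof eventually_elim
      fix x assume fx: "x \<in> B \<longrightarrow> ennreal \<bar>f x\<bar> \<le> ennreal C1 * riesz m R G x"
      have "x \<in> V" if "x \<in> E"
        using notS[of x] that fx V(2) by (auto simp: E_def not_le[symmetric])
      then show "w x * indicator E x \<le> w x * indicator V x" by (auto simp: indicator_def)
    qed
    then have "wmeas w E \<le> wmeas w V" unfolding wmeas_def by (rule nn_integral_mono_AE)
    then have "ennreal \<theta> * wmeas w E \<le> ennreal \<theta> * wmeas w V" by (rule mult_left_mono) simp
    then have EJ: "ennreal \<theta> * wmeas w E \<le> ennreal J" using V(3) by (rule order.trans)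
    define e where "e = enn2real (wmeas w E)"
    have "wmeas w E \<le> wmeas w B" by (intro wmeas_mono) (auto simp: E_def)
    then have e: "wmeas w E = ennreal e" "e \<ge> 0"
      using wB by (auto simp: e_def top_unique less_top[symmetric] intro!: ennreal_enn2real[symmetric])
    have eJ: "\<theta> * e \<le> J" using EJ \<theta> J e by (simp add: ennreal_mult[symmetric])
    show ?thesis
    proof (cases "e = 0")
      case True
      then show ?thesis using e q unfolding E_def[symmetric] by (simp add: epowr_def)
    next
      case False
      then have e0: "e > 0" using e by simp
      have "epowr (wmeas w E / wmeas w B) (1 / q) = ennreal ((e / wB) powr (1 / q))"
        using e0 wB by (simp add: e(1) wB(1) divide_ennreal epowr_ennreal)
      moreover have "t * (e / wB) powr (1 / q) \<le> Q * (J / wB) powr (1 / p)"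
      proof -
        have "e / wB \<le> (J / wB) / \<theta>"
          using eJ \<theta> wB by (simp add: field_simps)
        then have "(e / wB) powr (1 / q) \<le> ((J / wB) / \<theta>) powr (1 / q)"
          using e0 wB q by (intro powr_mono2) auto
        also have "\<dots> = (J / wB) powr (1 / q) / (t / d)"
          using J wB \<theta> by (subst powr_divide) auto
        finally have "t * (e / wB) powr (1 / q) \<le> t * ((J / wB) powr (1 / q) / (t / d))"
          using t by (intro mult_left_mono) auto
        also have "\<dots> = Q * ((J / wB) powr (1 / p - 1 / q) * (J / wB) powr (1 / q))"
          using t by (simp add: d_def)
        also have "(J / wB) powr (1 / p - 1 / q) * (J / wB) powr (1 / q) = (J / wB) powr (1 / p)"
          using J wB by (simp add: powr_add[symmetric])
        finally show ?thesis .
      qed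
      ultimately show ?thesis
        using t unfolding E_def[symmetric] by (simp add: ennreal_mult[symmetric] ennreal_leI)
    qed
  qed
  then have "weak_avg q B w f \<le> ennreal (Q * (J / wB) powr (1 / p))"
    unfolding weak_avg_def by (intro SUP_least) auto
  also have "Q * (J / wB) powr (1 / p) = C1 * (8 * unit_ball_vol DIM('a) * 5 ^ DIM('a) * 2 ^ m) * sobolev_exp DIM('a) m p *
     enn2real (Ap_const r w) powr (1 / p) * R ^ m * (J / enn2real (wmeas w B)) powr (1 / p)"
    unfolding Q_def K0_def pst_def W_def wB_def n_def \<omega>_def by (simp add: power_mult_distrib)
  finally show ?thesis .
qed

section \<open>The projection onto polynomials\<close>

lemma set_lebesgue_integral_sum:
  fixes f :: "'i \<Rightarrow> 'a \<Rightarrow> real"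
  assumes "finite I" "\<And>i. i \<in> I \<Longrightarrow> set_integrable M A (f i)"
  shows "(LINT x:A|M. \<Sum>i\<in>I. f i x) = (\<Sum>i\<in>I. LINT x:A|M. f i x)"
  using assms(2) unfolding set_lebesgue_integral_def set_integrable_def scaleR_sum_right
  by (rule Bochner_Integration.integral_sum)

lemma polysI: "(\<And>x. g x = (\<Sum>\<gamma> | mi_order \<gamma> \<le> d. a \<gamma> * mi_monom \<gamma> x)) \<Longrightarrow> g \<in> polys d"
  unfolding polys_def by (intro image_eqI[of _ _ a]) auto

lemma polysE:
  assumes "g \<in> polys d"
  obtains a where "\<And>x. g x = (\<Sum>\<gamma> | mi_order \<gamma> \<le> d. a \<gamma> * mi_monom \<gamma> x)"
proof -
  from assms obtain a where "g = (\<lambda>x. \<Sum>\<gamma> | mi_order \<gamma> \<le> d. a \<gamma> * mi_monom \<gamma> x)"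
    unfolding polys_def by (rule rangeE)
  with that[of a] show ?thesis by simp
qed

lemma polys_add:
  assumes "f \<in> polys d" "g \<in> polys d"
  shows "(\<lambda>x. f x + g x) \<in> polys d"
proof -
  obtain a b where "\<And>x. f x = (\<Sum>\<gamma> | mi_order \<gamma> \<le> d. a \<gamma> * mi_monom \<gamma> x)"
    "\<And>x. g x = (\<Sum>\<gamma> | mi_order \<gamma> \<le> d. b \<gamma> * mi_monom \<gamma> x)"
    using assms by (auto elim!: polysE)
  then show ?thesis
    by (intro polysI[where a = "\<lambda>\<gamma>. a \<gamma> + b \<gamma>"]) (simp add: distrib_right sum.distrib)
qed

lemma polys_cmult:
  assumes "f \<in> polys d"
  shows "(\<lambda>x. c * f x) \<in> polys d"
proof -
  obtain a where "\<And>x. f x = (\<Sum>\<gamma> | mi_order \<gamma> \<le> d. a \<gamma> * mi_monom \<gamma> x)"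
    using assms by (auto elim!: polysE)
  then show ?thesis
    by (intro polysI[where a = "\<lambda>\<gamma>. c * a \<gamma>"]) (simp add: sum_distrib_left mult.assoc)
qed

lemma polys_0: "(\<lambda>x. 0) \<in> polys d"
  by (rule polysI[where a = "\<lambda>_. 0"]) simp

lemma polys_sum: "(\<And>i. i \<in> I \<Longrightarrow> f i \<in> polys d) \<Longrightarrow> (\<lambda>x. \<Sum>i\<in>I. f i x) \<in> polys d"
  by (induction I rule: infinite_finite_induct) (auto intro: polys_add polys_0)

lemma polys_diff: "f \<in> polys d \<Longrightarrow> g \<in> polys d \<Longrightarrow> (\<lambda>x. f x - g x) \<in> polys d"
  using polys_add[of f d "\<lambda>x. (- 1) * g x"] polys_cmult[of g d "- 1"] by simp

lemma mi_monom_polys: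
  assumes "mi_order \<gamma> \<le> d"
  shows "mi_monom \<gamma> \<in> polys d"
proof (rule polysI[where a = "\<lambda>\<beta>. if \<beta> = \<gamma> then 1 else 0"])
  fix x
  have "(\<Sum>\<beta> | mi_order \<beta> \<le> d. (if \<beta> = \<gamma> then 1 else 0) * mi_monom \<beta> x)
      = (\<Sum>\<beta>\<in>{\<gamma>}. (if \<beta> = \<gamma> then 1 else 0) * mi_monom \<beta> x)"
    using assms by (intro sum.mono_neutral_right finite_mi_order_le) auto
  then show "mi_monom \<gamma> x = (\<Sum>\<beta> | mi_order \<beta> \<le> d. (if \<beta> = \<gamma> then 1 else 0) * mi_monom \<beta> x)"
    by simp
qed

definition mi_below :: "('n::finite \<Rightarrow> nat) \<Rightarrow> ('n \<Rightarrow> nat) set" where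
  "mi_below \<alpha> = PiE UNIV (\<lambda>j. {..\<alpha> j})"

lemma finite_mi_below: "finite (mi_below \<alpha>)"
  unfolding mi_below_def by (intro finite_PiE) auto

lemma mi_order_below: "\<beta> \<in> mi_below \<alpha> \<Longrightarrow> mi_order \<beta> \<le> mi_order \<alpha>"
  unfolding mi_below_def mi_order_def by (intro sum_mono) (auto dest: PiE_mem)

lemma prod_affine_powers:
  fixes x :: "real^'n::finite" and \<alpha> :: "'n \<Rightarrow> nat"
  shows "(\<Prod>j\<in>UNIV. (A * x $ j + b j) ^ \<alpha> j) =
    (\<Sum>\<beta>\<in>mi_below \<alpha>. mi_monom \<beta> x * (\<Prod>j\<in>UNIV. of_nat (\<alpha> j choose \<beta> j) * A ^ \<beta> j * b j ^ (\<alpha> j - \<beta> j)))"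
proof -
  have "(\<Prod>j\<in>UNIV. (A * x $ j + b j) ^ \<alpha> j)
      = (\<Prod>j\<in>UNIV. \<Sum>k\<le>\<alpha> j. (x $ j) ^ k * (of_nat (\<alpha> j choose k) * A ^ k * b j ^ (\<alpha> j - k)))"
    by (simp add: binomial_ring power_mult_distrib mult_ac)
  also have "\<dots> = (\<Sum>\<beta>\<in>mi_below \<alpha>. \<Prod>j\<in>UNIV. (x $ j) ^ \<beta> j * (of_nat (\<alpha> j choose \<beta> j) * A ^ \<beta> j * b j ^ (\<alpha> j - \<beta> j)))"
    unfolding mi_below_def by (rule prod_sum_PiE) auto
  finally show ?thesis
    by (simp add: prod.distrib mi_monom_def)
qed

lemma polys_affine:
  fixes g :: "real^'n::finite \<Rightarrow> real"
  assumes "g \<in> polys d"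
  shows "(\<lambda>u. g (c + R *\<^sub>R u)) \<in> polys d"
proof -
  obtain a where g: "\<And>x. g x = (\<Sum>\<gamma> | mi_order \<gamma> \<le> d. a \<gamma> * mi_monom \<gamma> x)"
    using assms by (auto elim!: polysE)
  have "(\<lambda>u. mi_monom \<gamma> (c + R *\<^sub>R u)) \<in> polys d" if "mi_order \<gamma> \<le> d" for \<gamma>
  proof -
    have eq: "mi_monom \<gamma> (c + R *\<^sub>R u) = (\<Sum>\<beta>\<in>mi_below \<gamma>.
        (\<Prod>j\<in>UNIV. of_nat (\<gamma> j choose \<beta> j) * R ^ \<beta> j * (c $ j) ^ (\<gamma> j - \<beta> j)) * mi_monom \<beta> u)" for u
      using prod_affine_powers[where A = R and b = "\<lambda>j. c $ j" and x = u and \<alpha> = \<gamma>]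
      by (simp add: mi_monom_def add.commute mult.commute)
    show ?thesis
      unfolding eq using that mi_order_below[of _ \<gamma>]
      by (intro polys_sum polys_cmult mi_monom_polys) (auto intro: order.trans)
  qed
  then show ?thesis
    unfolding g by (intro polys_sum polys_cmult) auto
qed

text \<open>Expanding the powers of \<open>x - z\<close> separates the variables: the monomials in
  \<open>x\<close> leave the integral, and what remains under it are coefficients.\<close>

lemma (in weak_derivs) taylor_polys:
  assumes K: "compact K" "K \<subseteq> U" and \<kappa>: "\<And>j. smooth1 (\<kappa> j)" "\<And>z. z \<notin> K \<Longrightarrow> tens \<kappa> z = 0"
  shows "taylor \<kappa> \<in> polys (m - 1)"
proof -
  define u where "u \<alpha> \<beta> = (\<lambda>j s. of_nat (\<alpha> j choose \<beta> j) * ((0 - s) ^ (\<alpha> j - \<beta> j) * \<kappa> j s))"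
    for \<alpha> \<beta> :: "'n \<Rightarrow> nat"
  have su: "smooth1 (u \<alpha> \<beta> j)" for \<alpha> \<beta> j
    unfolding u_def by (intro smooth1_mult smooth1_const smooth1_diff_power \<kappa>)
  have tu: "tens (u \<alpha> \<beta>) z = (\<Prod>j\<in>UNIV. of_nat (\<alpha> j choose \<beta> j) * 1 ^ \<beta> j * (- z $ j) ^ (\<alpha> j - \<beta> j)) * tens \<kappa> z" for \<alpha> \<beta> z
    by (simp add: tens_def u_def prod.distrib[symmetric] mult_ac)
  have T: "tens (taylor_factor x \<alpha> \<kappa>) z = (\<Sum>\<beta>\<in>mi_below \<alpha>. mi_monom \<beta> x * tens (u \<alpha> \<beta>) z)" for x z \<alpha>
    using prod_affine_powers[where A = 1 and b = "\<lambda>j. - z $ j" and x = x and \<alpha> = \<alpha>]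
    by (simp add: tens_taylor_factor tu sum_distrib_right mult.assoc)
  have "(LINT z:U|lebesgue. D \<alpha> z * tens (taylor_factor x \<alpha> \<kappa>) z)
      = (\<Sum>\<beta>\<in>mi_below \<alpha>. (LINT z:U|lebesgue. D \<alpha> z * tens (u \<alpha> \<beta>) z) * mi_monom \<beta> x)" if \<alpha>: "mi_order \<alpha> < m" for \<alpha> x
  proof -
    have si: "set_integrable lebesgue U (\<lambda>z. D \<alpha> z * tens (u \<alpha> \<beta>) z)" for \<beta>
      using \<alpha> \<kappa>(2) by (intro set_integrable_tens[OF loc_int K] su) (auto simp: tu)
    have "(LINT z:U|lebesgue. D \<alpha> z * tens (taylor_factor x \<alpha> \<kappa>) z)
        = (LINT z:U|lebesgue. \<Sum>\<beta>\<in>mi_below \<alpha>. mi_monom \<beta> x * (D \<alpha> z * tens (u \<alpha> \<beta>) z))"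
      unfolding T by (simp add: sum_distrib_left mult_ac)
    also have "\<dots> = (\<Sum>\<beta>\<in>mi_below \<alpha>. LINT z:U|lebesgue. mi_monom \<beta> x * (D \<alpha> z * tens (u \<alpha> \<beta>) z))"
      by (intro set_lebesgue_integral_sum finite_mi_below set_integrable_mult_right si)
    finally show ?thesis
      by (simp add: mult.commute)
  qed
  then have eq: "taylor \<kappa> x = (\<Sum>\<alpha> | mi_order \<alpha> < m. (1 / mi_fact \<alpha>) *
      (\<Sum>\<beta>\<in>mi_below \<alpha>. (LINT z:U|lebesgue. D \<alpha> z * tens (u \<alpha> \<beta>) z) * mi_monom \<beta> x))" for x
    unfolding taylor_def by (intro sum.cong) auto
  have "mi_monom \<beta> \<in> polys (m - 1)" if "mi_order \<alpha> < m" "\<beta> \<in> mi_below \<alpha>" for \<alpha> \<beta> :: "'n \<Rightarrow> nat"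
    using that mi_order_below[of \<beta> \<alpha>] by (intro mi_monom_polys) auto
  then have "(\<lambda>x. \<Sum>\<alpha> | mi_order \<alpha> < m. (1 / mi_fact \<alpha>) *
      (\<Sum>\<beta>\<in>mi_below \<alpha>. (LINT z:U|lebesgue. D \<alpha> z * tens (u \<alpha> \<beta>) z) * mi_monom \<beta> x)) \<in> polys (m - 1)"
    by (intro polys_sum polys_cmult) auto
  then show ?thesis
    unfolding eq[abs_def] .
qed

section \<open>Polynomials on a ball and the averaged inner product\<close>

lemma continuous_on_polys: "g \<in> polys d \<Longrightarrow> continuous_on A g"
  by (auto simp: polys_def mi_monom_def intro!: continuous_intros)

lemma polys_measurable: "g \<in> polys d \<Longrightarrow> g \<in> borel_measurable lebesgue"
  by (intro measurable_completion) (simp add: borel_measurable_continuous_onI continuous_on_polys)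

lemma polys_bounded:
  assumes "g \<in> polys d"
  obtains M where "M \<ge> 0" "\<And>x. x \<in> ball c R \<Longrightarrow> \<bar>g x\<bar> \<le> M"
proof -
  have "compact (g ` cball c R)"
    using assms by (intro compact_continuous_image continuous_on_polys) auto
  then obtain M where "\<And>x. x \<in> cball c R \<Longrightarrow> \<bar>g x\<bar> \<le> M"
    using compact_imp_bounded bounded_iff by (metis image_eqI real_norm_def)
  then have "\<bar>g x\<bar> \<le> max M 0" if "x \<in> ball c R" for x
    using that by (meson ball_subset_cball in_mono max.coboundedI1)
  with that[of "max M 0"] show ?thesis by auto
qed

lemma set_integrable_mult_polys:
  fixes c :: "real^'n::finite"
  assumes h: "set_integrable lebesgue (ball c R) h" and g: "g \<in> polys d"
  shows "set_integrable lebesgue (ball c R) (\<lambda>x. h x * g x)"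
proof -
  obtain M where M: "M \<ge> 0" "\<And>x. x \<in> ball c R \<Longrightarrow> \<bar>g x\<bar> \<le> M"
    using polys_bounded[OF g] by blast
  have int: "integrable lebesgue (\<lambda>x. indicat_real (ball c R) x * h x)"
    using h by (simp add: set_integrable_def)
  have "integrable lebesgue (\<lambda>x. (indicat_real (ball c R) x * h x) * g x)"
  proof (rule Bochner_Integration.integrable_bound)
    show "integrable lebesgue (\<lambda>x. M * (indicat_real (ball c R) x * h x))"
      by (intro integrable_mult_right int)
    show "(\<lambda>x. (indicat_real (ball c R) x * h x) * g x) \<in> borel_measurable lebesgue"
      by (intro borel_measurable_times borel_measurable_integrable[OF int] polys_measurable[OF g])
    show "AE x in lebesgue. norm ((indicat_real (ball c R) x * h x) * g x) \<le> norm (M * (indicat_real (ball c R) x * h x))"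
    proof (rule AE_I2)
      fix x
      show "norm ((indicat_real (ball c R) x * h x) * g x) \<le> norm (M * (indicat_real (ball c R) x * h x))"
        using M(1) mult_left_mono[OF M(2)[of x], of "\<bar>h x\<bar>"] by (auto simp: indicator_def abs_mult mult.commute)
    qed
  qed
  then show ?thesis
    by (simp add: set_integrable_def mult.assoc)
qed

lemma set_integrable_polys:
  fixes c :: "real^'n::finite"
  assumes "g \<in> polys d"
  shows "set_integrable lebesgue (ball c R) g"
proof -
  have "set_integrable lebesgue (ball c R) (\<lambda>x. 1 :: real)"
    by (metis absolutely_integrable_on_const lmeasurable_ball)
  from set_integrable_mult_polys[OF this assms] show ?thesis by simp
qed

lemma avg_inner_commute: "avg_inner B f g = avg_inner B g f"
  by (simp add: avg_inner_def mult.commute)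

lemma avg_inner_sum_left:
  fixes c :: "real^'n::finite"
  assumes "\<And>i. i \<in> I \<Longrightarrow> set_integrable lebesgue (ball c R) (f i)" "g \<in> polys d" "finite I"
  shows "avg_inner (ball c R) (\<lambda>x. \<Sum>i\<in>I. a i * f i x) g = (\<Sum>i\<in>I. a i * avg_inner (ball c R) (f i) g)"
proof -
  have "(LINT x:ball c R|lebesgue. (\<Sum>i\<in>I. a i * f i x) * g x)
      = (LINT x:ball c R|lebesgue. (\<Sum>i\<in>I. a i * (f i x * g x)))"
    by (simp add: sum_distrib_right mult.assoc)
  also have "\<dots> = (\<Sum>i\<in>I. LINT x:ball c R|lebesgue. a i * (f i x * g x))"
    using assms by (intro set_lebesgue_integral_sum set_integrable_mult_right set_integrable_mult_polys) auto
  finally show ?thesis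
    by (simp add: avg_inner_def sum_divide_distrib)
qed

lemma avg_inner_diff_left:
  fixes c :: "real^'n::finite"
  assumes "set_integrable lebesgue (ball c R) f" "set_integrable lebesgue (ball c R) h" "g \<in> polys d"
  shows "avg_inner (ball c R) (\<lambda>x. f x - h x) g = avg_inner (ball c R) f g - avg_inner (ball c R) h g"
  unfolding avg_inner_def left_diff_distrib
  using set_integrable_mult_polys[OF assms(1,3)] set_integrable_mult_polys[OF assms(2,3)]
  by (simp add: diff_divide_distrib)

text \<open>On the line through \<open>c\<close> and \<open>y\<close> the function is a polynomial
  in one variable with infinitely many zeros. The lemma is needed because bases must represent
  polynomials on the whole space, whereas the inner product only sees the ball.\<close>

lemma polys_zero_on_ball:
  fixes g :: "real^'n::finite \<Rightarrow> real"
  assumes g: "g \<in> polys d" and z: "\<And>x. x \<in> ball c R \<Longrightarrow> g x = 0" and R: "R > 0"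
  shows "g y = 0"
proof -
  obtain a where a: "\<And>x. g x = (\<Sum>\<gamma> | mi_order \<gamma> \<le> d. a \<gamma> * mi_monom \<gamma> x)"
    using g by (auto elim!: polysE)
  define v where "v = y - c"
  define P where "P = (\<Sum>\<gamma> | mi_order \<gamma> \<le> d. smult (a \<gamma>) (\<Prod>i\<in>UNIV. [:c $ i, v $ i:] ^ \<gamma> i))"
  have P: "poly P t = g (c + t *\<^sub>R v)" for t
    by (simp add: P_def a mi_monom_def poly_sum poly_prod)
  define e where "e = R / (norm v + 1)"
  have e: "e > 0" using R by (simp add: e_def add_nonneg_pos)
  have "poly P t = 0" if "t \<in> {0<..<e}" for t
  proof -
    have "t * (norm v + 1) < R"
      using that by (simp add: e_def pos_less_divide_eq add_nonneg_pos)
    then have "norm (t *\<^sub>R v) < R"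
      using that by (simp add: algebra_simps)
    then show ?thesis
      unfolding P by (intro z) (simp add: dist_norm)
  qed
  then have "{0<..<e} \<subseteq> {t. poly P t = 0}" by blast
  then have "infinite {t. poly P t = 0}"
    using e infinite_Ioo infinite_super by blast
  then have "P = 0"
    using poly_roots_finite by blast
  then have "g (c + 1 *\<^sub>R v) = 0"
    using P[of 1] by simp
  then show ?thesis by (simp add: v_def)
qed

lemma avg_inner_nonneg:
  "avg_inner B g g \<ge> 0"
  unfolding avg_inner_def set_lebesgue_integral_def
  by (intro divide_nonneg_nonneg integral_nonneg_AE AE_I2) auto

lemma avg_inner_eq_0:
  fixes g :: "real^'n::finite \<Rightarrow> real"
  assumes g: "g \<in> polys d" and 0: "avg_inner (ball c R) g g = 0" and R: "R > 0"
  shows "g y = 0"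
proof -
  have "(LINT x|lebesgue. indicat_real (ball c R) x * (g x * g x)) = 0"
    using 0 measure_lebesgue_ball_pos[OF R, of c] by (simp add: avg_inner_def set_lebesgue_integral_def)
  moreover have "integrable lebesgue (\<lambda>x. indicat_real (ball c R) x * (g x * g x))"
    using set_integrable_mult_polys[OF set_integrable_polys[OF g] g] by (simp add: set_integrable_def)
  ultimately have "AE x in lebesgue. indicat_real (ball c R) x * (g x * g x) = 0"
    by (subst (asm) integral_nonneg_eq_0_iff_AE) auto
  then have "AE x in lebesgue. x \<notin> ball c R \<inter> {x. g x \<noteq> 0}"
    by eventually_elim (auto simp: indicator_def)
  moreover have op: "open (ball c R \<inter> {x. g x \<noteq> 0})"
    by (intro open_Int open_ball open_Collect_neq continuous_on_polys[OF g] continuous_on_const)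
  then have "ball c R \<inter> {x. g x \<noteq> 0} \<in> sets lebesgue" by simp
  ultimately have "negligible (ball c R \<inter> {x. g x \<noteq> 0})"
    unfolding negligible_iff_null_sets by (simp add: AE_iff_null_sets)
  then have "ball c R \<inter> {x. g x \<noteq> 0} = {}"
    using open_not_negligible[OF op] by blast
  then have "g x = 0" if "x \<in> ball c R" for x using that by blast
  from polys_zero_on_ball[OF g this R] show ?thesis .
qed

section \<open>Orthonormal bases of the space of polynomials\<close>

definition orthonormal :: "(real^'n::finite) set \<Rightarrow> (real^'n \<Rightarrow> real) set \<Rightarrow> bool" where
  "orthonormal B \<Phi> \<longleftrightarrow> finite \<Phi> \<and> (\<forall>\<phi>\<in>\<Phi>. \<forall>\<psi>\<in>\<Phi>. avg_inner B \<phi> \<psi> = (if \<phi> = \<psi> then 1 else 0))"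

definition lin_comb :: "(real^'n::finite \<Rightarrow> real) set \<Rightarrow> (real^'n \<Rightarrow> real) \<Rightarrow> bool" where
  "lin_comb \<Phi> g \<longleftrightarrow> (\<exists>a. g = (\<lambda>x. \<Sum>\<phi>\<in>\<Phi>. a \<phi> * \<phi> x))"

lemma lin_comb_insert: "finite \<Phi> \<Longrightarrow> e \<notin> \<Phi> \<Longrightarrow> lin_comb \<Phi> g \<Longrightarrow> lin_comb (insert e \<Phi>) (\<lambda>x. g x + k * e x)"
proof -
  assume A: "finite \<Phi>" "e \<notin> \<Phi>" "lin_comb \<Phi> g"
  then obtain a where a: "g = (\<lambda>x. \<Sum>\<phi>\<in>\<Phi>. a \<phi> * \<phi> x)" by (auto simp: lin_comb_def)
  have "g x + k * e x = (\<Sum>\<phi>\<in>insert e \<Phi>. (a(e := k)) \<phi> * \<phi> x)" for x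
  proof -
    have "(\<Sum>\<phi>\<in>\<Phi>. (a(e := k)) \<phi> * \<phi> x) = g x"
      unfolding a using A(2) by (intro sum.cong) auto
    then show ?thesis using A by simp
  qed
  then show ?thesis unfolding lin_comb_def by (intro exI[of _ "a(e := k)"]) blast
qed

lemma lin_comb_sum:
  assumes "\<And>i. i \<in> I \<Longrightarrow> lin_comb \<Phi> (f i)"
  shows "lin_comb \<Phi> (\<lambda>x. \<Sum>i\<in>I. c i * f i x)"
proof -
  have "\<forall>i\<in>I. \<exists>a. f i = (\<lambda>x. \<Sum>\<phi>\<in>\<Phi>. a \<phi> * \<phi> x)"
    using assms by (auto simp: lin_comb_def)
  from bchoice[OF this] obtain a where a: "\<forall>i\<in>I. f i = (\<lambda>x. \<Sum>\<phi>\<in>\<Phi>. a i \<phi> * \<phi> x)" by blast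
  have "(\<Sum>i\<in>I. c i * f i x) = (\<Sum>\<phi>\<in>\<Phi>. (\<Sum>i\<in>I. c i * a i \<phi>) * \<phi> x)" for x
  proof -
    have "(\<Sum>i\<in>I. c i * f i x) = (\<Sum>i\<in>I. \<Sum>\<phi>\<in>\<Phi>. c i * a i \<phi> * \<phi> x)"
      by (rule sum.cong[OF refl]) (simp add: a sum_distrib_left mult.assoc)
    also have "\<dots> = (\<Sum>\<phi>\<in>\<Phi>. \<Sum>i\<in>I. c i * a i \<phi> * \<phi> x)" by (rule sum.swap)
    finally show ?thesis by (simp add: sum_distrib_right)
  qed
  then show ?thesis unfolding lin_comb_def by (intro exI[of _ "\<lambda>\<phi>. \<Sum>i\<in>I. c i * a i \<phi>"]) blast
qed

text \<open>If \<open>g\<close> is already in the span, its residual \<open>h\<close> has norm zero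
  and therefore vanishes everywhere, and the system is kept. Otherwise the normalized residual is
  new because it is orthogonal to \<open>\<Phi>\<close> and has norm \<open>1\<close>.\<close>

lemma Gram_Schmidt:
  fixes c :: "real^'n::finite"
  assumes "finite S" "S \<subseteq> polys d" and R: "R > 0"
  shows "\<exists>\<Phi>. orthonormal (ball c R) \<Phi> \<and> \<Phi> \<subseteq> polys d \<and> (\<forall>g\<in>S. lin_comb \<Phi> g)"
  using assms(1,2)
proof (induction S rule: finite_induct)
  case empty
  then show ?case by (intro exI[of _ "{}"]) (simp add: orthonormal_def)
next
  case (insert g S)
  let ?B = "ball c R"
  obtain \<Phi> where \<Phi>: "orthonormal ?B \<Phi>" "\<Phi> \<subseteq> polys d" "\<forall>g\<in>S. lin_comb \<Phi> g"
    using insert by auto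
  have fin: "finite \<Phi>" using \<Phi> by (simp add: orthonormal_def)
  have g: "g \<in> polys d" using insert by simp
  define pr where "pr x = (\<Sum>\<phi>\<in>\<Phi>. avg_inner ?B g \<phi> * \<phi> x)" for x
  define h where "h x = g x - pr x" for x
  have pr: "pr \<in> polys d"
    unfolding pr_def[abs_def] using \<Phi>(2) by (intro polys_sum polys_cmult) auto
  have h: "h \<in> polys d"
    unfolding h_def[abs_def] by (intro polys_diff g pr)
  have lpr: "lin_comb \<Phi> pr" unfolding lin_comb_def pr_def[abs_def] by blast
  have orth: "avg_inner ?B h \<psi> = 0" if \<psi>: "\<psi> \<in> \<Phi>" for \<psi>
  proof -
    have \<psi>p: "\<psi> \<in> polys d" using \<Phi> \<psi> by blast
    have "avg_inner ?B pr \<psi> = (\<Sum>\<phi>\<in>\<Phi>. avg_inner ?B g \<phi> * avg_inner ?B \<phi> \<psi>)"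
      unfolding pr_def[abs_def] using \<Phi>(2) by (intro avg_inner_sum_left[OF _ \<psi>p fin] set_integrable_polys) auto
    also have "\<dots> = (\<Sum>\<phi>\<in>\<Phi>. if \<phi> = \<psi> then avg_inner ?B g \<phi> else 0)"
      using \<Phi>(1) \<psi> by (intro sum.cong) (auto simp: orthonormal_def)
    also have "\<dots> = avg_inner ?B g \<psi>" using fin \<psi> by simp
    finally show ?thesis
      unfolding h_def[abs_def] by (subst avg_inner_diff_left[OF _ _ \<psi>p]) (auto intro: set_integrable_polys g pr)
  qed
  show ?case
  proof (cases "avg_inner ?B h h = 0")
    case True
    then have "h = (\<lambda>x. 0)" using avg_inner_eq_0[OF h _ R] by blast
    then have "g = pr" by (auto simp: h_def fun_eq_iff)
    then show ?thesis using \<Phi> lpr by auto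
  next
    case False
    then have pos: "avg_inner ?B h h > 0" using avg_inner_nonneg[of ?B h] by simp
    define k where "k = sqrt (avg_inner ?B h h)"
    have k: "k > 0" "k * k = avg_inner ?B h h" using pos by (simp_all add: k_def)
    define e where "e x = h x / k" for x
    have es: "e = (\<lambda>x. (1 / k) * h x)" by (auto simp: e_def)
    have e: "e \<in> polys d" unfolding es by (intro polys_cmult h)
    have ee: "avg_inner ?B e e = 1"
    proof -
      have "avg_inner ?B e e = avg_inner ?B h h / (k * k)"
        by (simp add: avg_inner_def e_def)
      then show ?thesis using k(2) pos by simp
    qed
    have eo: "avg_inner ?B e \<psi> = 0" if "\<psi> \<in> \<Phi>" for \<psi>
    proof -
      have "avg_inner ?B e \<psi> = avg_inner ?B h \<psi> / k"
        by (simp add: avg_inner_def e_def)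
      then show ?thesis using orth[OF that] by simp
    qed
    have new: "e \<notin> \<Phi>"
    proof
      assume "e \<in> \<Phi>"
      from eo[OF this] ee show False by simp
    qed
    have "orthonormal ?B (insert e \<Phi>)"
      unfolding orthonormal_def
    proof (intro conjI ballI)
      fix \<phi> \<psi> assume "\<phi> \<in> insert e \<Phi>" "\<psi> \<in> insert e \<Phi>"
      then consider "\<phi> = e" "\<psi> = e" | "\<phi> = e" "\<psi> \<in> \<Phi>" | "\<phi> \<in> \<Phi>" "\<psi> = e" | "\<phi> \<in> \<Phi>" "\<psi> \<in> \<Phi>"
        by blast
      then show "avg_inner ?B \<phi> \<psi> = (if \<phi> = \<psi> then 1 else 0)"
      proof cases
        case 1
        then show ?thesis using ee by simp
      next
        case 2
        then have "\<phi> \<noteq> \<psi>" using new by blast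
        then show ?thesis using 2 eo by simp
      next
        case 3
        then have "\<phi> \<noteq> \<psi>" using new by blast
        then show ?thesis using 3 eo avg_inner_commute[of ?B \<phi> e] by simp
      next
        case 4
        then show ?thesis using \<Phi>(1) unfolding orthonormal_def by blast
      qed
    qed (simp add: fin)
    moreover have "lin_comb (insert e \<Phi>) g"
    proof -
      have "g = (\<lambda>x. pr x + k * e x)" using k by (auto simp: e_def h_def)
      then show ?thesis using lin_comb_insert[OF fin new lpr, of k] by simp
    qed
    moreover have "lin_comb (insert e \<Phi>) f" if "f \<in> S" for f
      using lin_comb_insert[OF fin new, of f 0] \<Phi>(3) that by simp
    ultimately show ?thesis
      using e \<Phi>(2) by (intro exI[of _ "insert e \<Phi>"]) auto
  qed
qed

lemma orthonormal_basis_exists: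
  fixes c :: "real^'n::finite"
  assumes R: "R > 0"
  shows "\<exists>\<Phi>. orthonormal_basis (ball c R) d \<Phi>"
proof -
  let ?I = "{\<gamma> :: 'n \<Rightarrow> nat. mi_order \<gamma> \<le> d}"
  obtain \<Phi> where \<Phi>: "orthonormal (ball c R) \<Phi>" "\<Phi> \<subseteq> polys d" "\<forall>g\<in>mi_monom ` ?I. lin_comb \<Phi> g"
    using Gram_Schmidt[of "mi_monom ` ?I" d R c] R finite_mi_order_le mi_monom_polys by blast
  have "lin_comb \<Phi> g" if g: "g \<in> polys d" for g
  proof -
    obtain a where a: "\<And>x. g x = (\<Sum>\<gamma>\<in>?I. a \<gamma> * mi_monom \<gamma> x)"
      using g by (auto elim!: polysE)
    have "lin_comb \<Phi> (\<lambda>x. \<Sum>\<gamma>\<in>?I. a \<gamma> * mi_monom \<gamma> x)"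
      using \<Phi>(3) by (intro lin_comb_sum) auto
    moreover have "g = (\<lambda>x. \<Sum>\<gamma>\<in>?I. a \<gamma> * mi_monom \<gamma> x)" using a by blast
    ultimately show ?thesis by simp
  qed
  then have "orthonormal_basis (ball c R) d \<Phi>"
    using \<Phi>(1,2) unfolding orthonormal_basis_def orthonormal_def lin_comb_def by (intro conjI ballI) blast+
  then show ?thesis by (rule exI)
qed

lemma orthonormal_basis_expand:
  fixes c :: "real^'n::finite"
  assumes \<Phi>: "orthonormal_basis (ball c R) d \<Phi>" and g: "g \<in> polys d"
  shows "g x = (\<Sum>\<phi>\<in>\<Phi>. avg_inner (ball c R) g \<phi> * \<phi> x)"
    "avg_inner (ball c R) g g = (\<Sum>\<phi>\<in>\<Phi>. (avg_inner (ball c R) g \<phi>)\<^sup>2)"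
proof -
  let ?B = "ball c R"
  have fin: "finite \<Phi>" and sub: "\<Phi> \<subseteq> polys d" using \<Phi> by (auto simp: orthonormal_basis_def)
  obtain a where a: "g = (\<lambda>x. \<Sum>\<phi>\<in>\<Phi>. a \<phi> * \<phi> x)"
    using \<Phi> g by (auto simp: orthonormal_basis_def)
  have coef: "avg_inner ?B g \<psi> = a \<psi>" if \<psi>: "\<psi> \<in> \<Phi>" for \<psi>
  proof -
    have "avg_inner ?B g \<psi> = (\<Sum>\<phi>\<in>\<Phi>. a \<phi> * avg_inner ?B \<phi> \<psi>)"
      unfolding a using sub \<psi> by (intro avg_inner_sum_left[OF _ _ fin] set_integrable_polys) auto
    also have "\<dots> = (\<Sum>\<phi>\<in>\<Phi>. if \<phi> = \<psi> then a \<phi> else 0)"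
      using \<Phi> \<psi> by (intro sum.cong) (auto simp: orthonormal_basis_def)
    finally show ?thesis using fin \<psi> by simp
  qed
  show "g x = (\<Sum>\<phi>\<in>\<Phi>. avg_inner ?B g \<phi> * \<phi> x)"
    by (subst a) (auto simp: coef intro!: sum.cong)
  have "avg_inner ?B g g = (\<Sum>\<phi>\<in>\<Phi>. a \<phi> * avg_inner ?B \<phi> g)"
    by (subst (1) a) (use sub in \<open>intro avg_inner_sum_left[OF _ g fin] set_integrable_polys, auto\<close>)
  also have "\<dots> = (\<Sum>\<phi>\<in>\<Phi>. (avg_inner ?B g \<phi>)\<^sup>2)"
    using coef by (intro sum.cong) (auto simp: avg_inner_commute[of ?B _ g] power2_eq_square)
  finally show "avg_inner ?B g g = (\<Sum>\<phi>\<in>\<Phi>. (avg_inner ?B g \<phi>)\<^sup>2)" .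
qed

text \<open>The Jacobian cancels against the ratio of the volumes. This invariance reduces bounds on
  arbitrary balls to the unit ball.\<close>

lemma avg_inner_affine:
  fixes c :: "real^'n::finite"
  assumes g: "g \<in> polys d" and R: "R > 0"
  shows "avg_inner (ball c R) g g = avg_inner (ball 0 1) (\<lambda>u. g (c + R *\<^sub>R u)) (\<lambda>u. g (c + R *\<^sub>R u))"
proof -
  have [measurable]: "g \<in> borel_measurable borel"
    by (simp add: borel_measurable_continuous_onI continuous_on_polys[OF g])
  have [measurable]: "ball b s \<in> sets borel" for b :: "real^'n" and s by simp
  have "(LINT x:ball c R|lebesgue. g x * g x) = (LINT x|lborel. indicat_real (ball c R) x * (g x * g x))"
    unfolding set_lebesgue_integral_def real_scaleR_def by (rule integral_completion) measurable
  also have "\<dots> = (LINT x|density (distr lborel borel (\<lambda>u. c + R *\<^sub>R u)) (\<lambda>_. R ^ CARD('n)). indicat_real (ball c R) x * (g x * g x))"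
    using R by (subst lborel_affine[of R c]) (auto simp: ennreal_power[symmetric])
  also have "\<dots> = (LINT u|lborel. R ^ CARD('n) * (indicat_real (ball c R) (c + R *\<^sub>R u) * (g (c + R *\<^sub>R u) * g (c + R *\<^sub>R u))))"
    using R by (subst integral_real_density) (auto simp: integral_distr)
  also have "\<dots> = R ^ CARD('n) * (LINT u|lborel. indicat_real (ball 0 1) u * (g (c + R *\<^sub>R u) * g (c + R *\<^sub>R u)))"
  proof -
    have "indicat_real (ball c R) (c + R *\<^sub>R u) = indicat_real (ball 0 1) u" for u
      using R by (auto simp: indicator_def dist_norm)
    then show ?thesis by simp
  qed
  also have "(LINT u|lborel. indicat_real (ball 0 1) u * (g (c + R *\<^sub>R u) * g (c + R *\<^sub>R u)))
      = (LINT u:ball 0 1|lebesgue. g (c + R *\<^sub>R u) * g (c + R *\<^sub>R u))"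
    unfolding set_lebesgue_integral_def real_scaleR_def by (rule integral_completion[symmetric]) measurable
  finally have 1: "(LINT x:ball c R|lebesgue. g x * g x)
      = R ^ CARD('n) * (LINT u:ball 0 1|lebesgue. g (c + R *\<^sub>R u) * g (c + R *\<^sub>R u))" .
  have "measure lebesgue (ball c R) = unit_ball_vol DIM(real^'n) * R ^ DIM(real^'n)"
    "measure lebesgue (ball 0 1 :: (real^'n) set) = unit_ball_vol DIM(real^'n) * 1 ^ DIM(real^'n)"
    using R by (intro measure_lebesgue_ball; simp)+
  then show ?thesis
    unfolding avg_inner_def 1 using R by simp
qed

text \<open>On the unit ball one fixed orthonormal basis is bounded, and Cauchy-Schwarz on the
  expansion gives the estimate. An affine substitution preserves the degree bound and the averaged
  inner product, so the same constant serves every ball.\<close>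

lemma polys_sup_bound:
  "\<exists>C\<ge>0. \<forall>(c :: real^'n::finite) R. \<forall>g\<in>polys d. \<forall>x\<in>ball c R. R > 0 \<longrightarrow>
    (g x)\<^sup>2 \<le> C * avg_inner (ball c R) g g"
proof -
  obtain \<Phi> where \<Phi>: "orthonormal_basis (ball (0 :: real^'n) 1) d \<Phi>"
    using orthonormal_basis_exists[of 1 0 d] by auto
  have sub: "\<Phi> \<subseteq> polys d" using \<Phi> by (auto simp: orthonormal_basis_def)
  have "\<forall>\<phi>\<in>\<Phi>. \<exists>M. \<forall>x\<in>ball 0 1. \<bar>\<phi> x\<bar> \<le> M"
    using sub polys_bounded by (metis subsetD)
  from bchoice[OF this] obtain M where M: "\<forall>\<phi>\<in>\<Phi>. \<forall>x\<in>ball 0 1. \<bar>\<phi> x\<bar> \<le> M \<phi>" by blast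
  define C where "C = (\<Sum>\<phi>\<in>\<Phi>. (M \<phi>)\<^sup>2)"
  have C: "C \<ge> 0" unfolding C_def by (intro sum_nonneg) auto
  have unit: "(g x)\<^sup>2 \<le> C * avg_inner (ball 0 1) g g" if g: "g \<in> polys d" and x: "x \<in> ball 0 1"
    for g :: "real^'n \<Rightarrow> real" and x
  proof -
    have "(g x)\<^sup>2 = (\<Sum>\<phi>\<in>\<Phi>. avg_inner (ball 0 1) g \<phi> * \<phi> x)\<^sup>2"
      by (subst orthonormal_basis_expand(1)[OF \<Phi> g, of x]) simp
    also have "\<dots> \<le> (\<Sum>\<phi>\<in>\<Phi>. (avg_inner (ball 0 1) g \<phi>)\<^sup>2) * (\<Sum>\<phi>\<in>\<Phi>. (\<phi> x)\<^sup>2)"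
      by (rule Cauchy_Schwarz_ineq_sum)
    also have "\<dots> \<le> (\<Sum>\<phi>\<in>\<Phi>. (avg_inner (ball 0 1) g \<phi>)\<^sup>2) * C"
      unfolding C_def
    proof (intro mult_left_mono sum_mono sum_nonneg)
      fix \<phi> assume "\<phi> \<in> \<Phi>"
      then have "\<bar>\<phi> x\<bar> \<le> M \<phi>" using M x by blast
      from power_mono[OF this, of 2] show "(\<phi> x)\<^sup>2 \<le> (M \<phi>)\<^sup>2" by simp
    qed simp
    also have "(\<Sum>\<phi>\<in>\<Phi>. (avg_inner (ball 0 1) g \<phi>)\<^sup>2) = avg_inner (ball 0 1) g g"
      by (rule orthonormal_basis_expand(2)[OF \<Phi> g, symmetric])
    finally show ?thesis by (simp add: mult.commute)
  qed
  have "(g x)\<^sup>2 \<le> C * avg_inner (ball c R) g g" if R: "R > 0" and g: "g \<in> polys d" and x: "x \<in> ball c R" for c :: "real^'n" and R g x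
  proof -
    define u where "u = (1 / R) *\<^sub>R (x - c)"
    have u: "u \<in> ball 0 1" "x = c + R *\<^sub>R u"
      using R x by (auto simp: u_def dist_norm norm_minus_commute)
    show ?thesis
      using unit[OF polys_affine[OF g, of c R] u(1)] u(2) avg_inner_affine[OF g R, of c] by simp
  qed
  with C show ?thesis by (intro exI[of _ C]) simp
qed

text \<open>The projection reproduces \<open>\<pi>\<close>, so only \<open>f - \<pi>\<close> is
  projected, and its projection at \<open>x\<close> is the averaged inner product with the
  reproducing kernel \<open>K\<close> of the polynomials at \<open>x\<close>. The kernel is bounded
  by the constant of \<open>polys_sup_bound\<close>, which leaves the mean of
  \<open>|f - \<pi>|\<close>.\<close>

lemma poly_proj_estimate:
  "\<exists>C\<ge>0. \<forall>(c :: real^'n::finite) R f \<pi> x. R > 0 \<longrightarrow> set_integrable lebesgue (ball c R) f \<longrightarrow>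
    \<pi> \<in> polys d \<longrightarrow> x \<in> ball c R \<longrightarrow> \<bar>f x - poly_proj (ball c R) d f x\<bar> \<le>
      \<bar>f x - \<pi> x\<bar> + C * ((LINT y:ball c R|lebesgue. \<bar>f y - \<pi> y\<bar>) / measure lebesgue (ball c R))"
proof -
  from polys_sup_bound[of d, where 'n = 'n] obtain C
    where C0: "C \<ge> 0 \<and> (\<forall>(c :: real^'n) R. \<forall>g\<in>polys d. \<forall>x\<in>ball c R. R > 0 \<longrightarrow>
      (g x)\<^sup>2 \<le> C * avg_inner (ball c R) g g)"
    by (rule exE)
  have C_nonneg: "C \<ge> 0" using C0 by (rule conjunct1)
  have C: "(g x)\<^sup>2 \<le> C * avg_inner (ball c R) g g"
    if "R > 0" "g \<in> polys d" "x \<in> ball c R" for c :: "real^'n" and R g x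
    using C0 that by simp
  have "\<bar>f x - poly_proj (ball c R) d f x\<bar> \<le>
      \<bar>f x - \<pi> x\<bar> + C * ((LINT y:ball c R|lebesgue. \<bar>f y - \<pi> y\<bar>) / measure lebesgue (ball c R))"
    if R: "R > 0" and f: "set_integrable lebesgue (ball c R) f" and \<pi>: "\<pi> \<in> polys d" and x: "x \<in> ball c R"
    for c :: "real^'n" and R f \<pi> x
  proof -
    let ?B = "ball c R"
    define \<Phi> where "\<Phi> = (SOME \<Phi>. orthonormal_basis ?B d \<Phi>)"
    have \<Phi>: "orthonormal_basis ?B d \<Phi>"
      unfolding \<Phi>_def using orthonormal_basis_exists[OF R] by (rule someI_ex)
    have fin: "finite \<Phi>" and sub: "\<Phi> \<subseteq> polys d" using \<Phi> by (auto simp: orthonormal_basis_def)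
    define K where "K y = (\<Sum>\<phi>\<in>\<Phi>. \<phi> x * \<phi> y)" for y
    have K: "K \<in> polys d" unfolding K_def[abs_def] using sub by (intro polys_sum polys_cmult) auto
    define h where "h y = f y - \<pi> y" for y
    have h: "set_integrable lebesgue ?B h"
      unfolding h_def[abs_def] by (intro set_integral_diff(1) f set_integrable_polys[OF \<pi>])
    have coefK: "avg_inner ?B K \<psi> = \<psi> x" if \<psi>: "\<psi> \<in> \<Phi>" for \<psi>
    proof -
      have "avg_inner ?B K \<psi> = (\<Sum>\<phi>\<in>\<Phi>. \<phi> x * avg_inner ?B \<phi> \<psi>)"
        unfolding K_def[abs_def] using sub \<psi> by (intro avg_inner_sum_left[OF _ _ fin] set_integrable_polys) auto
      also have "\<dots> = (\<Sum>\<phi>\<in>\<Phi>. if \<phi> = \<psi> then \<phi> x else 0)"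
        using \<Phi> \<psi> by (intro sum.cong) (auto simp: orthonormal_basis_def)
      finally show ?thesis using fin \<psi> by simp
    qed
    define S where "S y = (\<Sum>\<phi>\<in>\<Phi>. (\<phi> y)\<^sup>2)" for y
    have KK: "avg_inner ?B K K = S x"
      unfolding S_def by (subst orthonormal_basis_expand(2)[OF \<Phi> K]) (simp add: coefK)
    have S_le: "\<bar>K y\<bar> \<le> C" if y: "y \<in> ?B" for y
    proof -
      have S0: "S x \<ge> 0" unfolding S_def by (intro sum_nonneg) auto
      \<comment> \<open>The value of the kernel at \<open>x\<close> is also its square norm, so the
        sup bound applied to \<open>K\<close> at \<open>x\<close> bounds \<open>S x\<close> in terms
        of itself.\<close>
      have 1: "(S x)\<^sup>2 \<le> C * S x"
        using C[OF R K x] by (simp add: KK) (simp add: K_def S_def power2_eq_square)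
      have Sx: "S x \<le> C"
      proof (cases "S x = 0")
        case False
        then show ?thesis using 1 S0 by (simp add: power2_eq_square)
      qed (simp add: C_nonneg)
      have "(K y)\<^sup>2 \<le> C * S x" using C[OF R K y] by (simp add: KK)
      also have "\<dots> \<le> C\<^sup>2" using Sx C_nonneg by (simp add: power2_eq_square mult_left_mono)
      finally show ?thesis using C_nonneg abs_le_square_iff[of "K y" C] by simp
    qed
    have proj: "poly_proj ?B d f x = (\<Sum>\<phi>\<in>\<Phi>. avg_inner ?B f \<phi> * \<phi> x)"
      by (simp add: poly_proj_def \<Phi>_def Let_def)
    have "f x - poly_proj ?B d f x = h x - (\<Sum>\<phi>\<in>\<Phi>. (avg_inner ?B f \<phi> - avg_inner ?B \<pi> \<phi>) * \<phi> x)"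
      unfolding proj h_def left_diff_distrib sum_subtractf
      using orthonormal_basis_expand(1)[OF \<Phi> \<pi>, of x] by simp
    also have "(\<Sum>\<phi>\<in>\<Phi>. (avg_inner ?B f \<phi> - avg_inner ?B \<pi> \<phi>) * \<phi> x) = (\<Sum>\<phi>\<in>\<Phi>. \<phi> x * avg_inner ?B h \<phi>)"
      unfolding h_def[abs_def] using sub
      by (intro sum.cong refl) (subst avg_inner_diff_left[OF f set_integrable_polys[OF \<pi>]], auto)
    also have "\<dots> = avg_inner ?B h K"
    proof -
      have "(LINT y:?B|lebesgue. h y * K y) = (LINT y:?B|lebesgue. \<Sum>\<phi>\<in>\<Phi>. \<phi> x * (h y * \<phi> y))"
        by (simp add: K_def sum_distrib_left mult_ac)
      also have "\<dots> = (\<Sum>\<phi>\<in>\<Phi>. LINT y:?B|lebesgue. \<phi> x * (h y * \<phi> y))"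
        using sub by (intro set_lebesgue_integral_sum fin set_integrable_mult_right set_integrable_mult_polys[OF h]) auto
      finally show ?thesis by (simp add: avg_inner_def sum_divide_distrib)
    qed
    finally have eq: "f x - poly_proj ?B d f x = h x - avg_inner ?B h K" .
    have "\<bar>LINT y:?B|lebesgue. h y * K y\<bar> \<le> (LINT y:?B|lebesgue. \<bar>h y * K y\<bar>)"
      using integral_abs_bound[of lebesgue "\<lambda>y. indicat_real ?B y *\<^sub>R (h y * K y)"]
      by (simp add: set_lebesgue_integral_def abs_mult)
    also have "\<dots> \<le> (LINT y:?B|lebesgue. C * \<bar>h y\<bar>)"
    proof (intro set_integral_mono set_integrable_abs set_integrable_mult_polys[OF h K] set_integrable_mult_right h)
      fix y assume "y \<in> ?B"
      then show "\<bar>h y * K y\<bar> \<le> C * \<bar>h y\<bar>"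
        using mult_left_mono[OF S_le, of y "\<bar>h y\<bar>"] by (simp add: abs_mult mult.commute)
    qed
    finally have "\<bar>avg_inner ?B h K\<bar> \<le> C * ((LINT y:?B|lebesgue. \<bar>h y\<bar>) / measure lebesgue ?B)"
      by (simp add: avg_inner_def abs_divide divide_right_mono)
    then show ?thesis
      unfolding eq h_def by linarith
  qed
  with C0 show ?thesis by (intro exI[of _ C]) simp
qed

section \<open>The estimate for Sobolev functions\<close>

text \<open>Tonelli's theorem, since \<open>z\<close> lies in the ball about \<open>x\<close>
  exactly if \<open>x\<close> lies in the ball about \<open>z\<close>. It is applied to a Borel
  representative of \<open>G\<close>, because joint measurability is wanted on the product of the
  Borel spaces.\<close>

lemma nn_integral_ball_averages:
  fixes G :: "'a::euclidean_space \<Rightarrow> ennreal"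
  assumes G: "G \<in> borel_measurable lebesgue" and r: "r \<ge> 0"
  shows "(\<lambda>x. \<integral>\<^sup>+z\<in>ball x r. G z \<partial>lebesgue) \<in> borel_measurable lebesgue"
    "(\<integral>\<^sup>+x. (\<integral>\<^sup>+z\<in>ball x r. G z \<partial>lebesgue) \<partial>lebesgue) = ennreal (unit_ball_vol DIM('a) * r ^ DIM('a)) * (\<integral>\<^sup>+z. G z \<partial>lebesgue)"
proof -
  obtain G' where G' [measurable]: "G' \<in> borel_measurable lborel" and ae: "AE z in lborel. G z = G' z"
    using completion_ex_borel_measurable[OF G] by blast
  have ae': "AE z in lebesgue. G z = G' z" using ae by (rule AE_completion)
  define I where "I x = (\<integral>\<^sup>+z. G' z * indicator {p. dist (fst p) (snd p) < r} (x, z) \<partial>lborel)" for x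
  have set [measurable]: "{p :: 'a \<times> 'a. dist (fst p) (snd p) < r} \<in> sets (borel \<Otimes>\<^sub>M borel)"
    unfolding borel_prod by (intro borel_open open_Collect_less continuous_intros)
  have meas [measurable]: "(\<lambda>(x, z). G' z * indicator {p. dist (fst p) (snd p) < r} (x, z)) \<in> borel_measurable (lborel \<Otimes>\<^sub>M lborel)"
    by measurable
  have I: "(\<integral>\<^sup>+z\<in>ball x r. G z \<partial>lebesgue) = I x" for x
  proof -
    have "(\<integral>\<^sup>+z\<in>ball x r. G z \<partial>lebesgue) = (\<integral>\<^sup>+z. G' z * indicator {p. dist (fst p) (snd p) < r} (x, z) \<partial>lebesgue)"
      using ae' by (intro nn_integral_cong_AE) (auto simp: indicator_def elim!: eventually_mono)
    then show ?thesis by (simp add: I_def nn_integral_completion)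
  qed
  have Im: "I \<in> borel_measurable lborel"
    unfolding I_def using lborel.borel_measurable_nn_integral[OF meas] by simp
  show "(\<lambda>x. \<integral>\<^sup>+z\<in>ball x r. G z \<partial>lebesgue) \<in> borel_measurable lebesgue"
    unfolding I using Im by (rule measurable_completion)
  have "(\<integral>\<^sup>+x. I x \<partial>lebesgue) = (\<integral>\<^sup>+x. I x \<partial>lborel)" by (rule nn_integral_completion)
  also have "\<dots> = (\<integral>\<^sup>+z. (\<integral>\<^sup>+x. G' z * indicator {p. dist (fst p) (snd p) < r} (x, z) \<partial>lborel) \<partial>lborel)"
    unfolding I_def by (rule lborel_pair.Fubini'[symmetric, OF meas])
  also have "\<dots> = (\<integral>\<^sup>+z. G' z * ennreal (unit_ball_vol DIM('a) * r ^ DIM('a)) \<partial>lborel)"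
  proof (rule nn_integral_cong)
    fix z
    have "(\<integral>\<^sup>+x. G' z * indicator {p. dist (fst p) (snd p) < r} (x, z) \<partial>lborel) = (\<integral>\<^sup>+x. G' z * indicator (ball z r) x \<partial>lborel)"
      by (intro nn_integral_cong) (auto simp: indicator_def dist_commute)
    also have "\<dots> = G' z * emeasure lborel (ball z r)" by (rule nn_integral_cmult_indicator) simp
    finally show "(\<integral>\<^sup>+x. G' z * indicator {p. dist (fst p) (snd p) < r} (x, z) \<partial>lborel) = G' z * ennreal (unit_ball_vol DIM('a) * r ^ DIM('a))"
      using emeasure_ball[OF r, of z] by simp
  qed
  also have "\<dots> = (\<integral>\<^sup>+z. G' z \<partial>lborel) * ennreal (unit_ball_vol DIM('a) * r ^ DIM('a))"
    by (rule nn_integral_multc) measurable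
  also have "(\<integral>\<^sup>+z. G' z \<partial>lborel) = (\<integral>\<^sup>+z. G z \<partial>lebesgue)"
    using ae by (subst nn_integral_completion) (auto intro!: nn_integral_cong_AE elim!: eventually_mono)
  finally show "(\<integral>\<^sup>+x. (\<integral>\<^sup>+z\<in>ball x r. G z \<partial>lebesgue) \<partial>lebesgue) = ennreal (unit_ball_vol DIM('a) * r ^ DIM('a)) * (\<integral>\<^sup>+z. G z \<partial>lebesgue)"
    by (simp add: I mult.commute)
qed

text \<open>Integrating a term of the potential in \<open>x\<close> replaces
  \<open>r_k^(m - n)\<close> by a multiple of \<open>r_k^m\<close>, and these powers are summable
  since \<open>m \<ge> 1\<close>.\<close>

lemma nn_integral_riesz_le:
  fixes G :: "'a::euclidean_space \<Rightarrow> ennreal"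
  assumes G: "G \<in> borel_measurable lebesgue" and R: "R > 0" and m: "m \<ge> 1"
  shows "(\<integral>\<^sup>+x. riesz m R G x \<partial>lebesgue) \<le> ennreal (2 * unit_ball_vol DIM('a) * (2 * R) ^ m) * (\<integral>\<^sup>+z. G z \<partial>lebesgue)"
proof -
  define \<omega> where "\<omega> = unit_ball_vol (real DIM('a))"
  have \<omega>: "\<omega> > 0" by (simp add: \<omega>_def unit_ball_vol_pos)
  define \<rho> where "\<rho> k = 2 * R / 2 ^ k" for k :: nat
  have \<rho>: "\<rho> k > 0" for k using R by (simp add: \<rho>_def)
  let ?IG = "\<integral>\<^sup>+z. G z \<partial>lebesgue"
  note meas = nn_integral_ball_averages(1)[OF G less_imp_le[OF \<rho>]]
  have "(\<integral>\<^sup>+x. riesz m R G x \<partial>lebesgue) = (\<Sum>k. \<integral>\<^sup>+x. ennreal (\<rho> k ^ m / \<rho> k ^ DIM('a)) * (\<integral>\<^sup>+z\<in>ball x (\<rho> k). G z \<partial>lebesgue) \<partial>lebesgue)"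
    unfolding riesz_def \<rho>_def[symmetric] using meas by (intro nn_integral_suminf borel_measurable_times_ennreal borel_measurable_const)
  also have "\<dots> = (\<Sum>k. ennreal (\<rho> k ^ m / \<rho> k ^ DIM('a)) * (ennreal (\<omega> * \<rho> k ^ DIM('a)) * ?IG))"
    by (intro suminf_cong) (simp only: nn_integral_cmult[OF meas] nn_integral_ball_averages(2)[OF G less_imp_le[OF \<rho>]] \<omega>_def)
  also have "\<dots> \<le> (\<Sum>k. ennreal (\<omega> * (2 * R) ^ m * (1 / 2) ^ k) * ?IG)"
  proof (rule suminf_le[OF _ summableI summableI])
    fix k
    have "ennreal (\<rho> k ^ m / \<rho> k ^ DIM('a)) * (ennreal (\<omega> * \<rho> k ^ DIM('a)) * ?IG) = ennreal (\<omega> * \<rho> k ^ m) * ?IG"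
      using \<rho>[of k] \<omega> by (simp add: mult.assoc[symmetric] ennreal_mult[symmetric]) (simp add: mult.commute)
    also have "\<dots> \<le> ennreal (\<omega> * (2 * R) ^ m * (1 / 2) ^ k) * ?IG"
    proof (intro mult_right_mono ennreal_leI)
      have "(2::real) ^ k \<le> (2 ^ k) ^ m" using m by (intro self_le_power) auto
      then have "(2 * R) ^ m / (2 ^ k) ^ m \<le> (2 * R) ^ m / 2 ^ k" using R by (intro divide_left_mono) auto
      then show "\<omega> * \<rho> k ^ m \<le> \<omega> * (2 * R) ^ m * (1 / 2) ^ k"
        using \<omega> mult_left_mono[of "(2 * R) ^ m / (2 ^ k) ^ m" "(2 * R) ^ m / 2 ^ k" \<omega>]
        by (simp add: \<rho>_def power_divide)
    qed simp
    finally show "ennreal (\<rho> k ^ m / \<rho> k ^ DIM('a)) * (ennreal (\<omega> * \<rho> k ^ DIM('a)) * ?IG) \<le> ennreal (\<omega> * (2 * R) ^ m * (1 / 2) ^ k) * ?IG" .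
  qed
  also have "\<dots> = (\<Sum>k. ennreal (\<omega> * (2 * R) ^ m * (1 / 2) ^ k)) * ?IG"
    by (rule ennreal_suminf_multc)
  also have "(\<Sum>k. ennreal (\<omega> * (2 * R) ^ m * (1 / 2) ^ k)) = ennreal (\<omega> * (2 * R) ^ m * 2)"
    using geometric_sums[of "1 / 2 :: real"] \<omega> R by (intro suminf_ennreal_eq sums_mult) auto
  finally show ?thesis by (simp add: \<omega>_def mult_ac)
qed

text \<open>If \<open>G\<close> lives on the ball, the term \<open>k = 0\<close> already sees all of
  it. Together with the previous bound this lets the mean of the potential be estimated by its value
  at any point of the ball.\<close>

lemma riesz_ge_first:
  fixes G :: "'a::euclidean_space \<Rightarrow> ennreal"
  assumes x: "x \<in> ball c R" and G: "\<And>z. z \<notin> ball c R \<Longrightarrow> G z = 0"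
  shows "ennreal ((2 * R) ^ m / (2 * R) ^ DIM('a)) * (\<integral>\<^sup>+z. G z \<partial>lebesgue) \<le> riesz m R G x"
proof -
  have "G z * indicator (ball x (2 * R)) z = G z" for z
  proof (cases "z \<in> ball c R")
    case True
    then have "dist x z < 2 * R" using x dist_triangle[of x z c] by (simp add: dist_commute)
    then show ?thesis by simp
  qed (simp add: G)
  then have "ennreal ((2 * R) ^ m / (2 * R) ^ DIM('a)) * (\<integral>\<^sup>+z. G z \<partial>lebesgue)
      = (\<Sum>k\<in>{0}. ennreal ((2 * R / 2 ^ k) ^ m / (2 * R / 2 ^ k) ^ DIM('a)) * (\<integral>\<^sup>+z\<in>ball x (2 * R / 2 ^ k). G z \<partial>lebesgue))"
    by simp
  also have "\<dots> \<le> riesz m R G x"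
    unfolding riesz_def by (intro sum_le_suminf) auto
  finally show ?thesis .
qed

section \<open>Weak derivatives on a ball\<close>

lemma pderiv_dir_test_function:
  fixes \<psi> :: "real^'n::finite \<Rightarrow> real"
  assumes "\<psi> \<in> test_functions U"
  shows "pderiv_dir i \<psi> \<in> test_functions U"
proof -
  have eq: "iter_pderiv is (pderiv_dir i \<psi>) = iter_pderiv (is @ [i]) \<psi>" for "is"
    by (simp add: iter_pderiv_def)
  have sm: "smooth (pderiv_dir i \<psi>)"
    using assms unfolding test_functions_def smooth_def eq by blast
  let ?S = "closure {x. \<psi> x \<noteq> 0}"
  have "pderiv_dir i \<psi> x = 0" if x: "x \<notin> ?S" for x
  proof -
    have "((\<lambda>_. 0) has_derivative (\<lambda>_. 0)) (at x)" by simp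
    then have "(\<psi> has_derivative (\<lambda>_. 0)) (at x)"
      by (rule has_derivative_transform_within_open[where s = "- ?S"])
         (use x closure_subset[of "{x. \<psi> x \<noteq> 0}"] in auto)
    then have "frechet_derivative \<psi> (at x) = (\<lambda>_. 0)"
      using frechet_derivative_at by metis
    then show ?thesis by (simp add: pderiv_dir_def)
  qed
  then have "{x. pderiv_dir i \<psi> x \<noteq> 0} \<subseteq> ?S" by blast
  then have sub: "closure {x. pderiv_dir i \<psi> x \<noteq> 0} \<subseteq> ?S"
    by (rule closure_minimal) simp
  moreover from this have "compact (closure {x. pderiv_dir i \<psi> x \<noteq> 0})"
    using assms unfolding test_functions_def
    by (metis (mono_tags, lifting) closed_closure compact_Int_closed inf.absorb_iff2 mem_Collect_eq)
  ultimately show ?thesis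
    using assms sm unfolding test_functions_def by blast
qed

lemma mi_list_exists: "\<exists>is. \<forall>i. count_list is i = (\<alpha> :: 'n::finite \<Rightarrow> nat) i"
proof -
  obtain xs where "mset xs = Abs_multiset \<alpha>" using ex_mset by blast
  then have "count_list xs i = \<alpha> i" for i
    using count_mset[of xs i] count_Abs_multiset[of \<alpha>] by simp
  then show ?thesis by blast
qed

text \<open>\<open>has_weak_deriv\<close> moves all derivatives onto the test function at once.
  Testing \<open>g\<close> with the partial derivative of \<open>\<psi>\<close> and \<open>h\<close>
  with \<open>\<psi>\<close> yields the same integral of \<open>f\<close>, with signs that differ by
  one factor \<open>- 1\<close>. The index is appended to the end of the list because the last entry
  acts first.\<close>

lemma has_weak_deriv_by_parts:
  assumes g: "has_weak_deriv U \<alpha> f g" and h: "has_weak_deriv U (\<alpha>(i := Suc (\<alpha> i))) f h" and \<psi>: "\<psi> \<in> test_functions U"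
  shows "(LINT z:U|lebesgue. g z * pderiv_dir i \<psi> z) = - (LINT z:U|lebesgue. h z * \<psi> z)"
proof -
  obtain "is" where "is": "\<forall>i. count_list is i = \<alpha> i"
    using mi_list_exists by blast
  have 1: "(LINT x:U|lebesgue. f x * iter_pderiv is (pderiv_dir i \<psi>) x)
      = (- 1) ^ mi_order \<alpha> * (LINT x:U|lebesgue. g x * pderiv_dir i \<psi> x)"
    using g pderiv_dir_test_function[OF \<psi>, of i] "is" unfolding has_weak_deriv_def by blast
  have "\<forall>j. count_list (is @ [i]) j = (\<alpha>(i := Suc (\<alpha> i))) j"
    using "is" by simp
  then have 2: "(LINT x:U|lebesgue. f x * iter_pderiv (is @ [i]) \<psi> x)
      = (- 1) ^ mi_order (\<alpha>(i := Suc (\<alpha> i))) * (LINT x:U|lebesgue. h x * \<psi> x)"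
    using h \<psi> unfolding has_weak_deriv_def by blast
  have "iter_pderiv is (pderiv_dir i \<psi>) = iter_pderiv (is @ [i]) \<psi>"
    by (simp add: iter_pderiv_def)
  then have "(- 1) ^ mi_order \<alpha> * (LINT x:U|lebesgue. g x * pderiv_dir i \<psi> x)
      = (- 1) ^ mi_order \<alpha> * (- (LINT x:U|lebesgue. h x * \<psi> x))"
    using 1 2 by (simp add: mi_order_inc)
  then show ?thesis by (subst (asm) mult_cancel_left) auto
qed

text \<open>A chosen weak derivative is known to be integrable only on compact subsets of the ball;
  measurability on the ball follows by exhausting it with closed balls.\<close>

lemma locally_integrable_on_ball_measurable:
  fixes h :: "'a::euclidean_space \<Rightarrow> real"
  assumes "locally_integrable_on h (ball c R)"
  shows "(\<lambda>x. indicat_real (ball c R) x * h x) \<in> borel_measurable lebesgue"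
proof (rule borel_measurable_LIMSEQ_real)
  fix x
  show "(\<lambda>k. indicat_real (cball c (R - 1 / real (Suc k))) x * h x) \<longlonglongrightarrow> indicat_real (ball c R) x * h x"
  proof (cases "x \<in> ball c R")
    case True
    have "(\<lambda>k. R - 1 / real (Suc k)) \<longlonglongrightarrow> R - 0"
      by (intro tendsto_intros LIMSEQ_Suc[OF lim_1_over_n])
    then have "\<forall>\<^sub>F k in sequentially. dist c x < R - 1 / real (Suc k)"
      using True by (intro order_tendstoD) auto
    then have "\<forall>\<^sub>F k in sequentially. indicat_real (cball c (R - 1 / real (Suc k))) x * h x = indicat_real (ball c R) x * h x"
      by eventually_elim (use True in auto)
    then show ?thesis by (rule tendsto_eventually)
  next
    case False
    then have "x \<notin> cball c (R - 1 / real (Suc k))" for k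
    proof -
      have "R - 1 / real (Suc k) < R" by simp
      then show ?thesis using False unfolding mem_ball mem_cball by linarith
    qed
    then show ?thesis using False by simp
  qed
next
  fix k
  have "R - 1 / real (Suc k) < R" by simp
  then have "set_integrable lebesgue (cball c (R - 1 / real (Suc k))) h"
    using assms cball_subset_ball_iff[of c "R - 1 / real (Suc k)" c R] by (auto simp: locally_integrable_on_def)
  then show "(\<lambda>x. indicat_real (cball c (R - 1 / real (Suc k))) x * h x) \<in> borel_measurable lebesgue"
    unfolding set_integrable_def by (simp add: borel_measurable_integrable)
qed

lemma grad_abs_measurable:
  fixes c :: "real^'n::finite"
  assumes "\<And>\<gamma>. mi_order \<gamma> = m \<Longrightarrow> locally_integrable_on (weak_deriv (ball c R) \<gamma> f) (ball c R)"
  shows "(\<lambda>z. ennreal (grad_abs m (ball c R) f z) * indicator (ball c R) z) \<in> borel_measurable lebesgue"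
proof -
  have "(\<lambda>z. \<Sum>\<gamma> | mi_order \<gamma> = m. \<bar>indicat_real (ball c R) z * weak_deriv (ball c R) \<gamma> f z\<bar>) \<in> borel_measurable lebesgue"
    using assms by (intro borel_measurable_sum borel_measurable_abs locally_integrable_on_ball_measurable) auto
  then have "(\<lambda>z. ennreal (\<Sum>\<gamma> | mi_order \<gamma> = m. \<bar>indicat_real (ball c R) z * weak_deriv (ball c R) \<gamma> f z\<bar>)) \<in> borel_measurable lebesgue"
    by (rule measurable_compose[OF _ measurable_ennreal])
  moreover have "ennreal (\<Sum>\<gamma> | mi_order \<gamma> = m. \<bar>indicat_real (ball c R) z * weak_deriv (ball c R) \<gamma> f z\<bar>)
      = ennreal (grad_abs m (ball c R) f z) * indicator (ball c R) z" for z
    by (simp add: grad_abs_def indicator_def)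
  ultimately show ?thesis by (simp only:)
qed

lemma sobolev_weak_deriv:
  assumes f: "f \<in> sobolev_W1 m U" and \<gamma>: "mi_order \<gamma> \<le> m"
  shows "has_weak_deriv U \<gamma> f (weak_deriv U \<gamma> f)"
proof -
  have "\<exists>g. has_weak_deriv U \<gamma> f g" using f \<gamma> unfolding sobolev_W1_def by blast
  then show ?thesis unfolding weak_deriv_def by (rule someI_ex)
qed

text \<open>The box at the centre gives a polynomial \<open>\<pi>\<close> close to \<open>f\<close>.
  Passing from \<open>\<pi>\<close> to the projection costs the mean of \<open>|f - \<pi>|\<close>,
  which by the integral bound for the potential is at most a multiple of \<open>R^(m - n)\<close>
  times the integral of the gradient. That is the first term of the potential at every point of the
  ball.\<close>

lemma sobolev_poly_proj_pointwise:
  assumes m: "m \<ge> 1"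
  shows "\<exists>C>0. \<forall>(c :: real^'n::finite) R f. R > 0 \<longrightarrow> f \<in> sobolev_W1 m (ball c R) \<longrightarrow>
    (AE x in lebesgue. x \<in> ball c R \<longrightarrow> ennreal \<bar>f x - poly_proj (ball c R) (m - 1) f x\<bar> \<le>
      ennreal C * riesz m R (\<lambda>z. ennreal (grad_abs m (ball c R) f z) * indicator (ball c R) z) x)"
proof -
  obtain M where M: "M \<ge> 1" "\<And>s. \<bar>bump s\<bar> \<le> M"
    by (rule bump_bounded) blast
  from poly_proj_estimate[of "m - 1", where 'n = 'n] obtain CP
    where CP0: "CP \<ge> 0 \<and> (\<forall>(c :: real^'n) R f \<pi> x. R > 0 \<longrightarrow> set_integrable lebesgue (ball c R) f \<longrightarrow>
      \<pi> \<in> polys (m - 1) \<longrightarrow> x \<in> ball c R \<longrightarrow> \<bar>f x - poly_proj (ball c R) (m - 1) f x\<bar> \<le>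
      \<bar>f x - \<pi> x\<bar> + CP * ((LINT y:ball c R|lebesgue. \<bar>f y - \<pi> y\<bar>) / measure lebesgue (ball c R)))"
    by (rule exE)
  then have CP: "CP \<ge> 0" by (rule conjunct1)
  define C1 where "C1 = real CARD('n) * (real (card {\<alpha> :: 'n \<Rightarrow> nat. mi_order \<alpha> = m - 1}) * (16 * CARD('n) * M) ^ (CARD('n) - 1))
      / bump_mass TYPE('n)"
  have C1: "C1 \<ge> 0" using M bump_mass_pos[where 'n = 'n] by (simp add: C1_def)
  \<comment> \<open>The first summand bounds \<open>f - \<pi>\<close>, the second the multiple
    \<open>CP\<close> of its mean; the \<open>1\<close> makes \<open>C\<close> positive.\<close>
  define C where "C = C1 + CP * (C1 * 2 * 2 ^ CARD('n)) + 1"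
  have main: "AE x in lebesgue. x \<in> ball c R \<longrightarrow> ennreal \<bar>f x - poly_proj (ball c R) (m - 1) f x\<bar> \<le>
      ennreal C * riesz m R (\<lambda>z. ennreal (grad_abs m (ball c R) f z) * indicator (ball c R) z) x"
    if R: "R > 0" and f: "f \<in> sobolev_W1 m (ball c R)" for c :: "real^'n" and R f
  proof -
    define U where "U = ball c R"
    have fint: "set_integrable lebesgue U f" using f by (simp add: sobolev_W1_def U_def)
    \<comment> \<open>Order \<open>m\<close> must be \<open>weak_deriv\<close>, so that
      \<open>grad\<close> agrees with \<open>grad_abs\<close>; there local integrability suffices.
      Order \<open>0\<close> must be \<open>f\<close> itself, for which the estimate is claimed. The
      orders in between need Lebesgue points and hence integrability on \<open>U\<close>, which the
      choice made by \<open>weak_deriv\<close> does not provide.\<close>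
    define D where "D \<gamma> = (if mi_order \<gamma> = m then weak_deriv U \<gamma> f else if mi_order \<gamma> = 0 then f
      else (SOME g. has_weak_deriv U \<gamma> f g \<and> set_integrable lebesgue U g))" for \<gamma> :: "'n \<Rightarrow> nat"
    have wd0: "has_weak_deriv U \<gamma> f f" if "mi_order \<gamma> = 0" for \<gamma>
    proof -
      have "locally_integrable_on f U"
        unfolding locally_integrable_on_def
        using set_integrable_subset[OF fint] lmeasurable_compact fmeasurableD by blast
      moreover have "is = []" if "\<forall>i. count_list is i = \<gamma> i" for "is"
      proof (cases "is")
        case (Cons a list)
        then have "\<gamma> a > 0" using that by (metis count_list.simps(2) zero_less_Suc add.commute plus_1_eq_Suc)
        then show ?thesis using \<open>mi_order \<gamma> = 0\<close> by (simp add: mi_order_def)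
      qed simp
      ultimately show ?thesis
        using that unfolding has_weak_deriv_def by (fastforce simp: iter_pderiv_def)
    qed
    have some: "has_weak_deriv U \<gamma> f (SOME g. has_weak_deriv U \<gamma> f g \<and> set_integrable lebesgue U g) \<and>
        set_integrable lebesgue U (SOME g. has_weak_deriv U \<gamma> f g \<and> set_integrable lebesgue U g)"
      if "mi_order \<gamma> \<le> m" for \<gamma>
    proof (rule someI_ex[of "\<lambda>g. has_weak_deriv U \<gamma> f g \<and> set_integrable lebesgue U g"])
      show "\<exists>g. has_weak_deriv U \<gamma> f g \<and> set_integrable lebesgue U g"
        using f that unfolding sobolev_W1_def U_def by blast
    qed
    have wd: "has_weak_deriv U \<gamma> f (D \<gamma>)" if "mi_order \<gamma> \<le> m" for \<gamma>
      unfolding D_def using sobolev_weak_deriv[OF f that, folded U_def] wd0[of \<gamma>] some[OF that] by simp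
    have Dint: "set_integrable lebesgue U (D \<gamma>)" if "mi_order \<gamma> < m" for \<gamma>
      unfolding D_def using that some[of \<gamma>] fint by simp
    interpret weak_derivs U m D
    proof
      show "m \<ge> 1" by (rule m)
      show "locally_integrable_on (D \<alpha>) U" if "mi_order \<alpha> \<le> m" for \<alpha>
        using wd[OF that] by (simp add: has_weak_deriv_def)
      show "(LINT z:U|lebesgue. D \<alpha> z * pderiv_dir i \<psi> z) = - (LINT z:U|lebesgue. D (\<alpha>(i := Suc (\<alpha> i))) z * \<psi> z)"
        if "mi_order \<alpha> < m" "\<psi> \<in> test_functions U" for \<alpha> i \<psi>
        using that by (intro has_weak_deriv_by_parts[of U \<alpha> f] wd) (auto simp: mi_order_inc)
    qed
    define G where "G z = ennreal (grad_abs m U f z) * indicator U z" for z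
    have gradG: "grad z * indicator U z = G z" for z
    proof -
      have "grad z = (\<Sum>\<gamma> | mi_order \<gamma> = m. ennreal \<bar>weak_deriv U \<gamma> f z\<bar>)"
        unfolding grad_def by (rule sum.cong) (auto simp: D_def)
      then show ?thesis by (simp add: G_def grad_abs_def sum_ennreal)
    qed
    have Gm: "G \<in> borel_measurable lebesgue"
      unfolding G_def U_def
      by (rule grad_abs_measurable) (use sobolev_weak_deriv[OF f] in \<open>auto simp: has_weak_deriv_def\<close>)
    have G0: "G z = 0" if "z \<notin> ball c R" for z using that by (simp add: G_def U_def)
    define \<epsilon> where "\<epsilon> = R / (4 * CARD('n))"
    have \<epsilon>: "\<epsilon> > 0" using R by (simp add: \<epsilon>_def)
    define K where "K = cbox c (c + \<epsilon> *\<^sub>R One)"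
    have KU: "K \<subseteq> U"
    proof
      fix z assume z: "z \<in> K"
      have "\<bar>(z - c) $ j\<bar> \<le> \<bar>(0 :: real^'n) $ j\<bar> + \<epsilon>" for j
      proof -
        have "c $ j \<le> z $ j \<and> z $ j \<le> c $ j + \<epsilon>" using z unfolding K_def mem_corner_box by blast
        then show ?thesis by simp
      qed
      then have "norm (z - c) \<le> norm (0 :: real^'n) + real CARD('n) * \<epsilon>"
        using \<epsilon> by (intro norm_le_norm_add_cart) auto
      also have "\<dots> < R" using R by (simp add: \<epsilon>_def)
      finally show "z \<in> U" by (simp add: U_def dist_norm norm_minus_commute)
    qed
    define \<pi> where "\<pi> x = taylor (box_bump c \<epsilon>) x / bump_mass TYPE('n)" for x
    have "taylor (box_bump c \<epsilon>) \<in> polys (m - 1)"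
      using tens_box_bump_eq_0[OF \<epsilon>] KU
      by (intro taylor_polys[of K] smooth1_box_bump) (auto simp: K_def)
    then have "(\<lambda>x. (1 / bump_mass TYPE('n)) * taylor (box_bump c \<epsilon>) x) \<in> polys (m - 1)"
      by (rule polys_cmult)
    then have \<pi>: "\<pi> \<in> polys (m - 1)" by (simp add: \<pi>_def[abs_def])
    define h where "h x = f x - \<pi> x" for x
    have hint: "set_integrable lebesgue U h"
      unfolding h_def[abs_def] U_def by (intro set_integral_diff(1) fint[unfolded U_def] set_integrable_polys[OF \<pi>])
    have "AE x in lebesgue. lebesgue_point (\<lambda>z. indicat_real U z * D \<alpha> z) x" if "mi_order \<alpha> < m" for \<alpha>
      using Dint[OF that] by (intro AE_lebesgue_point) (simp add: set_integrable_def)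
    then have "AE x in lebesgue. \<forall>\<alpha>\<in>{\<alpha>. mi_order \<alpha> < m}. lebesgue_point (\<lambda>z. indicat_real U z * D \<alpha> z) x"
      by (intro AE_finite_allI finite_mi_order_less) auto
    then have point: "AE x in lebesgue. x \<in> U \<longrightarrow> ennreal \<bar>h x\<bar> \<le> ennreal C1 * riesz m R G x"
    proof eventually_elim
      fix x assume LP: "\<forall>\<alpha>\<in>{\<alpha>. mi_order \<alpha> < m}. lebesgue_point (\<lambda>z. indicat_real U z * D \<alpha> z) x"
      have "D (\<lambda>_. 0) = f" using m by (simp add: D_def mi_order_def)
      then show "x \<in> U \<longrightarrow> ennreal \<bar>h x\<bar> \<le> ennreal C1 * riesz m R G x"
        using taylor_pointwise[OF U_def _ M Dint] LP
        unfolding h_def \<pi>_def C1_def \<epsilon>_def gradG by simp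
    qed
    define IG where "IG = (\<integral>\<^sup>+z. G z \<partial>lebesgue)"
    define v where "v = measure lebesgue U"
    have v: "v = unit_ball_vol DIM(real^'n) * R ^ DIM(real^'n)" "v > 0"
    proof -
      show "v = unit_ball_vol DIM(real^'n) * R ^ DIM(real^'n)"
        unfolding v_def U_def using R by (intro measure_lebesgue_ball) simp
      show "v > 0" unfolding v_def U_def by (rule measure_lebesgue_ball_pos[OF R])
    qed
    have avg: "ennreal ((LINT y:U|lebesgue. \<bar>h y\<bar>) / v) \<le> ennreal (C1 * 2 * 2 ^ CARD('n)) * riesz m R G x" if x: "x \<in> U" for x
    proof -
      have "ennreal (LINT y:U|lebesgue. \<bar>h y\<bar>) = (\<integral>\<^sup>+y. ennreal (indicat_real U y * \<bar>h y\<bar>) \<partial>lebesgue)"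
      proof -
        have "integrable lebesgue (\<lambda>y. indicat_real U y * \<bar>h y\<bar>)"
          using set_integrable_abs[OF hint] by (simp add: set_integrable_def)
        then show ?thesis
          by (simp add: set_lebesgue_integral_def nn_integral_eq_integral)
      qed
      also have "\<dots> \<le> (\<integral>\<^sup>+y. ennreal C1 * riesz m R G y \<partial>lebesgue)"
        using point by (intro nn_integral_mono_AE) (auto simp: indicator_def elim!: eventually_mono)
      also have "\<dots> = ennreal C1 * (\<integral>\<^sup>+y. riesz m R G y \<partial>lebesgue)"
      proof (rule nn_integral_cmult)
        show "riesz m R G \<in> borel_measurable lebesgue"
          unfolding riesz_def[abs_def] using R
          by (intro borel_measurable_suminf_order borel_measurable_times_ennreal borel_measurable_const nn_integral_ball_averages(1)[OF Gm]) auto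
      qed
      also have "\<dots> \<le> ennreal C1 * (ennreal (2 * unit_ball_vol DIM(real^'n) * (2 * R) ^ m) * IG)"
        unfolding IG_def by (intro mult_left_mono nn_integral_riesz_le Gm R m) auto
      finally have 1: "ennreal (LINT y:U|lebesgue. \<bar>h y\<bar>) \<le> ennreal C1 * (ennreal (2 * unit_ball_vol DIM(real^'n) * (2 * R) ^ m) * IG)" .
      have "(LINT y:U|lebesgue. \<bar>h y\<bar>) \<ge> 0"
        unfolding set_lebesgue_integral_def by (intro integral_nonneg_AE) auto
      then have "ennreal ((LINT y:U|lebesgue. \<bar>h y\<bar>) / v) = ennreal (1 / v) * ennreal (LINT y:U|lebesgue. \<bar>h y\<bar>)"
        using v(2) by (simp add: ennreal_mult[symmetric])
      also have "\<dots> \<le> ennreal (1 / v) * (ennreal C1 * (ennreal (2 * unit_ball_vol DIM(real^'n) * (2 * R) ^ m) * IG))"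
        by (intro mult_left_mono 1) simp
      also have "\<dots> = ennreal (1 / v * C1 * (2 * unit_ball_vol DIM(real^'n) * (2 * R) ^ m)) * IG"
      proof -
        have gen: "ennreal a * (ennreal b * (ennreal d * E)) = ennreal (a * b * d) * E"
          if "a \<ge> 0" "b \<ge> 0" "d \<ge> 0" for a b d E
          using that by (simp add: ennreal_mult mult.assoc)
        show ?thesis
          by (rule gen) (use v(2) C1 R unit_ball_vol_pos[of "real DIM(real^'n)"] in auto)
      qed
      also have "1 / v * C1 * (2 * unit_ball_vol DIM(real^'n) * (2 * R) ^ m) = C1 * 2 * 2 ^ CARD('n) * ((2 * R) ^ m / (2 * R) ^ DIM(real^'n))"
      proof -
        have gen: "1 / (\<omega> * R ^ k) * C1 * (2 * \<omega> * (2 * R) ^ m) = C1 * 2 * 2 ^ k * ((2 * R) ^ m / (2 * R) ^ k)"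
          if "\<omega> > 0" for \<omega> :: real and k
          using that R by (simp add: power_mult_distrib)
        have "unit_ball_vol (real DIM(real^'n)) > 0"
          by (simp add: unit_ball_vol_pos)
        from gen[OF this, of "DIM(real^'n)"] show ?thesis
          unfolding v(1) by (simp only: DIM_cart DIM_real mult_1_right)
      qed
      also have "ennreal (C1 * 2 * 2 ^ CARD('n) * ((2 * R) ^ m / (2 * R) ^ DIM(real^'n))) * IG
          = ennreal (C1 * 2 * 2 ^ CARD('n)) * (ennreal ((2 * R) ^ m / (2 * R) ^ DIM(real^'n)) * IG)"
        using C1 R by (subst ennreal_mult) (auto simp: mult.assoc)
      also have "\<dots> \<le> ennreal (C1 * 2 * 2 ^ CARD('n)) * riesz m R G x"
        unfolding IG_def using x by (intro mult_left_mono riesz_ge_first[of x c R] G0) (auto simp: U_def)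
      finally show ?thesis .
    qed
    show ?thesis
      using point
    proof eventually_elim
      fix x assume hx: "x \<in> U \<longrightarrow> ennreal \<bar>h x\<bar> \<le> ennreal C1 * riesz m R G x"
      show "x \<in> ball c R \<longrightarrow> ennreal \<bar>f x - poly_proj (ball c R) (m - 1) f x\<bar> \<le>
        ennreal C * riesz m R (\<lambda>z. ennreal (grad_abs m (ball c R) f z) * indicator (ball c R) z) x"
      proof
        assume x: "x \<in> ball c R"
        let ?I = "(LINT y:U|lebesgue. \<bar>h y\<bar>) / v"
        have I0: "?I \<ge> 0"
          using v(2) unfolding set_lebesgue_integral_def by (intro divide_nonneg_pos integral_nonneg_AE) auto
        have "\<bar>f x - poly_proj (ball c R) (m - 1) f x\<bar> \<le> \<bar>h x\<bar> + CP * ?I"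
          using CP0 R fint \<pi> x unfolding h_def v_def U_def by blast
        then have "ennreal \<bar>f x - poly_proj (ball c R) (m - 1) f x\<bar> \<le> ennreal (\<bar>h x\<bar> + CP * ?I)"
          by (rule ennreal_leI)
        also have "\<dots> = ennreal \<bar>h x\<bar> + ennreal CP * ennreal ?I"
          unfolding ennreal_mult[OF CP I0, symmetric] by (rule ennreal_plus[OF abs_ge_zero mult_nonneg_nonneg[OF CP I0]])
        also have "\<dots> \<le> ennreal C1 * riesz m R G x + ennreal CP * (ennreal (C1 * 2 * 2 ^ CARD('n)) * riesz m R G x)"
          using hx x avg[of x] by (intro add_mono mult_left_mono) (auto simp: U_def)
        also have "\<dots> = ennreal (C1 + CP * (C1 * 2 * 2 ^ CARD('n))) * riesz m R G x"
          using C1 CP by (simp add: ennreal_plus ennreal_mult distrib_right mult.assoc)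
        also have "\<dots> \<le> ennreal C * riesz m R G x"
          by (intro mult_right_mono ennreal_leI) (auto simp: C_def)
        finally show "ennreal \<bar>f x - poly_proj (ball c R) (m - 1) f x\<bar> \<le>
          ennreal C * riesz m R (\<lambda>z. ennreal (grad_abs m (ball c R) f z) * indicator (ball c R) z) x"
          by (simp add: G_def[abs_def] U_def)
      qed
    qed
  qed
  have "C > 0" using C1 CP by (simp add: C_def add_nonneg_pos)
  with main show ?thesis by (intro exI[of _ C]) blast
qed

text \<open>The weak norm is taken with respect to a normalized measure: the weight of a level set
  divided by that of \<open>B\<close> is at most \<open>1\<close>, so lowering the power
  \<open>1 / q\<close> enlarges it. This serves the case in which \<open>enn2real\<close> gives
  \<open>0\<close> for the constant of \<open>\<sigma>\<close>.\<close>

lemma weak_avg_mono_exponent: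
  assumes q: "0 < q" "q \<le> q'"
  shows "weak_avg q B w g \<le> weak_avg q' B w g"
  unfolding weak_avg_def
proof (rule SUP_mono)
  fix t :: real assume t: "t \<in> {0<..}"
  have "epowr (wmeas w {x \<in> B. \<bar>g x\<bar> > t} / wmeas w B) (1 / q) \<le> epowr (wmeas w {x \<in> B. \<bar>g x\<bar> > t} / wmeas w B) (1 / q')"
  proof -
    define y where "y = wmeas w {x \<in> B. \<bar>g x\<bar> > t} / wmeas w B"
    have "wmeas w {x \<in> B. \<bar>g x\<bar> > t} \<le> wmeas w B" by (rule wmeas_mono) auto
    then have "y \<le> wmeas w B / wmeas w B" unfolding y_def by (rule divide_right_mono_ennreal)
    also have "\<dots> \<le> 1"
    proof (cases "wmeas w B = 0 \<or> wmeas w B = top")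
      case False
      then show ?thesis by (simp add: ennreal_divide_self less_top)
    qed auto
    finally obtain z where z: "y = ennreal z" "0 \<le> z" "z \<le> 1"
      by (cases y) (auto simp: top_unique)
    show ?thesis
    proof (cases "z = 0")
      case True
      then show ?thesis using z q unfolding y_def[symmetric] by (simp add: epowr_def)
    next
      case False
      moreover have "z powr (1 / q) \<le> z powr (1 / q')"
        using z q False by (intro powr_mono') (auto simp: frac_le)
      ultimately show ?thesis
        using z unfolding y_def[symmetric] by (simp add: epowr_ennreal ennreal_leI)
    qed
  qed
  then show "\<exists>s\<in>{0<..}. ennreal t * epowr (wmeas w {x \<in> B. \<bar>g x\<bar> > t} / wmeas w B) (1 / q)
      \<le> ennreal s * epowr (wmeas w {x \<in> B. \<bar>g x\<bar> > s} / wmeas w B) (1 / q')"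
    using t by (intro bexI[of _ t] mult_left_mono) auto
qed

text \<open>Replaces the positive bound \<open>J\<close> by the integral itself as an element of
  \<open>[0, \<infinity>]\<close>. An infinite integral makes the right-hand side infinite, a
  vanishing one is reached by letting \<open>J\<close> tend to \<open>0\<close>, and if
  \<open>B\<close> has weight zero the left-hand side vanishes because
  \<open>0 / 0 = 0\<close>.\<close>

lemma riesz_weighted_estimate:
  fixes w G :: "'a::euclidean_space \<Rightarrow> ennreal" and f :: "'a \<Rightarrow> real" and m :: nat
  assumes dim: "DIM('a) \<ge> 2" and m: "m \<ge> 1" and p: "1 \<le> p" "real m * p < real DIM('a)"
    and r: "r \<ge> 1" "r \<le> p" and w: "w \<in> Ap_class r" and R: "R > 0" and B: "B = ball c R"
    and \<eta>: "s = r - (r - 1) * \<eta>" "s \<ge> 1"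
    and decay: "\<And>x k. r > 1 \<Longrightarrow> wmeas w B > 0 \<Longrightarrow> wmeas (dual_weight r w) (ball x (2 * R / 2 ^ k)) \<le>
      ennreal (2 * 2 powr (- (real k * DIM('a) * \<eta>))) * wmeas (dual_weight r w) (ball x (2 * R))"
    and q: "1 / p - 1 / q = real m / (real DIM('a) * s)" "q > 0"
    and G: "G \<in> borel_measurable lebesgue" and f: "\<And>t. {x \<in> B. \<bar>f x\<bar> > t} \<in> sets lebesgue"
    and C1: "C1 > 0" "AE x in lebesgue. x \<in> B \<longrightarrow> ennreal \<bar>f x\<bar> \<le> ennreal C1 * riesz m R G x"
  shows "weak_avg q B w f \<le> ennreal (C1 * (8 * unit_ball_vol DIM('a) * 5 ^ DIM('a) * 2 ^ m) * sobolev_exp DIM('a) m p) *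
     epowr (Ap_const r w) (1 / p) * ennreal (R ^ m) *
     epowr ((\<integral>\<^sup>+x. epowr (G x) p * w x \<partial>lebesgue) / wmeas w B) (1 / p)"
proof (cases "wmeas w B > 0")
  case False
  have "epowr (wmeas w {x \<in> B. \<bar>f x\<bar> > t} / wmeas w B) (1 / q) = 0" for t
  proof -
    have "wmeas w {x \<in> B. \<bar>f x\<bar> > t} \<le> wmeas w B" by (rule wmeas_mono) auto
    then show ?thesis using False q(2) by (simp add: epowr_def)
  qed
  then have "weak_avg q B w f = 0" unfolding weak_avg_def by simp
  then show ?thesis by simp
next
  case True
  have wt: "weight w" and fin: "Ap_const r w < \<infinity>" using w by (auto simp: Ap_class_def)
  define W where "W = enn2real (Ap_const r w)"
  have W: "W > 0" unfolding W_def by (rule Ap_const_pos[OF w r(1) B R True])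
  have AW: "Ap_const r w = ennreal W" unfolding W_def using fin by simp
  define wB where "wB = enn2real (wmeas w B)"
  have wB: "wmeas w B = ennreal wB" "wB > 0"
    using True wmeas_ball_finite[OF wt, of c R] B by (simp_all add: wB_def enn2real_positive_iff)
  define I where "I = (\<integral>\<^sup>+x. epowr (G x) p * w x \<partial>lebesgue)"
  define Q where "Q = C1 * (8 * unit_ball_vol DIM('a) * 5 ^ DIM('a) * 2 ^ m) * sobolev_exp DIM('a) m p"
  have Q: "Q > 0"
    using C1(1) p dim unit_ball_vol_pos[of "real DIM('a)"] by (simp add: Q_def sobolev_exp_def)
  have est: "weak_avg q B w f \<le> ennreal (Q * W powr (1 / p) * R ^ m * (J / wB) powr (1 / p))"
    if "J > 0" "I \<le> ennreal J" for J
    using riesz_weak_estimate[OF dim m p r w R B True \<eta> decay[OF _ True] q(2,1) G f C1 that(1)] that(2)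
    unfolding I_def W_def wB_def Q_def by simp
  have eW: "epowr (Ap_const r w) (1 / p) = ennreal (W powr (1 / p))"
    unfolding AW by (rule epowr_ennreal[OF W])
  show ?thesis
    unfolding eW I_def[symmetric] Q_def[symmetric]
  proof (cases I)
    case top
    then have "epowr (I / wmeas w B) (1 / p) = \<infinity>"
      using wB p by (simp add: wB(1) ennreal_top_divide epowr_def)
    then show "weak_avg q B w f \<le> ennreal Q * ennreal (W powr (1 / p)) * ennreal (R ^ m) * epowr (I / wmeas w B) (1 / p)"
      using Q W R by (simp add: ennreal_mult_top)
  next
    case (real J)
    show "weak_avg q B w f \<le> ennreal Q * ennreal (W powr (1 / p)) * ennreal (R ^ m) * epowr (I / wmeas w B) (1 / p)"
    proof (cases "J = 0")
      case True
      have "weak_avg q B w f \<le> 0"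
      proof (rule ennreal_le_epsilon)
        fix e :: real assume e: "e > 0"
        define k where "k = Q * W powr (1 / p) * R ^ m"
        have k: "k > 0" using Q W R by (simp add: k_def)
        \<comment> \<open>The value of \<open>J\<close> for which the bound becomes exactly
          \<open>e\<close>.\<close>
        define J' where "J' = wB * (e / k) powr p"
        have J': "J' > 0" using wB e k by (simp add: J'_def)
        have "weak_avg q B w f \<le> ennreal (k * (J' / wB) powr (1 / p))"
          unfolding k_def by (rule est[OF J']) (simp add: real True)
        also have "k * (J' / wB) powr (1 / p) = e"
          using wB e k p by (simp add: J'_def powr_powr)
        finally show "weak_avg q B w f \<le> 0 + ennreal e" by simp
      qed
      then show ?thesis by simp
    next
      case False
      then have J: "J > 0" using real by simp
      have "epowr (I / wmeas w B) (1 / p) = ennreal ((J / wB) powr (1 / p))"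
        using J wB by (simp add: real(2) wB(1) divide_ennreal epowr_ennreal)
      then show ?thesis
        using est[OF J] Q W R by (simp add: real(2) ennreal_mult)
    qed
  qed
qed

text \<open>
  The exponent \<open>s\<close> below is the one for which \<open>w\<close> still satisfies an \<open>A\<^sub>s\<close>-type condition on
  concentric balls. If \<open>[\<sigma>]\<close> is infinite, then \<open>enn2real\<close> turns it into \<open>0\<close> and \<open>q = p\<close>; the
  choice \<open>s = r\<close> then gives a larger exponent than needed.
\<close>

lemma is_qr_weighted_estimate:
  fixes w G :: "real^'n::finite \<Rightarrow> ennreal" and f :: "real^'n \<Rightarrow> real" and m :: nat
  assumes dim: "CARD('n) \<ge> 2" and m: "m \<ge> 1" and p: "1 \<le> p" "p < real CARD('n) / real m"
    and r: "1 \<le> r" "r \<le> p" and w: "w \<in> Ap_class r" and R: "R > 0" and B: "B = ball c R"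
    and qr: "is_qr m p r w q"
    and G: "G \<in> borel_measurable lebesgue" and f: "\<And>t. {x \<in> B. \<bar>f x\<bar> > t} \<in> sets lebesgue"
    and C1: "C1 > 0" "AE x in lebesgue. x \<in> B \<longrightarrow> ennreal \<bar>f x\<bar> \<le> ennreal C1 * riesz m R G x"
  shows "weak_avg q B w f \<le> ennreal (C1 * (8 * unit_ball_vol CARD('n) * 5 ^ CARD('n) * 2 ^ m) * sobolev_exp CARD('n) m p) *
     epowr (Ap_const r w) (1 / p) * ennreal (R ^ m) *
     epowr ((\<integral>\<^sup>+x. epowr (G x) p * w x \<partial>lebesgue) / wmeas w B) (1 / p)"
proof -
  define n where "n = real CARD('n)"
  have n: "n \<ge> 2" using dim by (simp add: n_def)
  have mp: "real m * p < n" using p m by (simp add: n_def field_simps)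
  have lt: "real m / (n * s) < 1 / p" if "s \<ge> 1" for s
  proof -
    have "real m * p < n * 1" using mp by simp
    also have "\<dots> \<le> n * s" using that n by (intro mult_left_mono) auto
    finally show ?thesis using p n that by (simp add: field_simps)
  qed
  have qpos: "q' > 0" if "1 / p - 1 / q' = real m / (n * s)" "s \<ge> 1" for q' s
  proof -
    have "1 / q' > 0" using lt[OF that(2)] that(1) by linarith
    then show ?thesis by simp
  qed
  have est: "weak_avg q' B w f \<le> ennreal (C1 * (8 * unit_ball_vol CARD('n) * 5 ^ CARD('n) * 2 ^ m) * sobolev_exp CARD('n) m p) *
     epowr (Ap_const r w) (1 / p) * ennreal (R ^ m) *
     epowr ((\<integral>\<^sup>+x. epowr (G x) p * w x \<partial>lebesgue) / wmeas w B) (1 / p)"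
    if "s = r - (r - 1) * \<eta>" "s \<ge> 1" "1 / p - 1 / q' = real m / (n * s)"
      and "\<And>x k. r > 1 \<Longrightarrow> wmeas w B > 0 \<Longrightarrow> wmeas (dual_weight r w) (ball x (2 * R / 2 ^ k)) \<le>
        ennreal (2 * 2 powr (- (real k * n * \<eta>))) * wmeas (dual_weight r w) (ball x (2 * R))" for s \<eta> q'
    by (rule riesz_weighted_estimate[where 'a = "real^'n", unfolded DIM_cart DIM_real mult_1_right,
          OF dim m p(1) mp[unfolded n_def] r w R B that(1,2) that(4)[unfolded n_def] that(3)[unfolded n_def]
          qpos[OF that(3,2)] G f C1])
  show ?thesis
  proof (cases "r = 1")
    case True
    \<comment> \<open>For \<open>r = 1\<close> the exponent is the classical one, with
      \<open>s = 1\<close>; the decay of the dual weight is then an empty condition.\<close>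
    have "q = n * p / (n - real m * p)" using qr True by (simp add: is_qr_def sobolev_exp_def n_def)
    then have "1 / q = (n - real m * p) / (n * p)" by simp
    also have "\<dots> = 1 / p - real m / n"
      using p n by (simp add: diff_divide_distrib)
    finally have "1 / p - 1 / q = real m / (n * 1)" by simp
    then show ?thesis using True by (intro est[of 1 0]) auto
  next
    case False
    then have r1: "r > 1" using r by simp
    define \<sigma> where "\<sigma> = dual_weight r w"
    define A where "A = enn2real (Ainf_const \<sigma>)"
    define T where "T = 2 ^ (CARD('n) + 1) * A"
    have q: "1 / p - 1 / q = real m / n * (T / (1 + r * (T - 1)))"
      using qr False by (simp add: is_qr_def Let_def T_def A_def \<sigma>_def dual_weight_def n_def)
    have \<sigma>: "wmeas \<sigma> (ball x t) < \<infinity>" "wmeas \<sigma> (ball x t) > 0" if "wmeas w B > 0" "t > 0" for x t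
      using Ap_ball_gt1[OF w r1 refl that(2), of x] Ap_positive[OF w r(1) _ that(2), of c R x] that(1) B
      by (simp_all add: \<sigma>_def)
    show ?thesis
    proof (cases "A = 0")
      case True
      then have "1 / p - 1 / q = 0" using q by (simp add: T_def)
      then have qp: "q = p" by simp
      define q' where "q' = 1 / (1 / p - real m / (n * r))"
      have q': "1 / p - 1 / q' = real m / (n * r)" by (simp add: q'_def)
      have "p \<le> q'"
      proof -
        have "0 < 1 / p - real m / (n * r)" using lt[OF r(1)] by simp
        moreover have "1 / p - real m / (n * r) \<le> 1 / p" using n r by simp
        ultimately have "1 / (1 / p) \<le> q'" unfolding q'_def using p by (intro divide_left_mono) auto
        then show ?thesis by simp
      qed
      then have "weak_avg q B w f \<le> weak_avg q' B w f"
        unfolding qp using p by (intro weak_avg_mono_exponent) auto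
      also have "\<dots> \<le> ennreal (C1 * (8 * unit_ball_vol CARD('n) * 5 ^ CARD('n) * 2 ^ m) * sobolev_exp CARD('n) m p) *
         epowr (Ap_const r w) (1 / p) * ennreal (R ^ m) *
         epowr ((\<integral>\<^sup>+x. epowr (G x) p * w x \<partial>lebesgue) / wmeas w B) (1 / p)"
      proof (rule est[of r 0])
        fix x and k :: nat
        have "2 * R / 2 ^ k \<le> 2 * R" using R by (simp add: divide_le_eq)
        then have "wmeas (dual_weight r w) (ball x (2 * R / 2 ^ k)) \<le> 1 * wmeas (dual_weight r w) (ball x (2 * R))"
          by (simp add: wmeas_mono subset_ball)
        also have "\<dots> \<le> ennreal (2 * 2 powr (- (real k * n * 0))) * wmeas (dual_weight r w) (ball x (2 * R))"
          by (intro mult_right_mono) auto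
        finally show "wmeas (dual_weight r w) (ball x (2 * R / 2 ^ k)) \<le>
          ennreal (2 * 2 powr (- (real k * n * 0))) * wmeas (dual_weight r w) (ball x (2 * R))" .
      qed (use r q' in auto)
      finally show ?thesis .
    next
      case False
      then have A: "A > 0" by (simp add: A_def less_le)
      have Afin: "Ainf_const \<sigma> < \<infinity>"
        using False by (auto simp: A_def less_top[symmetric])
      show ?thesis
      proof (cases "wmeas w B > 0")
        case wB: True
        have dim': "DIM(real^'n) \<ge> 2" using dim by simp
        have R2: "2 * R > 0" using R by simp
        note dec = Ainf_decay[OF dim' R2 Afin \<sigma>(1)[OF wB R2] \<sigma>(2)[OF wB]]
        have A1: "A \<ge> 1" using dec(1) by (simp add: A_def)
        have T1: "T \<ge> 1"
        proof -
          have "1 * 1 \<le> (2 :: real) ^ (CARD('n) + 1) * A"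
            using A1 by (intro mult_mono one_le_power) auto
          then show ?thesis by (simp add: T_def)
        qed
        define s where "s = r - (r - 1) * (1 / T)"
        have s1: "s \<ge> 1"
        proof -
          have "(r - 1) * (1 / T) \<le> (r - 1) * 1" using r T1 by (intro mult_left_mono) auto
          then show ?thesis by (simp add: s_def)
        qed
        \<comment> \<open>By this identity the defining relation of \<open>q_r\<close> becomes
          \<open>1 / p - 1 / q = m / (n s)\<close>, the form in which the exponent comes out of the
          estimate.\<close>
        have "T * s = 1 + r * (T - 1)" using T1 by (simp add: s_def field_simps)
        then have "T / (1 + r * (T - 1)) = 1 / s" using T1 s1 by (metis div_by_1 mult.commute mult_1 nonzero_divide_mult_cancel_right not_one_le_zero)
        then have qs: "1 / p - 1 / q = real m / (n * s)" using q by simp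
        show ?thesis
          by (rule est[OF s_def s1 qs]) (use dec(2) in \<open>simp add: \<sigma>_def[symmetric] T_def A_def n_def\<close>)
      next
        \<comment> \<open>In this case \<open>w\<close> vanishes almost everywhere and
          \<open>\<sigma>\<close> is infinite almost everywhere. Every quotient in
          \<open>Ainf_const\<close> has an infinite denominator and is therefore \<open>0\<close>,
          contrary to \<open>A > 0\<close>.\<close>
        case wB: False
        have [measurable]: "w \<in> borel_measurable lebesgue"
          using w by (simp add: Ap_class_def weight_measurable)
        have top: "wmeas \<sigma> (ball x t) = \<infinity>" if t: "t > 0" for x t
        proof -
          have [measurable]: "ball x t \<in> sets lebesgue" by simp
          have "\<not> wmeas w (ball x t) > 0"
            using Ap_positive[OF w r(1) _ R, of x t c] wB B by blast
          then have "(\<integral>\<^sup>+y. w y * indicator (ball x t) y \<partial>lebesgue) = 0"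
            by (simp add: wmeas_def)
          then have "AE y in lebesgue. w y * indicator (ball x t) y = 0"
            by (subst (asm) nn_integral_0_iff_AE) auto
          then have "AE y in lebesgue. \<sigma> y * indicator (ball x t) y = \<infinity> * indicator (ball x t) y"
            by eventually_elim
               (use r1 in \<open>auto simp: indicator_def \<sigma>_def dual_weight_def epowr_def one_minus_conj_exp\<close>)
          then have "wmeas \<sigma> (ball x t) = (\<integral>\<^sup>+y. \<infinity> * indicator (ball x t) y \<partial>lebesgue)"
            unfolding wmeas_def by (rule nn_integral_cong_AE)
          also have "\<dots> = \<infinity> * emeasure lebesgue (ball x t)"
            by (rule nn_integral_cmult_indicator) measurable
          also have "\<dots> = \<infinity>"
            using measure_lebesgue_ball_pos[OF t, of x] unfolding emeasure_lebesgue_ball by (simp add: ennreal_top_mult)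
          finally show ?thesis .
        qed
        have "Ainf_const \<sigma> \<le> 0"
          unfolding Ainf_const_def by (intro SUP_least) (auto simp: balls_def top)
        then have "A = 0" by (simp add: A_def)
        with False show ?thesis by simp
      qed
    qed
  qed
qed


section \<open>Measurability of level sets, and the conclusion\<close>

lemma poly_proj_polys:
  fixes c :: "real^'n::finite"
  assumes R: "R > 0"
  shows "poly_proj (ball c R) d f \<in> polys d"
proof -
  define \<Phi> where "\<Phi> = (SOME \<Phi>. orthonormal_basis (ball c R) d \<Phi>)"
  have "orthonormal_basis (ball c R) d \<Phi>"
    unfolding \<Phi>_def using orthonormal_basis_exists[OF R] by (rule someI_ex)
  then have "\<Phi> \<subseteq> polys d" by (simp add: orthonormal_basis_def)
  moreover have "poly_proj (ball c R) d f = (\<lambda>x. \<Sum>\<phi>\<in>\<Phi>. avg_inner (ball c R) f \<phi> * \<phi> x)"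
    by (simp add: poly_proj_def \<Phi>_def Let_def)
  ultimately show ?thesis by (auto intro!: polys_sum polys_cmult)
qed

lemma level_set_measurable:
  fixes c :: "real^'n::finite"
  assumes f: "set_integrable lebesgue (ball c R) f" and g: "g \<in> polys d"
  shows "{x \<in> ball c R. \<bar>f x - g x\<bar> > t} \<in> sets lebesgue"
proof -
  have fm [measurable]: "(\<lambda>x. indicat_real (ball c R) x * f x) \<in> borel_measurable lebesgue"
    using f by (simp add: set_integrable_def borel_measurable_integrable)
  have gm [measurable]: "g \<in> borel_measurable lebesgue" by (rule polys_measurable[OF g])
  have "{x \<in> space lebesgue. \<bar>indicat_real (ball c R) x * f x - g x\<bar> > t} \<in> sets lebesgue"
    by measurable
  then have "ball c R \<inter> {x \<in> space lebesgue. \<bar>indicat_real (ball c R) x * f x - g x\<bar> > t} \<in> sets lebesgue"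
    by (intro sets.Int) auto
  also have "ball c R \<inter> {x \<in> space lebesgue. \<bar>indicat_real (ball c R) x * f x - g x\<bar> > t} = {x \<in> ball c R. \<bar>f x - g x\<bar> > t}"
    by auto
  finally show ?thesis .
qed

theorem theorem2p10:
  fixes m :: nat
  assumes "CARD('n::finite) \<ge> 2" and "m \<ge> 1"
  shows "\<exists>C::real. C > 0 \<and>
    (\<forall>(p::real) (r::real) (q::real) (w :: real^'n \<Rightarrow> ennreal).
      1 \<le> p \<and> p < real CARD('n) / real m \<and> 1 \<le> r \<and> r \<le> p \<and> w \<in> Ap_class r \<and> is_qr m p r w q \<longrightarrow>
      (\<forall>(c :: real^'n) (\<rho>::real) (f :: real^'n \<Rightarrow> real).
        0 < \<rho> \<and> f \<in> sobolev_W1 m (ball c \<rho>) \<longrightarrow>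
        weak_avg q (ball c \<rho>) w (\<lambda>x. f x - poly_proj (ball c \<rho>) (m - 1) f x)
          \<le> ennreal (C * sobolev_exp CARD('n) m p) * epowr (Ap_const r w) (1 / p) * ennreal (\<rho> ^ m)
             * epowr ((\<integral>\<^sup>+x\<in>ball c \<rho>. ennreal (grad_abs m (ball c \<rho>) f x powr p) * w x \<partial>lebesgue)
                       / wmeas w (ball c \<rho>)) (1 / p)))"
proof -
  from sobolev_poly_proj_pointwise[OF assms(2), where 'n = 'n] obtain C1
    where C1: "C1 > 0 \<and> (\<forall>(c :: real^'n) R f. R > 0 \<longrightarrow> f \<in> sobolev_W1 m (ball c R) \<longrightarrow>
      (AE x in lebesgue. x \<in> ball c R \<longrightarrow> ennreal \<bar>f x - poly_proj (ball c R) (m - 1) f x\<bar> \<le>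
        ennreal C1 * riesz m R (\<lambda>z. ennreal (grad_abs m (ball c R) f z) * indicator (ball c R) z) x))"
    by (rule exE)
  then have C1pos: "C1 > 0" by (rule conjunct1)
  define C where "C = C1 * (8 * unit_ball_vol CARD('n) * 5 ^ CARD('n) * 2 ^ m)"
  have "unit_ball_vol (real CARD('n)) > 0" by (simp add: unit_ball_vol_pos)
  then have C: "C > 0" using C1pos unfolding C_def by (intro mult_pos_pos) auto
  have "weak_avg q (ball c \<rho>) w (\<lambda>x. f x - poly_proj (ball c \<rho>) (m - 1) f x)
      \<le> ennreal (C * sobolev_exp CARD('n) m p) * epowr (Ap_const r w) (1 / p) * ennreal (\<rho> ^ m)
         * epowr ((\<integral>\<^sup>+x\<in>ball c \<rho>. ennreal (grad_abs m (ball c \<rho>) f x powr p) * w x \<partial>lebesgue)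
                   / wmeas w (ball c \<rho>)) (1 / p)"
    if H: "1 \<le> p" "p < real CARD('n) / real m" "1 \<le> r" "r \<le> p" "w \<in> Ap_class r" "is_qr m p r w q"
      and \<rho>: "0 < \<rho>" and f: "f \<in> sobolev_W1 m (ball c \<rho>)"
    for p r q :: real and w :: "real^'n \<Rightarrow> ennreal" and c :: "real^'n" and \<rho> f
  proof -
    let ?B = "ball c \<rho>"
    define G where "G = (\<lambda>z. ennreal (grad_abs m ?B f z) * indicator ?B z)"
    have Gm: "G \<in> borel_measurable lebesgue"
      unfolding G_def by (rule grad_abs_measurable) (use sobolev_weak_deriv[OF f] in \<open>auto simp: has_weak_deriv_def\<close>)
    have lev: "{x \<in> ?B. \<bar>f x - poly_proj ?B (m - 1) f x\<bar> > t} \<in> sets lebesgue" for t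
      using f by (intro level_set_measurable[OF _ poly_proj_polys[OF \<rho>]]) (simp add: sobolev_W1_def)
    have ae: "AE x in lebesgue. x \<in> ?B \<longrightarrow> ennreal \<bar>f x - poly_proj ?B (m - 1) f x\<bar> \<le> ennreal C1 * riesz m \<rho> G x"
      unfolding G_def using C1 \<rho> f by blast
    \<comment> \<open>As \<open>p > 0\<close>, the real power and \<open>epowr\<close> agree also
      where the gradient vanishes, and outside the ball both sides are \<open>0\<close>.\<close>
    have "epowr (G x) p * w x = ennreal (grad_abs m ?B f x powr p) * w x * indicator ?B x" for x
    proof (cases "x \<in> ?B")
      case True
      have "grad_abs m ?B f x \<ge> 0" unfolding grad_abs_def by (intro sum_nonneg) auto
      then have "epowr (ennreal (grad_abs m ?B f x)) p = ennreal (grad_abs m ?B f x powr p)"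
        using H(1) by (cases "grad_abs m ?B f x = 0") (auto simp: epowr_def)
      then show ?thesis using True by (simp add: G_def)
    next
      case False
      then show ?thesis using H(1) by (simp add: G_def epowr_def)
    qed
    then have int: "(\<integral>\<^sup>+x. epowr (G x) p * w x \<partial>lebesgue)
        = (\<integral>\<^sup>+x\<in>?B. ennreal (grad_abs m ?B f x powr p) * w x \<partial>lebesgue)"
      by (intro nn_integral_cong)
    show ?thesis
      using is_qr_weighted_estimate[OF assms(1,2) H(1-5) \<rho> refl H(6) Gm lev C1pos ae]
      unfolding int C_def .
  qed
  with C show ?thesis by blast
qed

end
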